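(* Consider any element of the Thompson group $F$, represented by a bijection $f:P\to Q$ that preserves the dictionary order, where $P,Q\subset\{0,1\}^*$ are finite maximal prefix codes. Let $m=\max\{|p|:p\in P\}$ and $n=\max\{|q|:q\in Q\}$. If $f$ can be computed by a $\{0,1,\bot\}$-valued circuit of size $s$, then $f^{-1}:Q\to P$ can be computed by a combinational ($\{0,1,\bot\}$-valued) circuit of size $m(m+1)\,s+O(m^2n)$. Moreover, a circuit for $f^{-1}$ can be found from a circuit for $f$ deterministically in polynomial time in terms of $s,m,n$.
   Context: A prefix code is a set of words none of which is a prefix of another; it is maximal if not strictly contained in another prefix code. Dictionary order on $\{0,1\}^*$: $x_1\le_d x_2$ iff $x_1$ is a prefix of $x_2$, or $x_1=p0v_1$, $x_2=p1v_2$ for some words $p,v_1,v_2$. $F=F_{2,1}$ is the group whose elements are (classes, modulo extension/restriction $f(pz)=f(p)z$, of) dictionary-order-preserving bijections between finite maximal prefix codes over $\{0,1\}$. Padding: for a bijection $\varphi:P\to Q$ between finite maximal prefix codes with maximal word lengths $m$ and $n$ respectively, $\varphi^\bot:\{0,1,\bot\}^m\to\{0,1,\bot\}^n$ is defined by $\varphi^\bot(p\,\bot^{m-|p|})=\varphi(p)\,\bot^{n-|\varphi(p)|}$ for $p\in P$, and $\varphi^\bot(x)=\bot^n$ for all other $x\in\{0,1,\bot\}^m$. A $\{0,1,\bot\}$-valued circuit is an acyclic combinational circuit with gates from a fixed finite computationally universal set of ternary logic gates over $\{0,1,\bot\}$ together with the wire-swap operations $\tau_{i,i+1}$ (exchange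 of wires $i$ and $i+1$). It computes $\varphi:P\to Q$ if its input-output function is $\varphi^\bot$. The size of a circuit is its number of gates plus its number of wires (links between gates, or between gates and inputs or outputs); a gate applied at any wire position and a wire-swap each count as one gate. *)

theory Defs
  imports Main "HOL-Library.Sublist"
begin

section \<open>Prefix codes and the Thompson group F\<close>

text \<open>Words over \<open>{0,1}\<close> are boolean lists; \<open>False\<close> is the letter 0 and \<open>True\<close> the letter 1.\<close>

type_synonym word = "bool list"

definition prefix_code :: "word set \<Rightarrow> bool" where
  "prefix_code P \<longleftrightarrow> (\<forall>x\<in>P. \<forall>y\<in>P. prefix x y \<longrightarrow> x = y)"

definition maximal_prefix_code :: "word set \<Rightarrow> bool" where
  "maximal_prefix_code P \<longleftrightarrow> prefix_code P \<and> \<not> (\<exists>P'. prefix_code P' \<and> P \<subset> P')"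

definition dict_le :: "word \<Rightarrow> word \<Rightarrow> bool" where
  "dict_le x y \<longleftrightarrow> prefix x y \<or> (\<exists>p v w. x = p @ False # v \<and> y = p @ True # w)"

text \<open>The bijections \<open>f : P \<rightarrow> Q\<close> that represent the elements of F. Every element of F has such a
  representative, so a statement about all elements and all their representatives
  quantifies over all such \<open>P\<close>, \<open>Q\<close>, \<open>f\<close>. Only the values of \<open>f\<close> on \<open>P\<close> matter.\<close>

definition represents_F :: "word set \<Rightarrow> word set \<Rightarrow> (word \<Rightarrow> word) \<Rightarrow> bool" where
  "represents_F P Q f \<longleftrightarrow>
     finite P \<and> maximal_prefix_code P \<and> finite Q \<and> maximal_prefix_code Q \<and>
     bij_betw f P Q \<and> (\<forall>x\<in>P. \<forall>y\<in>P. dict_le x y \<longrightarrow> dict_le (f x) (f y))"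

definition maxlen :: "word set \<Rightarrow> nat" where
  "maxlen P = Max (length ` P)"


section \<open>Padding\<close>

text \<open>\<open>None\<close> is the third value, bottom.\<close>

type_synonym trit = "bool option"

definition pad :: "nat \<Rightarrow> word \<Rightarrow> trit list" where
  "pad k w = map Some w @ replicate (k - length w) None"

text \<open>The padded function of \<open>\<phi> : P \<rightarrow> Q\<close>. The word \<open>p\<close> is unique because padding to a fixed
  length is injective on the words of at most that length.\<close>

definition padded :: "word set \<Rightarrow> word set \<Rightarrow> (word \<Rightarrow> word) \<Rightarrow> trit list \<Rightarrow> trit list" where
  "padded P Q \<phi> x =
     (if \<exists>p\<in>P. x = pad (maxlen P) p
      then pad (maxlen Q) (\<phi> (THE p. p \<in> P \<and> x = pad (maxlen P) p))
      else replicate (maxlen Q) None)"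


section \<open>Circuits\<close>

record gate =
  gate_in :: nat
  gate_out :: nat
  gate_fun :: "trit list \<Rightarrow> trit list"

text \<open>The finite gate set is listed as \<open>G\<close>, so that a circuit names its gates by their index.\<close>

definition wf_gates :: "gate list \<Rightarrow> bool" where
  "wf_gates G \<longleftrightarrow>
     (\<forall>g\<in>set G. \<forall>x. length x = gate_in g \<longrightarrow> length (gate_fun g x) = gate_out g)"

text \<open>An acyclic circuit is given in topological order. The wires that are present at some stage
  are numbered; initially these are the inputs. \<open>Gate g ps\<close> links the inputs of gate number
  \<open>g\<close> to the wires at positions \<open>ps\<close> (fan-out is allowed) and adds the outputs of the gate as
  new last wires. \<open>Swap i\<close> is the operation \<open>\<tau>\<^sub>i\<^sub>,\<^sub>i\<^sub>+\<^sub>1\<close>, exchanging wires \<open>i\<close> and \<open>i + 1\<close>. The outputs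
  of the circuit are linked to the wires at positions \<open>circ_outs\<close>.\<close>

datatype operation = Gate nat "nat list" | Swap nat

record circuit =
  circ_in :: nat
  circ_ops :: "operation list"
  circ_outs :: "nat list"

fun exec_op :: "gate list \<Rightarrow> operation \<Rightarrow> trit list \<Rightarrow> trit list" where
  "exec_op G (Gate g ps) vs = vs @ gate_fun (G ! g) (map (\<lambda>p. vs ! p) ps)"
| "exec_op G (Swap i) vs = vs[i := vs ! Suc i, Suc i := vs ! i]"

definition eval_circuit :: "gate list \<Rightarrow> circuit \<Rightarrow> trit list \<Rightarrow> trit list" where
  "eval_circuit G c x = (let vs = fold (exec_op G) (circ_ops c) x in map (\<lambda>p. vs ! p) (circ_outs c))"

text \<open>\<open>wf_ops G w os ps\<close>: with \<open>w\<close> wires present, the operations \<open>os\<close> followed by output links to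
  the positions \<open>ps\<close> only use existing gates and existing wires.\<close>

fun wf_ops :: "gate list \<Rightarrow> nat \<Rightarrow> operation list \<Rightarrow> nat list \<Rightarrow> bool" where
  "wf_ops G w [] ps \<longleftrightarrow> (\<forall>p\<in>set ps. p < w)"
| "wf_ops G w (Gate g qs # os) ps \<longleftrightarrow>
     g < length G \<and> length qs = gate_in (G ! g) \<and> (\<forall>q\<in>set qs. q < w) \<and>
     wf_ops G (w + gate_out (G ! g)) os ps"
| "wf_ops G w (Swap i # os) ps \<longleftrightarrow> Suc i < w \<and> wf_ops G w os ps"

definition wf_circuit :: "gate list \<Rightarrow> circuit \<Rightarrow> bool" where
  "wf_circuit G c \<longleftrightarrow> wf_ops G (circ_in c) (circ_ops c) (circ_outs c)"

text \<open>Every wire (link) is counted at its end, which is an input of a gate or of a swap, or an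
  output of the circuit.\<close>

fun op_links :: "operation \<Rightarrow> nat" where
  "op_links (Gate g ps) = length ps"
| "op_links (Swap i) = 2"

definition num_gates :: "circuit \<Rightarrow> nat" where
  "num_gates c = length (circ_ops c)"

definition num_wires :: "circuit \<Rightarrow> nat" where
  "num_wires c = sum_list (map op_links (circ_ops c)) + length (circ_outs c)"

definition circuit_size :: "circuit \<Rightarrow> nat" where
  "circuit_size c = num_gates c + num_wires c"

definition has_io_function ::
    "gate list \<Rightarrow> circuit \<Rightarrow> nat \<Rightarrow> nat \<Rightarrow> (trit list \<Rightarrow> trit list) \<Rightarrow> bool" where
  "has_io_function G c a b h \<longleftrightarrow>
     wf_circuit G c \<and> circ_in c = a \<and> length (circ_outs c) = b \<and>
     (\<forall>x. length x = a \<longrightarrow> eval_circuit G c x = h x)"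

definition computes ::
    "gate list \<Rightarrow> circuit \<Rightarrow> word set \<Rightarrow> word set \<Rightarrow> (word \<Rightarrow> word) \<Rightarrow> bool" where
  "computes G c P Q \<phi> \<longleftrightarrow> has_io_function G c (maxlen P) (maxlen Q) (padded P Q \<phi>)"

text \<open>Functions without inputs are not required, so a universal set need not contain a gate
  without inputs.\<close>

definition universal :: "gate list \<Rightarrow> bool" where
  "universal G \<longleftrightarrow>
     (\<forall>a b h. 1 \<le> a \<and> (\<forall>x. length x = a \<longrightarrow> length (h x) = b) \<longrightarrow>
        (\<exists>c. has_io_function G c a b h))"


section \<open>Deterministic Turing machines\<close>

text \<open>Deterministic multi-tape machines with two-way infinite tapes. The tape symbols are the
  numbers below \<open>tm_symbols\<close>, with 0 as the blank; the states are the numbers below \<open>tm_states\<close>,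
  with 0 as the start state; the additional state \<open>tm_states\<close> is the halting state. The input is
  written on tape 0, the output on tape 1.\<close>

datatype move = MLeft | MStay | MRight

fun shift :: "move \<Rightarrow> int" where
  "shift MLeft = -1"
| "shift MStay = 0"
| "shift MRight = 1"

record tm =
  tm_tapes :: nat
  tm_symbols :: nat
  tm_states :: nat
  tm_trans :: "nat \<Rightarrow> nat list \<Rightarrow> nat \<times> (nat \<times> move) list"

definition wf_tm :: "tm \<Rightarrow> bool" where
  "wf_tm M \<longleftrightarrow> 2 \<le> tm_tapes M \<and> 3 \<le> tm_symbols M \<and>
     (\<forall>q < tm_states M. \<forall>xs. length xs = tm_tapes M \<and> (\<forall>x\<in>set xs. x < tm_symbols M) \<longrightarrow>
        (case tm_trans M q xs of (q', as) \<Rightarrow>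
           q' \<le> tm_states M \<and> length as = tm_tapes M \<and> (\<forall>(y, d)\<in>set as. y < tm_symbols M)))"

text \<open>A tape consists of its contents and its head position.\<close>

type_synonym tape = "(int \<Rightarrow> nat) \<times> int"

fun tape_step :: "tape \<Rightarrow> nat \<times> move \<Rightarrow> tape" where
  "tape_step (t, h) (y, d) = (t(h := y), h + shift d)"

fun tm_step :: "tm \<Rightarrow> nat \<times> tape list \<Rightarrow> nat \<times> tape list" where
  "tm_step M (q, ts) =
     (if q < tm_states M
      then (case tm_trans M q (map (\<lambda>(t, h). t h) ts) of (q', as) \<Rightarrow> (q', map2 tape_step ts as))
      else (q, ts))"

definition word_tape :: "nat list \<Rightarrow> int \<Rightarrow> nat" where
  "word_tape w i = (if 0 \<le> i \<and> i < int (length w) then w ! nat i else 0)"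

definition tm_init :: "tm \<Rightarrow> nat list \<Rightarrow> nat \<times> tape list" where
  "tm_init M w = (0, (word_tape w, 0) # replicate (tm_tapes M - 1) (word_tape [], 0))"

definition tm_outputs_within :: "tm \<Rightarrow> nat list \<Rightarrow> nat list \<Rightarrow> nat \<Rightarrow> bool" where
  "tm_outputs_within M w v T \<longleftrightarrow>
     (\<exists>t\<le>T. case (tm_step M ^^ t) (tm_init M w) of (q, ts) \<Rightarrow>
        q = tm_states M \<and> fst (ts ! 1) = word_tape v)"

text \<open>Circuits as words over the symbols 1 and 2: a list of numbers, each in unary notation. In a
  well-formed circuit all these numbers are linear in the size and the number of inputs (for a fixed
  gate set), so for polynomial time bounds this is interchangeable with binary notation.\<close>

definition enc_nat :: "nat \<Rightarrow> nat list" where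
  "enc_nat k = replicate k 1 @ [2]"

fun op_numbers :: "operation \<Rightarrow> nat list" where
  "op_numbers (Gate g ps) = 0 # g # length ps # ps"
| "op_numbers (Swap i) = [1, i]"

definition circuit_numbers :: "circuit \<Rightarrow> nat list" where
  "circuit_numbers c =
     circ_in c # length (circ_ops c) # concat (map op_numbers (circ_ops c)) @
     length (circ_outs c) # circ_outs c"

definition enc_circuit :: "circuit \<Rightarrow> nat list" where
  "enc_circuit c = concat (map enc_nat (circuit_numbers c))"

end

theory Submission
  imports Defs
begin

text \<open>
  Given \<open>y = f x\<close>, the word \<open>x\<close> is found letter by letter. Suppose that \<open>u\<close> is a proper prefix
  of \<open>x\<close>. As \<open>P\<close> is a maximal prefix code, \<open>u10\<^sup>j\<close> belongs to \<open>P\<close> for exactly one \<open>j\<close>, and it is the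
  least element of \<open>P\<close> that begins with \<open>u1\<close>; hence \<open>u1\<close> is a prefix of \<open>x\<close> iff \<open>f (u10\<^sup>j) \<le> y\<close> in the
  dictionary order. If \<open>u = x\<close> or \<open>u\<close> contains a padding symbol, then \<open>u10\<^sup>j\<close> is never in \<open>P\<close>. So one
  evaluates \<open>f\<close> at \<open>u10\<^sup>j\<close> for all \<open>j < m\<close> and takes the first result that is not
  bottom. This uses \<open>m\<^sup>2\<close> copies of the circuit, and one more copy checks that the word found is
  mapped to \<open>y\<close>; \<open>m\<^sup>2 + 1 \<le> m (m + 1)\<close>. The exchanges of wires are first
  removed by renaming, so that the inputs of a copy can be any existing wires.

  The numbering of the wires of the new circuit has a closed form, so the new circuit can be printed
  by nested loops that only keep numbers of polynomial size. A function whose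
  value is defined by such loops from the numbers on the input tape is computed by a
  program with registers in unary notation, which takes one tape per register.
\<close>

section \<open>Register programs and their compilation to Turing machines\<close>

text \<open>The letters are found one after another, since the probes for letter \<open>i\<close>
  contain the letters before it. The number of zeros after \<open>u1\<close> is unknown to the
  circuit, so all \<open>m\<close> probes are evaluated, and those outside the code betray
  themselves by the value bottom. To see this from a single trit, no word of \<open>Q\<close> may be
  empty; the one exception, \<open>P = Q = {[]}\<close>, needs no wires and is treated apart. The
  final check is there because an input that is not a padded word of \<open>Q\<close> still leads to
  some candidate. Universality only promises circuits with at least one input, so there may be no
  constant gates; a gadget fed with an arbitrary wire supplies 0, 1 and bottom. One gadget with a
  selector input does all the extra work, so that every stage has the same size and each wire number
  is a simple formula in the indices. A stage contains \<open>n + 1\<close> gadgets of constant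
  size, whence the term \<open>O(m^2 n)\<close>. A single machine has to serve all circuits, and its
  building blocks are correct on arbitrary lists of numbers, also on lists that encode no
  circuit.\<close>

datatype test = Pos nat | Sym nat

datatype com =
    Inc nat | Dec nat | GoL | GoR | Out nat
  | Seq com com (infixr ";;" 60)
  | Ite test com com
  | While test com

type_synonym store = "(nat \<Rightarrow> nat) \<times> int \<times> nat list"

fun holds :: "nat list \<Rightarrow> test \<Rightarrow> store \<Rightarrow> bool" where
  "holds w (Pos r) (R, h, u) \<longleftrightarrow> 0 < R r"
| "holds w (Sym y) (R, h, u) \<longleftrightarrow> word_tape w h = y"

text \<open>The time is the exact number of machine steps of the compiled code: \<open>Inc\<close>
  first moves and then writes, a test costs one step, and a branch or loop body that is left by a
  jump costs one more.\<close>

inductive run :: "nat list \<Rightarrow> com \<Rightarrow> store \<Rightarrow> nat \<Rightarrow> store \<Rightarrow> bool" for w where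
  run_Inc: "run w (Inc r) (R, h, u) 2 (R(r := Suc (R r)), h, u)"
| run_Dec: "run w (Dec r) (R, h, u) 1 (R(r := R r - 1), h, u)"
| run_GoL: "run w GoL (R, h, u) 1 (R, h - 1, u)"
| run_GoR: "run w GoR (R, h, u) 1 (R, h + 1, u)"
| run_Out: "run w (Out y) (R, h, u) 1 (R, h, u @ [y])"
| run_Seq: "run w c s t s' \<Longrightarrow> run w d s' t' s'' \<Longrightarrow> run w (c ;; d) s (t + t') s''"
| run_Ite_True: "holds w b s \<Longrightarrow> run w c s t s' \<Longrightarrow> run w (Ite b c d) s (t + 2) s'"
| run_Ite_False: "\<not> holds w b s \<Longrightarrow> run w d s t s' \<Longrightarrow> run w (Ite b c d) s (t + 1) s'"
| run_While_False: "\<not> holds w b s \<Longrightarrow> run w (While b c) s 1 s"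
| run_While_True: "holds w b s \<Longrightarrow> run w c s t s' \<Longrightarrow> run w (While b c) s' t' s'' \<Longrightarrow>
    run w (While b c) s (t + t' + 2) s''"

fun tests_ok :: "nat \<Rightarrow> test \<Rightarrow> bool" where
  "tests_ok K (Pos r) \<longleftrightarrow> r < K"
| "tests_ok K (Sym y) \<longleftrightarrow> True"

fun regs_below :: "nat \<Rightarrow> com \<Rightarrow> bool" where
  "regs_below K (Inc r) \<longleftrightarrow> r < K"
| "regs_below K (Dec r) \<longleftrightarrow> r < K"
| "regs_below K (Out y) \<longleftrightarrow> y < 3"
| "regs_below K (c ;; d) \<longleftrightarrow> regs_below K c \<and> regs_below K d"
| "regs_below K (Ite b c d) \<longleftrightarrow> tests_ok K b \<and> regs_below K c \<and> regs_below K d"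
| "regs_below K (While b c) \<longleftrightarrow> tests_ok K b \<and> regs_below K c"
| "regs_below K _ \<longleftrightarrow> True"

lemma tests_ok_mono: "tests_ok K b \<Longrightarrow> K \<le> K' \<Longrightarrow> tests_ok K' b"
  by (cases b) auto

lemma regs_below_mono: "regs_below K c \<Longrightarrow> K \<le> K' \<Longrightarrow> regs_below K' c"
  by (induction c) (auto intro: tests_ok_mono)

text \<open>The two extra states of \<open>Ite\<close> and \<open>While\<close> are the test in
  front and the jump after the first branch or the body.\<close>

fun states :: "com \<Rightarrow> nat" where
  "states (Inc r) = 2"
| "states (c ;; d) = states c + states d"
| "states (Ite b c d) = states c + states d + 2"
| "states (While b c) = states c + 2"
| "states _ = 1"

fun sees :: "nat list \<Rightarrow> test \<Rightarrow> bool" where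
  "sees xs (Pos r) \<longleftrightarrow> xs ! (r + 2) = 1"
| "sees xs (Sym y) \<longleftrightarrow> xs ! 0 = y"

abbreviation keep :: "nat list \<Rightarrow> (nat \<times> move) list" where
  "keep xs \<equiv> map (\<lambda>x. (x, MStay)) xs"

text \<open>The code of a command occupies the states from \<open>a\<close> on and is left in the first state after
  them.\<close>

fun code_trans :: "com \<Rightarrow> nat \<Rightarrow> nat \<Rightarrow> nat list \<Rightarrow> nat \<times> (nat \<times> move) list" where
  "code_trans (Inc r) a q xs =
     (if q = a then (a + 1, (keep xs)[r + 2 := (xs ! (r + 2), MRight)])
      else (a + 2, (keep xs)[r + 2 := (1, MStay)]))"
| "code_trans (Dec r) a q xs =
     (a + 1, if xs ! (r + 2) = 1 then (keep xs)[r + 2 := (0, MLeft)] else keep xs)"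
| "code_trans GoL a q xs = (a + 1, (keep xs)[0 := (xs ! 0, MLeft)])"
| "code_trans GoR a q xs = (a + 1, (keep xs)[0 := (xs ! 0, MRight)])"
| "code_trans (Out y) a q xs = (a + 1, (keep xs)[1 := (y, MRight)])"
| "code_trans (c ;; d) a q xs =
     (if q < a + states c then code_trans c a q xs else code_trans d (a + states c) q xs)"
| "code_trans (Ite b c d) a q xs =
     (if q = a then (if sees xs b then a + 1 else a + states c + 2, keep xs)
      else if q < a + 1 + states c then code_trans c (a + 1) q xs
      else if q = a + 1 + states c then (a + states c + states d + 2, keep xs)
      else code_trans d (a + states c + 2) q xs)"
| "code_trans (While b c) a q xs =
     (if q = a then (if sees xs b then a + 1 else a + states c + 2, keep xs)
      else if q < a + 1 + states c then code_trans c (a + 1) q xs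
      else (a, keep xs))"

text \<open>Cell 0 of a register tape stays blank, so that the head sees a 1 iff the register is not 0.\<close>

definition reg_tape :: "nat \<Rightarrow> tape" where
  "reg_tape v = ((\<lambda>i. if 1 \<le> i \<and> i \<le> int v then 1 else 0), int v)"

fun tapes :: "nat \<Rightarrow> nat list \<Rightarrow> store \<Rightarrow> tape list" where
  "tapes K w (R, h, u) =
     (word_tape w, h) # (word_tape u, int (length u)) # map (\<lambda>r. reg_tape (R r)) [0..<K]"

definition machine :: "nat \<Rightarrow> com \<Rightarrow> tm" where
  "machine K c = \<lparr>tm_tapes = K + 2, tm_symbols = 3, tm_states = states c, tm_trans = code_trans c 0\<rparr>"

lemma code_trans_wf:
  assumes "regs_below K c" "length xs = K + 2" "\<forall>x\<in>set xs. x < 3" "a \<le> q" "q < a + states c"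
  shows "case code_trans c a q xs of (q', as) \<Rightarrow>
    q' \<le> a + states c \<and> length as = K + 2 \<and> (\<forall>(y, d)\<in>set as. y < 3)"
  using assms
proof (induction c arbitrary: a)
  case (Seq c d)
  show ?case
  proof (cases "q < a + states c")
    case True
    then show ?thesis using Seq.IH(1)[of a] Seq.prems by (auto split: prod.splits)
  next
    case False
    then show ?thesis using Seq.IH(2)[of "a + states c"] Seq.prems by (auto split: prod.splits)
  qed
next
  case (Ite b c d)
  show ?case
    using Ite.IH(1)[of "a + 1"] Ite.IH(2)[of "a + states c + 2"] Ite.prems
    by (auto split: prod.splits)
next
  case (While b c)
  show ?case
    using While.IH[of "a + 1"] While.prems by (auto split: prod.splits)
qed (auto dest!: set_update_subset_insert[THEN subsetD])

lemma wf_tm_machine: "regs_below K c \<Longrightarrow> wf_tm (machine K c)"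
  using code_trans_wf[of K c _ 0] by (auto simp: wf_tm_def machine_def)

definition heads :: "tape list \<Rightarrow> nat list" where
  "heads ts = map (\<lambda>(t, h). t h) ts"

lemma step_keep:
  "map2 tape_step ts (keep (heads ts)) = ts"
  by (rule nth_equalityI) (auto simp: heads_def split: prod.split)

lemma step_update:
  assumes "j < length ts"
  shows "map2 tape_step ts ((keep (heads ts))[j := a]) = ts[j := tape_step (ts ! j) a]"
proof (rule nth_equalityI)
  fix i assume "i < length (map2 tape_step ts ((keep (heads ts))[j := a]))"
  then show "map2 tape_step ts ((keep (heads ts))[j := a]) ! i = ts[j := tape_step (ts ! j) a] ! i"
    using assms by (cases "i = j") (auto simp: heads_def split: prod.split)
qed (simp add: heads_def)

lemma tm_step_eq:
  "q < tm_states M \<Longrightarrow>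
    tm_step M (q, ts) = (case tm_trans M q (heads ts) of (q', as) \<Rightarrow> (q', map2 tape_step ts as))"
  by (simp add: heads_def)

lemma reg_tape_head: "(case reg_tape v of (t, h) \<Rightarrow> t h) = (if 0 < v then 1 else 0)"
  by (simp add: reg_tape_def)

lemma reg_tape_right:
  "tape_step (reg_tape v) (if 0 < v then 1 else 0, MRight) = (fst (reg_tape v), int v + 1)"
  by (auto simp: reg_tape_def fun_eq_iff)

lemma length_tapes [simp]: "length (tapes K w s) = K + 2"
  by (cases s) auto

lemma heads_reg: "r < K \<Longrightarrow> heads (tapes K w (R, h, u)) ! Suc (Suc r) = (if 0 < R r then 1 else 0)"
  by (simp add: heads_def reg_tape_head)

lemma heads_input: "heads (tapes K w (R, h, u)) ! 0 = word_tape w h"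
  by (simp add: heads_def)

lemma sees_iff_holds: "tests_ok K b \<Longrightarrow> sees (heads (tapes K w s)) b \<longleftrightarrow> holds w b s"
  by (cases s; cases b) (auto simp: heads_reg heads_input simp del: tapes.simps)

lemma tapes_reg_update:
  "r < K \<Longrightarrow> (tapes K w (R, h, u))[r + 2 := reg_tape v] = tapes K w (R(r := v), h, u)"
  by (auto simp: list_eq_iff_nth_eq nth_list_update nth_Cons split: nat.split)

lemma word_tape_snoc: "(word_tape u)(int (length u) := y) = word_tape (u @ [y])"
  by (auto simp: word_tape_def fun_eq_iff nth_append)

text \<open>Stated for any machine that agrees with the code on the states from \<open>a\<close> up
  to \<open>a + states c\<close>, because the code of a subcommand is only a part of the whole
  program. Those states lie below the halting state, so each of the \<open>t\<close> steps is really
  taken.\<close>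

lemma run_machine:
  assumes "run w c s t s'" "regs_below K c" "a + states c \<le> tm_states M"
    "\<And>q xs. a \<le> q \<Longrightarrow> q < a + states c \<Longrightarrow> tm_trans M q xs = code_trans c a q xs"
  shows "(tm_step M ^^ t) (a, tapes K w s) = (a + states c, tapes K w s')"
  using assms
proof (induction arbitrary: a rule: run.induct)
  case (run_Inc r R h u)
  let ?ts = "tapes K w (R, h, u)"
  \<comment> \<open>Between the two steps of \<open>Inc\<close> this is not a register tape: the
    head is one cell beyond the unary number, where the second step writes a 1.\<close>
  let ?ts' = "?ts[r + 2 := (fst (reg_tape (R r)), int (R r) + 1)]"
  have r: "r < K" using run_Inc by simp
  have nth: "?ts ! (r + 2) = reg_tape (R r)" using r by simp
  have "tm_step M (a, ?ts) = (a + 1, map2 tape_step ?ts ((keep (heads ?ts))[r + 2 := (heads ?ts ! (r + 2), MRight)]))"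
    using run_Inc by (simp add: tm_step_eq del: tm_step.simps tapes.simps)
  also have "\<dots> = (a + 1, ?ts')"
    using r nth reg_tape_right[of "R r"] by (subst step_update) (simp_all add: heads_reg del: tapes.simps)
  finally have 1: "tm_step M (a, ?ts) = (a + 1, ?ts')" .
  have nth': "?ts' ! (r + 2) = (fst (reg_tape (R r)), int (R r) + 1)" using r by (simp del: tapes.simps)
  have "tm_step M (a + 1, ?ts') = (a + 2, map2 tape_step ?ts' ((keep (heads ?ts'))[r + 2 := (1, MStay)]))"
    using run_Inc by (simp add: tm_step_eq del: tm_step.simps tapes.simps)
  also have "\<dots> = (a + 2, ?ts'[r + 2 := tape_step (fst (reg_tape (R r)), int (R r) + 1) (1, MStay)])"
    using r nth' by (subst step_update) (auto simp del: tapes.simps)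
  also have "tape_step (fst (reg_tape (R r)), int (R r) + 1) (1, MStay) = reg_tape (Suc (R r))"
    by (auto simp: reg_tape_def fun_eq_iff)
  finally have 2: "tm_step M (a + 1, ?ts') = (a + 2, tapes K w (R(r := Suc (R r)), h, u))"
    using r tapes_reg_update[of r K w R h u "Suc (R r)"] by (simp del: tm_step.simps tapes.simps)
  show ?case using 1 2 by (simp add: numeral_2_eq_2 del: tm_step.simps tapes.simps)
next
  case (run_Dec r R h u)
  let ?ts = "tapes K w (R, h, u)"
  have r: "r < K" using run_Dec by simp
  have nth: "?ts ! (r + 2) = reg_tape (R r)" using r by simp
  have "tm_step M (a, ?ts) = (a + 1, tapes K w (R(r := R r - 1), h, u))"
  proof (cases "R r")
    case 0
    have "tm_step M (a, ?ts) = (a + 1, map2 tape_step ?ts (keep (heads ?ts)))"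
      using run_Dec 0 heads_reg[OF r, of w R h u] by (simp add: tm_step_eq del: tm_step.simps tapes.simps)
    then show ?thesis using 0 by (simp add: step_keep fun_upd_idem del: tm_step.simps tapes.simps)
  next
    case (Suc v)
    have "tm_step M (a, ?ts) = (a + 1, map2 tape_step ?ts ((keep (heads ?ts))[r + 2 := (0, MLeft)]))"
      using run_Dec Suc heads_reg[OF r, of w R h u] by (simp add: tm_step_eq del: tm_step.simps tapes.simps)
    also have "\<dots> = (a + 1, ?ts[r + 2 := reg_tape v])"
      using r nth Suc by (subst step_update) (auto simp: reg_tape_def fun_eq_iff simp del: tapes.simps intro!: arg_cong[where f="list_update _ _"])
    finally show ?thesis using r tapes_reg_update[of r K w R h u v] Suc by (simp del: tm_step.simps tapes.simps)
  qed
  then show ?case by (simp del: tm_step.simps tapes.simps)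
next
  case (run_GoL R h u)
  let ?ts = "tapes K w (R, h, u)"
  have "tm_step M (a, ?ts) = (a + 1, map2 tape_step ?ts ((keep (heads ?ts))[0 := (heads ?ts ! 0, MLeft)]))"
    using run_GoL by (simp add: tm_step_eq del: tm_step.simps tapes.simps)
  also have "\<dots> = (a + 1, tapes K w (R, h - 1, u))"
    by (subst step_update) (auto simp: heads_def)
  finally show ?case by (simp del: tm_step.simps tapes.simps)
next
  case (run_GoR R h u)
  let ?ts = "tapes K w (R, h, u)"
  have "tm_step M (a, ?ts) = (a + 1, map2 tape_step ?ts ((keep (heads ?ts))[0 := (heads ?ts ! 0, MRight)]))"
    using run_GoR by (simp add: tm_step_eq del: tm_step.simps tapes.simps)
  also have "\<dots> = (a + 1, tapes K w (R, h + 1, u))"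
    by (subst step_update) (auto simp: heads_def)
  finally show ?case by (simp del: tm_step.simps tapes.simps)
next
  case (run_Out y R h u)
  let ?ts = "tapes K w (R, h, u)"
  have "tm_step M (a, ?ts) = (a + 1, map2 tape_step ?ts ((keep (heads ?ts))[1 := (y, MRight)]))"
    using run_Out by (simp add: tm_step_eq del: tm_step.simps tapes.simps)
  also have "\<dots> = (a + 1, tapes K w (R, h, u @ [y]))"
    by (subst step_update) (auto simp: word_tape_snoc)
  finally show ?case by (simp del: tm_step.simps tapes.simps)
next
  case (run_Seq c s t s' d t' s'')
  have 1: "(tm_step M ^^ t) (a, tapes K w s) = (a + states c, tapes K w s')"
    using run_Seq.prems by (intro run_Seq.IH(1)) auto
  have 2: "(tm_step M ^^ t') (a + states c, tapes K w s') = (a + states c + states d, tapes K w s'')"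
    using run_Seq.prems by (intro run_Seq.IH(2)) auto
  show ?case using 1 2 by (subst add.commute) (simp add: funpow_add add.assoc del: tm_step.simps)
next
  case (run_Ite_True b s c t s' d)
  have 0: "tm_step M (a, tapes K w s) = (a + 1, tapes K w s)"
    using run_Ite_True.prems run_Ite_True.hyps
    by (simp add: tm_step_eq sees_iff_holds step_keep del: tm_step.simps)
  have 1: "(tm_step M ^^ t) (a + 1, tapes K w s) = (a + 1 + states c, tapes K w s')"
    using run_Ite_True.prems by (intro run_Ite_True.IH) auto
  have 2: "tm_step M (a + 1 + states c, tapes K w s') = (a + states c + states d + 2, tapes K w s')"
    using run_Ite_True.prems by (simp add: tm_step_eq step_keep del: tm_step.simps)
  have "(tm_step M ^^ (t + 2)) (a, tapes K w s) = tm_step M ((tm_step M ^^ t) (tm_step M (a, tapes K w s)))"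
    by (simp add: funpow_swap1 del: tm_step.simps)
  then show ?case using 0 1 2 by (simp del: tm_step.simps)
next
  case (run_Ite_False b s d t s' c)
  have 0: "tm_step M (a, tapes K w s) = (a + states c + 2, tapes K w s)"
    using run_Ite_False.prems run_Ite_False.hyps
    by (simp add: tm_step_eq sees_iff_holds step_keep del: tm_step.simps)
  have 1: "(tm_step M ^^ t) (a + states c + 2, tapes K w s) = (a + states c + 2 + states d, tapes K w s')"
    using run_Ite_False.prems by (intro run_Ite_False.IH) auto
  have "(tm_step M ^^ (t + 1)) (a, tapes K w s) = (tm_step M ^^ t) (tm_step M (a, tapes K w s))"
    by (simp add: funpow_swap1 del: tm_step.simps)
  then show ?case using 0 1 by (simp del: tm_step.simps)
next
  case (run_While_False b s c)
  then show ?case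
    by (simp add: tm_step_eq sees_iff_holds step_keep del: tm_step.simps)
next
  case (run_While_True b s c t s' t' s'')
  have 0: "tm_step M (a, tapes K w s) = (a + 1, tapes K w s)"
    using run_While_True.prems run_While_True.hyps
    by (simp add: tm_step_eq sees_iff_holds step_keep del: tm_step.simps)
  have 1: "(tm_step M ^^ t) (a + 1, tapes K w s) = (a + 1 + states c, tapes K w s')"
    using run_While_True.prems by (intro run_While_True.IH(1)) auto
  have 2: "tm_step M (a + 1 + states c, tapes K w s') = (a, tapes K w s')"
    using run_While_True.prems by (simp add: tm_step_eq step_keep del: tm_step.simps)
  have 3: "(tm_step M ^^ t') (a, tapes K w s') = (a + states (While b c), tapes K w s'')"
    using run_While_True.prems by (intro run_While_True.IH(2)) auto
  \<comment> \<open>\<open>funpow_add\<close> applies the right summand first, so the sum is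
    arranged backwards, from the remaining rounds to the first test.\<close>
  have eq: "t + t' + 2 = t' + (1 + (t + 1))" by simp
  have "(tm_step M ^^ (t + t' + 2)) (a, tapes K w s) =
      (tm_step M ^^ t') (tm_step M ((tm_step M ^^ t) (tm_step M (a, tapes K w s))))"
    by (simp only: eq funpow_add o_apply One_nat_def funpow.simps id_apply)
  then show ?case using 0 1 2 3 by (simp del: tm_step.simps)
qed

text \<open>A blank tape with its head on cell 0 represents the number 0, so the initial
  configuration is already that of the store with all registers 0.\<close>

lemma machine_outputs:
  assumes "run w c (\<lambda>_. 0, 0, []) t (R, h, u)" "regs_below K c" "t \<le> T"
  shows "tm_outputs_within (machine K c) w u T"
proof -
  have "(tm_step (machine K c) ^^ t) (0, tapes K w (\<lambda>_. 0, 0, [])) = (0 + states c, tapes K w (R, h, u))"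
    using assms by (intro run_machine) (auto simp: machine_def)
  moreover have "tm_init (machine K c) w = (0, tapes K w (\<lambda>_. 0, 0, []))"
    by (auto simp: tm_init_def machine_def word_tape_def reg_tape_def fun_eq_iff map_replicate_trivial
        list_eq_iff_nth_eq nth_Cons split: nat.split)
  ultimately show ?thesis
    using assms(3) unfolding tm_outputs_within_def
    by (intro exI[of _ t]) (simp add: machine_def del: tm_step.simps)
qed

section \<open>Functions computable in polynomial time\<close>

text \<open>Monotonicity is included because bounds get applied to estimates of sizes and are
  composed with each other.\<close>

definition poly_bounded :: "(nat \<Rightarrow> nat) \<Rightarrow> bool" where
  "poly_bounded B \<longleftrightarrow> mono B \<and> (\<exists>a k. \<forall>N. B N \<le> a * (N + 1) ^ k)"

lemma poly_boundedI: "mono B \<Longrightarrow> (\<And>N. B N \<le> a * (N + 1) ^ k) \<Longrightarrow> poly_bounded B"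
  by (auto simp: poly_bounded_def)

lemma poly_bounded_mono: "poly_bounded B \<Longrightarrow> x \<le> y \<Longrightarrow> B x \<le> B y"
  by (auto simp: poly_bounded_def dest: monoD)

lemma poly_bounded_const: "poly_bounded (\<lambda>N. c)"
  by (rule poly_boundedI[of _ c 0]) (auto intro: monoI)

lemma poly_bounded_id: "poly_bounded (\<lambda>N. N)"
  by (rule poly_boundedI[of _ 1 1]) (auto intro: monoI)

lemma poly_bounded_add:
  assumes "poly_bounded A" "poly_bounded B"
  shows "poly_bounded (\<lambda>N. A N + B N)"
proof -
  obtain a k b l where A: "\<And>N. A N \<le> a * (N + 1) ^ k" and B: "\<And>N. B N \<le> b * (N + 1) ^ l"
    using assms by (auto simp: poly_bounded_def)
  show ?thesis
  proof (rule poly_boundedI[of _ "a + b" "k + l"])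
    show "mono (\<lambda>N. A N + B N)" by (intro monoI add_mono) (simp_all add: poly_bounded_mono assms)
    fix N
    have "a * (N + 1) ^ k \<le> a * (N + 1) ^ (k + l)" "b * (N + 1) ^ l \<le> b * (N + 1) ^ (k + l)"
      by (intro mult_le_mono2 power_increasing; simp)+
    then show "A N + B N \<le> (a + b) * (N + 1) ^ (k + l)"
      using A[of N] B[of N] unfolding distrib_right by linarith
  qed
qed

lemma poly_bounded_mult:
  assumes "poly_bounded A" "poly_bounded B"
  shows "poly_bounded (\<lambda>N. A N * B N)"
proof -
  obtain a k b l where A: "\<And>N. A N \<le> a * (N + 1) ^ k" and B: "\<And>N. B N \<le> b * (N + 1) ^ l"
    using assms by (auto simp: poly_bounded_def)
  show ?thesis
  proof (rule poly_boundedI[of _ "a * b" "k + l"])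
    show "mono (\<lambda>N. A N * B N)" by (intro monoI mult_mono) (simp_all add: poly_bounded_mono assms)
    fix N
    show "A N * B N \<le> (a * b) * (N + 1) ^ (k + l)"
      using mult_mono[OF A[of N] B[of N]] by (simp add: power_add ac_simps)
  qed
qed

lemma poly_bounded_compose:
  assumes "poly_bounded A" "poly_bounded B"
  shows "poly_bounded (\<lambda>N. A (B N))"
proof -
  obtain a k b l where A: "\<And>N. A N \<le> a * (N + 1) ^ k" and B: "\<And>N. B N \<le> b * (N + 1) ^ l"
    using assms by (auto simp: poly_bounded_def)
  show ?thesis
  proof (rule poly_boundedI[of _ "a * (b + 1) ^ k" "l * k"])
    show "mono (\<lambda>N. A (B N))" by (intro monoI) (simp add: poly_bounded_mono assms)
    fix N
    have "B N + 1 \<le> (b + 1) * (N + 1) ^ l"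
      using B[of N] one_le_power[of "N + 1" l] unfolding distrib_right by linarith
    then have "(B N + 1) ^ k \<le> (b + 1) ^ k * (N + 1) ^ (l * k)"
      by (metis power_mono power_mult power_mult_distrib zero_le)
    then show "A (B N) \<le> a * (b + 1) ^ k * (N + 1) ^ (l * k)"
      using A[of "B N"] by (metis le_trans mult.assoc mult_le_mono2)
  qed
qed

lemmas poly_bounded_intros =
  poly_bounded_const poly_bounded_id poly_bounded_add poly_bounded_mult


section \<open>Upper bounds on running times\<close>

definition within :: "nat list \<Rightarrow> com \<Rightarrow> store \<Rightarrow> nat \<Rightarrow> store \<Rightarrow> bool" where
  "within w c s T s' \<longleftrightarrow> (\<exists>t\<le>T. run w c s t s')"

lemma within_mono: "within w c s T s' \<Longrightarrow> T \<le> U \<Longrightarrow> s' = s'' \<Longrightarrow> within w c s U s''"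
  unfolding within_def by (metis le_trans)

lemma within_Seq:
  "within w c s T s' \<Longrightarrow> within w d s' T' s'' \<Longrightarrow> T + T' \<le> U \<Longrightarrow> within w (c ;; d) s U s''"
  unfolding within_def by (meson add_mono le_trans run_Seq)

lemma within_Inc: "within w (Inc r) (R, h, u) 2 (R(r := Suc (R r)), h, u)"
  unfolding within_def by (blast intro: run.intros)

lemma within_Dec: "within w (Dec r) (R, h, u) 1 (R(r := R r - 1), h, u)"
  unfolding within_def by (blast intro: run.intros)

lemma within_GoR: "within w GoR (R, h, u) 1 (R, h + 1, u)"
  unfolding within_def by (blast intro: run.intros)

lemma within_GoL: "within w GoL (R, h, u) 1 (R, h - 1, u)"
  unfolding within_def by (blast intro: run.intros)

lemma within_Out: "within w (Out y) (R, h, u) 1 (R, h, u @ [y])"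
  unfolding within_def by (blast intro: run.intros)

lemma within_Ite_True: "holds w b s \<Longrightarrow> within w c s T s' \<Longrightarrow> within w (Ite b c d) s (T + 2) s'"
  unfolding within_def by (meson add_le_mono1 run_Ite_True)

lemma within_Ite_False: "\<not> holds w b s \<Longrightarrow> within w d s T s' \<Longrightarrow> within w (Ite b c d) s (T + 2) s'"
  unfolding within_def by (metis add_le_mono le_numeral_extra(4) one_le_numeral run_Ite_False)

text \<open>The number of rounds is known in advance in all applications, so a loop is verified by
  giving its trace \<open>\<sigma>\<close>; no separate termination argument is needed.\<close>

lemma within_While:
  assumes "\<And>i. i < n \<Longrightarrow> holds w b (\<sigma> i)" "\<And>i. i < n \<Longrightarrow> within w c (\<sigma> i) T (\<sigma> (Suc i))"
    "\<not> holds w b (\<sigma> n)" "n * (T + 2) + 1 \<le> U" "s = \<sigma> 0" "s' = \<sigma> n"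
  shows "within w (While b c) s U s'"
proof -
  \<comment> \<open>Induction on the number \<open>k\<close> of rounds that remain, because the rule
    for a true test splits off the first round.\<close>
  have "within w (While b c) (\<sigma> (n - k)) (k * (T + 2) + 1) (\<sigma> n)" if "k \<le> n" for k
    using that
  proof (induction k)
    case 0
    show ?case using run_While_False[OF assms(3), of c] by (auto simp: within_def intro!: exI[of _ 1])
  next
    case (Suc k)
    let ?i = "n - Suc k"
    have i: "?i < n" "Suc ?i = n - k" using Suc.prems by auto
    obtain t where "t \<le> T" "run w c (\<sigma> ?i) t (\<sigma> (Suc ?i))"
      using assms(2) i(1) by (auto simp: within_def)
    moreover obtain t' where "t' \<le> k * (T + 2) + 1" "run w (While b c) (\<sigma> (Suc ?i)) t' (\<sigma> n)"
      using Suc i(2) by (auto simp: within_def)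
    ultimately show ?case
      using run_While_True[OF assms(1)[OF i(1)]] unfolding within_def
      by (intro exI[of _ "t + t' + 2"]) auto
  qed
  from this[of n] show ?thesis using assms(4-6) within_mono by fastforce
qed


section \<open>Basic register programs\<close>

definition clear :: "nat \<Rightarrow> com" where
  "clear r = While (Pos r) (Dec r)"

lemma within_clear:
  "R r + R r + R r + 1 \<le> T \<Longrightarrow> within w (clear r) (R, h, u) T (R(r := 0), h, u)"
  unfolding clear_def
  by (rule within_While[where n = "R r" and T = 1 and \<sigma> = "\<lambda>i. (R(r := R r - i), h, u)"])
    (auto intro: within_mono[OF within_Dec])

definition move_reg :: "nat \<Rightarrow> nat \<Rightarrow> com" where
  "move_reg x r = While (Pos x) (Dec x ;; Inc r)"

lemma within_move_reg:
  assumes "x \<noteq> r" "5 * R x + 1 \<le> T"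
  shows "within w (move_reg x r) (R, h, u) T (R(x := 0, r := R r + R x), h, u)"
  unfolding move_reg_def
  by (rule within_While[where n = "R x" and T = 3 and \<sigma> = "\<lambda>i. (R(x := R x - i, r := R r + i), h, u)"])
    (use assms in \<open>auto simp: fun_eq_iff intro!: within_Seq[OF within_Dec within_mono[OF within_Inc order_refl]]\<close>)

text \<open>Reading a unary register destroys it. Its content is therefore collected in the scratch
  register \<open>z\<close> as well, and moved back afterwards.\<close>

definition add_reg :: "nat \<Rightarrow> nat \<Rightarrow> nat \<Rightarrow> com" where
  "add_reg x r z = While (Pos x) (Dec x ;; Inc r ;; Inc z) ;; move_reg z x"

lemma within_add_reg:
  assumes "x \<noteq> r" "x \<noteq> z" "r \<noteq> z" "R z = 0" "12 * R x + 2 \<le> T"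
  shows "within w (add_reg x r z) (R, h, u) T (R(r := R r + R x), h, u)"
  unfolding add_reg_def
proof (rule within_Seq)
  show "within w (While (Pos x) (Dec x ;; Inc r ;; Inc z)) (R, h, u) (7 * R x + 1)
      (R(x := 0, r := R r + R x, z := R x), h, u)"
    by (rule within_While[where n = "R x" and T = 5 and
          \<sigma> = "\<lambda>i. (R(x := R x - i, r := R r + i, z := i), h, u)"])
      (use assms in \<open>auto simp: fun_eq_iff intro!: within_Seq[OF within_Dec within_Seq[OF within_Inc within_mono[OF within_Inc order_refl]]]\<close>)
  show "within w (move_reg z x) (R(x := 0, r := R r + R x, z := R x), h, u) (5 * R x + 1)
      (R(r := R r + R x), h, u)"
    by (rule within_mono[OF within_move_reg order_refl]) (use assms in \<open>auto simp: fun_eq_iff\<close>)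
qed (use assms in auto)


definition encs :: "nat list \<Rightarrow> nat list" where
  "encs I = concat (map enc_nat I)"

lemma encs_simps [simp]:
  "encs [] = []" "encs (a # I) = replicate a 1 @ 2 # encs I" "encs (I @ J) = encs I @ encs J"
  by (simp_all add: encs_def enc_nat_def)

text \<open>Registers are unary, so the values of the arguments count like the length of an
  input.\<close>

definition arg_size :: "nat \<Rightarrow> nat list \<Rightarrow> (nat \<Rightarrow> nat) \<Rightarrow> nat" where
  "arg_size k I e = length (encs I) + (\<Sum>j<k. e j)"

definition args :: "nat \<Rightarrow> (nat \<Rightarrow> nat) \<Rightarrow> nat \<Rightarrow> (nat \<Rightarrow> nat) \<Rightarrow> (nat \<Rightarrow> nat) \<Rightarrow> bool" where
  "args k \<rho> r e R \<longleftrightarrow> (\<forall>j<k. \<rho> j < r \<and> R (\<rho> j) = e j) \<and> (\<forall>q\<ge>r. R q = 0)"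

text \<open>Argument \<open>j\<close> is found in register \<open>\<rho> j\<close>, all registers from \<open>r\<close> on are free, and the value
  is returned in register \<open>r\<close>. Environments are total, but only the arguments below \<open>k\<close> can
  influence the result.\<close>

definition implements ::
    "((nat \<Rightarrow> nat) \<Rightarrow> nat \<Rightarrow> com) \<Rightarrow> nat \<Rightarrow> (nat \<Rightarrow> nat) \<Rightarrow> nat \<Rightarrow>
      (nat list \<Rightarrow> (nat \<Rightarrow> nat) \<Rightarrow> nat) \<Rightarrow> (nat list \<Rightarrow> (nat \<Rightarrow> nat) \<Rightarrow> nat list) \<Rightarrow> bool" where
  "implements p d B k F S \<longleftrightarrow>
     poly_bounded B \<and>
     (\<forall>\<rho> r. (\<forall>j<k. \<rho> j < r) \<longrightarrow> regs_below (r + d) (p \<rho> r)) \<and>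
     (\<forall>I e. F I e \<le> B (arg_size k I e)) \<and>
     (\<forall>\<rho> r I e R u. args k \<rho> r e R \<longrightarrow>
        within (encs I) (p \<rho> r) (R, 0, u) (B (arg_size k I e)) (R(r := F I e), 0, u @ encs (S I e)))"

text \<open>The returned value \<open>F\<close> and the printed numbers \<open>S\<close> are treated
  together because a loop can print numbers that depend on the value it carries along.\<close>

definition effective ::
    "nat \<Rightarrow> (nat list \<Rightarrow> (nat \<Rightarrow> nat) \<Rightarrow> nat) \<Rightarrow> (nat list \<Rightarrow> (nat \<Rightarrow> nat) \<Rightarrow> nat list) \<Rightarrow> bool" where
  "effective k F S \<longleftrightarrow> (\<exists>p d B. implements p d B k F S)"

abbreviation poly_computable :: "nat \<Rightarrow> (nat list \<Rightarrow> (nat \<Rightarrow> nat) \<Rightarrow> nat) \<Rightarrow> bool" where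
  "poly_computable k F \<equiv> effective k F (\<lambda>I e. [])"

abbreviation poly_printable :: "nat \<Rightarrow> (nat list \<Rightarrow> (nat \<Rightarrow> nat) \<Rightarrow> nat list) \<Rightarrow> bool" where
  "poly_printable k S \<equiv> effective k (\<lambda>I e. 0) S"

lemma effectiveI:
  assumes "poly_bounded B"
    "\<And>\<rho> r. (\<And>j. j < k \<Longrightarrow> \<rho> j < r) \<Longrightarrow> regs_below (r + d) (p \<rho> r)"
    "\<And>I e. F I e \<le> B (arg_size k I e)"
    "\<And>\<rho> r I e R u. args k \<rho> r e R \<Longrightarrow>
        within (encs I) (p \<rho> r) (R, 0, u) (B (arg_size k I e)) (R(r := F I e), 0, u @ encs (S I e))"
  shows "effective k F S"
  using assms unfolding effective_def implements_def by blast

lemma effectiveE: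
  assumes "effective k F S"
  obtains p d B where "poly_bounded B"
    "\<And>\<rho> r. (\<And>j. j < k \<Longrightarrow> \<rho> j < r) \<Longrightarrow> regs_below (r + d) (p \<rho> r)"
    "\<And>I e. F I e \<le> B (arg_size k I e)"
    "\<And>\<rho> r I e R u. args k \<rho> r e R \<Longrightarrow>
        within (encs I) (p \<rho> r) (R, 0, u) (B (arg_size k I e)) (R(r := F I e), 0, u @ encs (S I e))"
  using assms unfolding effective_def implements_def by blast

lemma arg_le_size: "j < k \<Longrightarrow> e j \<le> arg_size k I e"
  by (simp add: arg_size_def member_le_sum trans_le_add2)

lemma arg_size_push: "arg_size (Suc k) I (case_nat v e) = v + arg_size k I e"
  by (simp add: arg_size_def sum.lessThan_Suc_shift del: sum.lessThan_Suc)

text \<open>The new argument gets index 0, as with de Bruijn indices. Its register \<open>q\<close>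
  may lie above \<open>r\<close>: a loop keeps its counter in the gap.\<close>

lemma args_push:
  assumes "args k \<rho> r e R" "r \<le> q" "R' q = v" "\<And>j. j < r \<Longrightarrow> R' j = R j" "\<And>j. q < j \<Longrightarrow> R' j = 0"
  shows "args (Suc k) (case_nat q \<rho>) (Suc q) (case_nat v e) R'"
proof -
  have "case_nat q \<rho> j < Suc q \<and> R' (case_nat q \<rho> j) = case_nat v e j" if "j < Suc k" for j
  proof (cases j)
    case 0
    then show ?thesis using assms(3) by simp
  next
    case (Suc i)
    then have "\<rho> i < r" "R (\<rho> i) = e i" using assms(1) that by (simp_all add: args_def)
    then show ?thesis using Suc assms(2,4) by simp
  qed
  then show ?thesis using assms(5) by (simp add: args_def)
qed

lemma effective_const: "poly_computable k (\<lambda>I e. c)"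
proof -
  \<comment> \<open>There is no empty command; clearing the register \<open>r\<close>, which is free
    and hence 0, serves as one.\<close>
  define incs where "incs r = ((\<lambda>p. p ;; Inc r) ^^ c) (clear r)" for r
  have regs: "regs_below (r + 1) (((\<lambda>p. p ;; Inc r) ^^ n) (clear r))" for n r
    by (induction n) (auto simp: clear_def)
  have run: "within w (((\<lambda>p. p ;; Inc r) ^^ n) (clear r)) (R, h, u) (2 * n + 1) (R(r := n), h, u)"
    if "R r = 0" for n r R h u w
  proof (induction n)
    case 0
    show ?case using within_clear[of R r 1 w h u] that by (simp del: fun_upd_apply)
  next
    case (Suc n)
    then show ?case by (auto intro!: within_Seq[OF Suc within_mono[OF within_Inc order_refl]])
  qed
  show ?thesis
    by (rule effectiveI[where p = "\<lambda>\<rho>. incs" and d = 1 and B = "\<lambda>N. 2 * c + 1"])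
      (use regs run in \<open>auto intro: poly_bounded_const simp: incs_def args_def\<close>)
qed

lemma effective_add_vars:
  assumes "x < k" "y < k"
  shows "poly_computable k (\<lambda>I e. e x + e y)"
proof (rule effectiveI[where p = "\<lambda>\<rho> r. add_reg (\<rho> x) r (r + 1) ;; add_reg (\<rho> y) r (r + 1)"
      and d = 2 and B = "\<lambda>N. 24 * N + 4"])
  show "poly_bounded (\<lambda>N. 24 * N + 4)" by (intro poly_bounded_intros)
  show "regs_below (r + 2) (add_reg (\<rho> x) r (r + 1) ;; add_reg (\<rho> y) r (r + 1))"
    if "\<And>j. j < k \<Longrightarrow> \<rho> j < r" for \<rho> r
    using that[OF assms(1)] that[OF assms(2)] by (simp add: add_reg_def move_reg_def)
  fix I e
  have le: "e x \<le> arg_size k I e" "e y \<le> arg_size k I e"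
    using assms arg_le_size by blast+
  then show "e x + e y \<le> 24 * arg_size k I e + 4" by linarith
  fix \<rho> :: "nat \<Rightarrow> nat" and r R and u :: "nat list" assume "args k \<rho> r e R"
  then have R: "\<rho> x < r" "\<rho> y < r" "R (\<rho> x) = e x" "R (\<rho> y) = e y" "\<And>q. q \<ge> r \<Longrightarrow> R q = 0"
    using assms by (auto simp: args_def)
  show "within (encs I) (add_reg (\<rho> x) r (r + 1) ;; add_reg (\<rho> y) r (r + 1)) (R, 0, u)
     (24 * arg_size k I e + 4) (R(r := e x + e y), 0, u @ encs [])"
    by (rule within_Seq[OF within_add_reg within_mono[OF within_add_reg order_refl]])
      (use R le in auto)
qed

lemma effective_var:
  assumes "x < k"
  shows "poly_computable k (\<lambda>I e. e x)"
proof (rule effectiveI[where p = "\<lambda>\<rho> r. add_reg (\<rho> x) r (r + 1)" and d = 2 and B = "\<lambda>N. 12 * N + 2"])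
  show "poly_bounded (\<lambda>N. 12 * N + 2)" by (intro poly_bounded_intros)
  show "regs_below (r + 2) (add_reg (\<rho> x) r (r + 1))"
    if "\<And>j. j < k \<Longrightarrow> \<rho> j < r" for \<rho> r
    using that[OF assms(1)] by (simp add: add_reg_def move_reg_def)
  fix I e
  have le: "e x \<le> arg_size k I e" using assms arg_le_size by blast
  then show "e x \<le> 12 * arg_size k I e + 2" by linarith
  fix \<rho> :: "nat \<Rightarrow> nat" and r R and u :: "nat list" assume "args k \<rho> r e R"
  then have R: "\<rho> x < r" "R (\<rho> x) = e x" "\<And>q. q \<ge> r \<Longrightarrow> R q = 0"
    using assms by (auto simp: args_def)
  show "within (encs I) (add_reg (\<rho> x) r (r + 1)) (R, 0, u)
     (12 * arg_size k I e + 2) (R(r := e x), 0, u @ encs [])"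
    by (rule within_mono[OF within_add_reg order_refl]) (use R le in auto)
qed

lemma effective_diff_vars:
  assumes "x < k" "y < k"
  shows "poly_computable k (\<lambda>I e. e x - e y)"
proof (rule effectiveI[where p = "\<lambda>\<rho> r. add_reg (\<rho> x) r (r + 1) ;; add_reg (\<rho> y) (r + 1) (r + 2) ;;
        While (Pos (r + 1)) (Dec (r + 1) ;; Dec r)"
      and d = 3 and B = "\<lambda>N. 28 * N + 5"])
  show "poly_bounded (\<lambda>N. 28 * N + 5)" by (intro poly_bounded_intros)
  show "regs_below (r + 3) (add_reg (\<rho> x) r (r + 1) ;; add_reg (\<rho> y) (r + 1) (r + 2) ;;
        While (Pos (r + 1)) (Dec (r + 1) ;; Dec r))"
    if "\<And>j. j < k \<Longrightarrow> \<rho> j < r" for \<rho> r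
    using that[OF assms(1)] that[OF assms(2)] by (simp add: add_reg_def move_reg_def)
  fix I e
  have le: "e x \<le> arg_size k I e" "e y \<le> arg_size k I e"
    using assms arg_le_size by blast+
  then show "e x - e y \<le> 28 * arg_size k I e + 5" by linarith
  fix \<rho> :: "nat \<Rightarrow> nat" and r R and u :: "nat list" assume "args k \<rho> r e R"
  then have R: "\<rho> x < r" "\<rho> y < r" "R (\<rho> x) = e x" "R (\<rho> y) = e y" "\<And>q. q \<ge> r \<Longrightarrow> R q = 0"
    using assms by (auto simp: args_def)
  \<comment> \<open>\<open>Dec\<close> leaves 0 unchanged, so the loop yields the truncated
    difference.\<close>
  have 3: "within (encs I) (While (Pos (r + 1)) (Dec (r + 1) ;; Dec r)) (R(r := e x, r + 1 := e y), 0, u)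
      (4 * e y + 1) (R(r := e x - e y), 0, u)"
    by (rule within_While[where n = "e y" and T = 2 and
          \<sigma> = "\<lambda>i. (R(r := e x - i, r + 1 := e y - i), 0, u)"])
      (use R in \<open>auto simp: fun_eq_iff intro!: within_Seq[OF within_Dec within_mono[OF within_Dec order_refl]]\<close>)
  have 2: "within (encs I) (add_reg (\<rho> y) (r + 1) (r + 2)) (R(r := e x), 0, u)
      (12 * e y + 2) (R(r := e x, r + 1 := e y), 0, u)"
    by (rule within_mono[OF within_add_reg order_refl]) (use R in auto)
  have 1: "within (encs I) (add_reg (\<rho> x) r (r + 1)) (R, 0, u) (12 * e x + 2) (R(r := e x), 0, u)"
    by (rule within_mono[OF within_add_reg order_refl]) (use R in auto)
  show "within (encs I) (add_reg (\<rho> x) r (r + 1) ;; add_reg (\<rho> y) (r + 1) (r + 2) ;;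
        While (Pos (r + 1)) (Dec (r + 1) ;; Dec r)) (R, 0, u)
     (28 * arg_size k I e + 5) (R(r := e x - e y), 0, u @ encs [])"
    using within_Seq[OF 1 within_Seq[OF 2 3 order_refl]] le by simp
qed

text \<open>Sequencing and substitution in one rule: the value of \<open>F\<close> becomes argument
  0 of \<open>G\<close>. The second program then has an argument size of at most
  \<open>B N + N\<close>, which is why a polynomial bound on values, and not only on times, belongs
  to \<open>implements\<close>. The last two commands restore the convention that only register
  \<open>r\<close> changes.\<close>

lemma effective_bind:
  assumes "effective k F S" "effective (Suc k) G T"
  shows "effective k (\<lambda>I e. G I (case_nat (F I e) e)) (\<lambda>I e. S I e @ T I (case_nat (F I e) e))"
proof -
  obtain p d B where B: "poly_bounded B"
    and p1: "\<And>\<rho> r. (\<And>j. j < k \<Longrightarrow> \<rho> j < r) \<Longrightarrow> regs_below (r + d) (p \<rho> r)"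
    and p2: "\<And>I e. F I e \<le> B (arg_size k I e)"
    and p3: "\<And>\<rho> r I e R u. args k \<rho> r e R \<Longrightarrow>
        within (encs I) (p \<rho> r) (R, 0, u) (B (arg_size k I e)) (R(r := F I e), 0, u @ encs (S I e))"
    using effectiveE[OF assms(1)] by metis
  obtain q d' B' where B': "poly_bounded B'"
    and q1: "\<And>\<rho> r. (\<And>j. j < Suc k \<Longrightarrow> \<rho> j < r) \<Longrightarrow> regs_below (r + d') (q \<rho> r)"
    and q2: "\<And>I e. G I e \<le> B' (arg_size (Suc k) I e)"
    and q3: "\<And>\<rho> r I e R u. args (Suc k) \<rho> r e R \<Longrightarrow>
        within (encs I) (q \<rho> r) (R, 0, u) (B' (arg_size (Suc k) I e)) (R(r := G I e), 0, u @ encs (T I e))"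
    using effectiveE[OF assms(2)] by metis
  let ?B = "\<lambda>N. B N + B' (B N + N) + 3 * B N + 5 * B' (B N + N) + 2"
  have le: "B' (arg_size (Suc k) I (case_nat (F I e) e)) \<le> B' (B (arg_size k I e) + arg_size k I e)" for I e
    unfolding arg_size_push by (rule poly_bounded_mono[OF B']) (simp add: p2)
  show ?thesis
  proof (rule effectiveI[where d = "d + d' + 2" and B = ?B and
        p = "\<lambda>\<rho> r. p \<rho> r ;; q (case_nat r \<rho>) (Suc r) ;; clear r ;; move_reg (Suc r) r"])
    show "poly_bounded ?B" by (intro poly_bounded_intros poly_bounded_compose[OF B'] B)
    show "regs_below (r + (d + d' + 2)) (p \<rho> r ;; q (case_nat r \<rho>) (Suc r) ;; clear r ;; move_reg (Suc r) r)"
      if "\<And>j. j < k \<Longrightarrow> \<rho> j < r" for \<rho> r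
    proof -
      have "regs_below (Suc r + d') (q (case_nat r \<rho>) (Suc r))"
        using that by (intro q1) (simp add: less_SucI split: nat.split)
      moreover have "regs_below (r + d) (p \<rho> r)" using that by (intro p1)
      ultimately have "regs_below (r + (d + d' + 2)) (p \<rho> r)"
        "regs_below (r + (d + d' + 2)) (q (case_nat r \<rho>) (Suc r))"
        by (rule_tac [!] regs_below_mono) auto
      then show ?thesis by (simp add: clear_def move_reg_def)
    qed
    fix I e
    let ?v = "F I e" let ?e = "case_nat ?v e" let ?N = "arg_size k I e"
    show "G I ?e \<le> ?B ?N" using q2[of I ?e] le[of I e] by linarith
    fix \<rho> r R u assume a: "args k \<rho> r e R"
    have r: "R r = 0" "R (Suc r) = 0" using a by (auto simp: args_def)
    have a': "args (Suc k) (case_nat r \<rho>) (Suc r) ?e (R(r := ?v))"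
      by (rule args_push[OF a]) (use a in \<open>auto simp: args_def\<close>)
    show "within (encs I) (p \<rho> r ;; q (case_nat r \<rho>) (Suc r) ;; clear r ;; move_reg (Suc r) r) (R, 0, u)
        (?B ?N) (R(r := G I ?e), 0, u @ encs (S I e @ T I ?e))"
    proof -
      let ?w = "encs I"
      have 1: "within ?w (p \<rho> r) (R, 0, u) (B ?N) (R(r := ?v), 0, u @ encs (S I e))"
        by (rule p3[OF a])
      have 2: "within ?w (q (case_nat r \<rho>) (Suc r)) (R(r := ?v), 0, u @ encs (S I e))
          (B' (arg_size (Suc k) I ?e)) (R(r := ?v, Suc r := G I ?e), 0, u @ encs (S I e @ T I ?e))"
        using q3[OF a', of I "u @ encs (S I e)"] by simp
      have 3: "within ?w (clear r) (R(r := ?v, Suc r := G I ?e), 0, u @ encs (S I e @ T I ?e))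
          (3 * ?v + 1) (R(Suc r := G I ?e), 0, u @ encs (S I e @ T I ?e))"
        by (rule within_mono[OF within_clear order_refl]) (use r in \<open>auto simp: fun_eq_iff\<close>)
      have 4: "within ?w (move_reg (Suc r) r) (R(Suc r := G I ?e), 0, u @ encs (S I e @ T I ?e))
          (5 * G I ?e + 1) (R(r := G I ?e), 0, u @ encs (S I e @ T I ?e))"
        by (rule within_mono[OF within_move_reg order_refl]) (use r in \<open>auto simp: fun_eq_iff\<close>)
      have "B' (arg_size (Suc k) I ?e) \<le> B' (B ?N + ?N)" "?v \<le> B ?N" "G I ?e \<le> B' (arg_size (Suc k) I ?e)"
        using le p2 q2 by auto
      then show ?thesis
        by (intro within_Seq[OF 1 within_Seq[OF 2 within_Seq[OF 3 4 order_refl] order_refl]]) linarith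
    qed
  qed
qed

lemma effective_rename:
  assumes "effective k F S" "\<And>j. j < k \<Longrightarrow> h j < k'"
  shows "effective k' (\<lambda>I e. F I (\<lambda>j. e (h j))) (\<lambda>I e. S I (\<lambda>j. e (h j)))"
proof -
  obtain p d B where B: "poly_bounded B"
    and p1: "\<And>\<rho> r. (\<And>j. j < k \<Longrightarrow> \<rho> j < r) \<Longrightarrow> regs_below (r + d) (p \<rho> r)"
    and p2: "\<And>I e. F I e \<le> B (arg_size k I e)"
    and p3: "\<And>\<rho> r I e R u. args k \<rho> r e R \<Longrightarrow>
        within (encs I) (p \<rho> r) (R, 0, u) (B (arg_size k I e)) (R(r := F I e), 0, u @ encs (S I e))"
    using effectiveE[OF assms(1)] by metis
  \<comment> \<open>One argument may be used under all \<open>k\<close> names, so the sum of the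
    argument values can grow by the factor \<open>k\<close>.\<close>
  let ?B = "\<lambda>N. B (N + k * N)"
  have le: "B (arg_size k I (\<lambda>j. e (h j))) \<le> ?B (arg_size k' I e)" for I e
  proof (rule poly_bounded_mono[OF B])
    have "(\<Sum>j<k. e (h j)) \<le> (\<Sum>j<k. arg_size k' I e)"
      by (intro sum_mono arg_le_size assms(2)) simp
    then show "arg_size k I (\<lambda>j. e (h j)) \<le> arg_size k' I e + k * arg_size k' I e"
      by (simp add: arg_size_def add_mono trans_le_add1)
  qed
  show ?thesis
  proof (rule effectiveI[where p = "\<lambda>\<rho>. p (\<lambda>j. \<rho> (h j))" and d = d and B = ?B])
    show "poly_bounded ?B" by (intro poly_bounded_intros poly_bounded_compose[OF B])
    show "regs_below (r + d) (p (\<lambda>j. \<rho> (h j)) r)" if "\<And>j. j < k' \<Longrightarrow> \<rho> j < r" for \<rho> r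
      using that assms(2) by (intro p1) auto
    fix I e
    show "F I (\<lambda>j. e (h j)) \<le> ?B (arg_size k' I e)"
      using p2 le le_trans by blast
    fix \<rho> r R u assume "args k' \<rho> r e R"
    then have "args k (\<lambda>j. \<rho> (h j)) r (\<lambda>j. e (h j)) R" using assms(2) by (auto simp: args_def)
    from within_mono[OF p3[OF this] le refl]
    show "within (encs I) (p (\<lambda>j. \<rho> (h j)) r) (R, 0, u) (?B (arg_size k' I e))
        (R(r := F I (\<lambda>j. e (h j))), 0, u @ encs (S I (\<lambda>j. e (h j))))" .
  qed
qed

lemma effective_if_var:
  assumes "effective k F S" "effective k G T" "c < k"
  shows "effective k (\<lambda>I e. if e c = 0 then F I e else G I e) (\<lambda>I e. if e c = 0 then S I e else T I e)"
proof -
  obtain p d B where B: "poly_bounded B"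
    and p1: "\<And>\<rho> r. (\<And>j. j < k \<Longrightarrow> \<rho> j < r) \<Longrightarrow> regs_below (r + d) (p \<rho> r)"
    and p2: "\<And>I e. F I e \<le> B (arg_size k I e)"
    and p3: "\<And>\<rho> r I e R u. args k \<rho> r e R \<Longrightarrow>
        within (encs I) (p \<rho> r) (R, 0, u) (B (arg_size k I e)) (R(r := F I e), 0, u @ encs (S I e))"
    using effectiveE[OF assms(1)] by metis
  obtain q d' B' where B': "poly_bounded B'"
    and q1: "\<And>\<rho> r. (\<And>j. j < k \<Longrightarrow> \<rho> j < r) \<Longrightarrow> regs_below (r + d') (q \<rho> r)"
    and q2: "\<And>I e. G I e \<le> B' (arg_size k I e)"
    and q3: "\<And>\<rho> r I e R u. args k \<rho> r e R \<Longrightarrow>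
        within (encs I) (q \<rho> r) (R, 0, u) (B' (arg_size k I e)) (R(r := G I e), 0, u @ encs (T I e))"
    using effectiveE[OF assms(2)] by metis
  let ?B = "\<lambda>N. B N + B' N + 2"
  let ?p = "\<lambda>\<rho> r. Ite (Pos (\<rho> c)) (q \<rho> r) (p \<rho> r)"
  show ?thesis
  proof (rule effectiveI[where p = ?p and d = "d + d'" and B = ?B])
    show "poly_bounded ?B" by (intro poly_bounded_intros B B')
    show "regs_below (r + (d + d')) (?p \<rho> r)" if "\<And>j. j < k \<Longrightarrow> \<rho> j < r" for \<rho> r
    proof -
      have "regs_below (r + d) (p \<rho> r)" "regs_below (r + d') (q \<rho> r)"
        using that by (auto intro: p1 q1)
      then have "regs_below (r + (d + d')) (p \<rho> r)" "regs_below (r + (d + d')) (q \<rho> r)"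
        by (rule_tac [!] regs_below_mono) auto
      then show ?thesis using that[OF assms(3)] by simp
    qed
    fix I e
    let ?N = "arg_size k I e"
    show "(if e c = 0 then F I e else G I e) \<le> ?B ?N"
      using p2[of I e] q2[of I e] by simp
    fix \<rho> r R u assume a: "args k \<rho> r e R"
    then have c: "R (\<rho> c) = e c" using assms(3) by (auto simp: args_def)
    show "within (encs I) (?p \<rho> r) (R, 0, u) (?B ?N)
        (R(r := if e c = 0 then F I e else G I e), 0, u @ encs (if e c = 0 then S I e else T I e))"
    proof (cases "e c = 0")
      case True
      then show ?thesis using c
        by (intro within_mono[OF within_Ite_False[OF _ p3[OF a]]]) auto
    next
      case False
      then show ?thesis using c
        by (intro within_mono[OF within_Ite_True[OF _ q3[OF a]]]) auto
    qed
  qed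
qed

lemma effective_print_var:
  assumes "x < k"
  shows "poly_printable k (\<lambda>I e. [e x])"
proof -
  let ?p = "\<lambda>\<rho> r. add_reg (\<rho> x) r (r + 1) ;; While (Pos r) (Dec r ;; Out 1) ;; Out 2"
  show ?thesis
  proof (rule effectiveI[where p = ?p and d = 2 and B = "\<lambda>N. 16 * N + 4"])
    show "poly_bounded (\<lambda>N. 16 * N + 4)" by (intro poly_bounded_intros)
    show "regs_below (r + 2) (?p \<rho> r)" if "\<And>j. j < k \<Longrightarrow> \<rho> j < r" for \<rho> r
      using that[OF assms(1)] by (simp add: add_reg_def move_reg_def)
    fix I e
    have le: "e x \<le> arg_size k I e" using assms arg_le_size by blast
    show "0 \<le> 16 * arg_size k I e + 4" by simp
    fix \<rho> :: "nat \<Rightarrow> nat" and r R and u :: "nat list" assume "args k \<rho> r e R"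
    then have R: "\<rho> x < r" "R (\<rho> x) = e x" "\<And>q. q \<ge> r \<Longrightarrow> R q = 0"
      using assms by (auto simp: args_def)
    have 1: "within (encs I) (add_reg (\<rho> x) r (r + 1)) (R, 0, u) (12 * e x + 2) (R(r := e x), 0, u)"
      by (rule within_mono[OF within_add_reg order_refl]) (use R in auto)
    have 2: "within (encs I) (While (Pos r) (Dec r ;; Out 1)) (R(r := e x), 0, u) (4 * e x + 1)
        (R, 0, u @ replicate (e x) 1)"
      by (rule within_While[where n = "e x" and T = 2 and
            \<sigma> = "\<lambda>i. (R(r := e x - i), 0, u @ replicate i 1)"])
        (use R in \<open>auto simp: fun_eq_iff replicate_append_same[symmetric]
           intro!: within_Seq[OF within_Dec within_mono[OF within_Out order_refl]]\<close>)
    show "within (encs I) (?p \<rho> r) (R, 0, u) (16 * arg_size k I e + 4) (R(r := 0), 0, u @ encs [e x])"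
      using within_Seq[OF 1 within_Seq[OF 2 within_Out[of _ 2] order_refl]] le R by (simp add: fun_upd_idem)
  qed
qed

text \<open>Iterating a polynomially bounded function can produce exponentially large values, so a
  bound \<open>D\<close> on all intermediate values has to be supplied. Register \<open>r\<close>
  counts down, \<open>r + 1\<close> holds the current value and \<open>r + 2\<close> the index of
  the round; the body works from \<open>r + 3\<close> on.\<close>

lemma effective_loop:
  assumes "effective (Suc (Suc k)) F S" "c < k" "z < k" "poly_bounded D"
  defines "X \<equiv> \<lambda>I e. rec_nat (e z) (\<lambda>i x. F I (case_nat i (case_nat x e)))"
  assumes bound: "\<And>I e i. i \<le> e c \<Longrightarrow> X I e i \<le> D (arg_size k I e)"
  shows "effective k (\<lambda>I e. X I e (e c))
    (\<lambda>I e. concat (map (\<lambda>i. S I (case_nat i (case_nat (X I e i) e))) [0..<e c]))"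
proof -
  obtain p d B where B: "poly_bounded B"
    and p1: "\<And>\<rho> r. (\<And>j. j < Suc (Suc k) \<Longrightarrow> \<rho> j < r) \<Longrightarrow> regs_below (r + d) (p \<rho> r)"
    and p2: "\<And>I e. F I e \<le> B (arg_size (Suc (Suc k)) I e)"
    and p3: "\<And>\<rho> r I e R u. args (Suc (Suc k)) \<rho> r e R \<Longrightarrow>
        within (encs I) (p \<rho> r) (R, 0, u) (B (arg_size (Suc (Suc k)) I e)) (R(r := F I e), 0, u @ encs (S I e))"
    using effectiveE[OF assms(1)] by metis
  let ?\<rho> = "\<lambda>\<rho> r. case_nat (r + 2) (case_nat (r + 1) \<rho>)"
  let ?body = "\<lambda>\<rho> r. p (?\<rho> \<rho> r) (r + 3) ;; clear (r + 1) ;; move_reg (r + 3) (r + 1) ;; Inc (r + 2) ;; Dec r"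
  let ?p = "\<lambda>\<rho> r. add_reg (\<rho> c) r (r + 1) ;; add_reg (\<rho> z) (r + 1) (r + 2) ;;
    While (Pos r) (?body \<rho> r) ;; clear (r + 2) ;; move_reg (r + 1) r"
  let ?TB = "\<lambda>N. B (N + (D N + N)) + 8 * D N + 5"
  let ?B = "\<lambda>N. 27 * N + 5 * D N + 7 + N * (?TB N + 2)"
  show ?thesis
  proof (rule effectiveI[where p = ?p and d = "d + 4" and B = ?B])
    show "poly_bounded ?B"
      by (intro poly_bounded_intros poly_bounded_compose[OF B] \<open>poly_bounded D\<close>)
    show "regs_below (r + (d + 4)) (?p \<rho> r)" if "\<And>j. j < k \<Longrightarrow> \<rho> j < r" for \<rho> r
    proof -
      have "regs_below (r + 3 + d) (p (?\<rho> \<rho> r) (r + 3))"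
        using that by (intro p1) (simp add: trans_less_add1 split: nat.split)
      then have "regs_below (r + (d + 4)) (p (?\<rho> \<rho> r) (r + 3))" by (rule regs_below_mono) simp
      then show ?thesis using that[OF \<open>c < k\<close>] that[OF \<open>z < k\<close>]
        by (simp add: add_reg_def clear_def move_reg_def)
    qed
    fix I e
    let ?N = "arg_size k I e" let ?n = "e c"
    have le: "?n \<le> ?N" "e z \<le> ?N" using arg_le_size assms by blast+
    show "X I e ?n \<le> ?B ?N" using bound[where I = I and e = e and i = "e c"] by simp
    fix \<rho> r R u assume a: "args k \<rho> r e R"
    let ?x = "X I e" and ?w = "encs I"
    let ?e = "\<lambda>i. case_nat i (case_nat (?x i) e)"
    let ?out = "\<lambda>i. u @ encs (concat (map (\<lambda>i. S I (?e i)) [0..<i]))"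
    let ?R = "\<lambda>i. R(r := ?n - i, r + 1 := ?x i, r + 2 := i)"
    have R: "\<rho> c < r" "R (\<rho> c) = ?n" "\<rho> z < r" "R (\<rho> z) = e z" "\<And>q. q \<ge> r \<Longrightarrow> R q = 0"
      using a assms by (auto simp: args_def)
    have x0: "?x 0 = e z" and xS: "?x (Suc i) = F I (?e i)" for i
      by (simp_all add: X_def)
    have 1: "within ?w (add_reg (\<rho> c) r (r + 1)) (R, 0, u) (12 * ?n + 2) (R(r := ?n), 0, u)"
      by (rule within_mono[OF within_add_reg order_refl]) (use R in auto)
    have 2: "within ?w (add_reg (\<rho> z) (r + 1) (r + 2)) (R(r := ?n), 0, u) (12 * e z + 2) (?R 0, 0, u)"
      by (rule within_mono[OF within_add_reg order_refl]) (use R x0 in \<open>auto simp: fun_eq_iff\<close>)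
    have body: "within ?w (?body \<rho> r) (?R i, 0, ?out i) (?TB ?N) (?R (Suc i), 0, ?out (Suc i))"
      if i: "i < ?n" for i
    proof -
      have b: "?x i \<le> D ?N" "?x (Suc i) \<le> D ?N" using bound i by simp_all
      have "arg_size (Suc (Suc k)) I (?e i) \<le> ?N + (D ?N + ?N)"
        unfolding arg_size_push using b i le by linarith
      then have t: "B (arg_size (Suc (Suc k)) I (?e i)) \<le> B (?N + (D ?N + ?N))"
        by (rule poly_bounded_mono[OF B])
      have "args (Suc k) (case_nat (r + 1) \<rho>) (Suc (r + 1)) (case_nat (?x i) e) (R(r := ?n - i, r + 1 := ?x i))"
        by (rule args_push[OF a]) (use R(5) in auto)
      then have "args (Suc (Suc k)) (?\<rho> \<rho> r) (Suc (r + 2)) (?e i) (?R i)"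
        by (rule args_push) (use R(5) in auto)
      then have "args (Suc (Suc k)) (?\<rho> \<rho> r) (r + 3) (?e i) (?R i)" by (simp add: numeral_3_eq_3)
      from p3[OF this, of I "?out i"]
      have 1: "within ?w (p (?\<rho> \<rho> r) (r + 3)) (?R i, 0, ?out i) (B (arg_size (Suc (Suc k)) I (?e i)))
          ((?R i)(r + 3 := ?x (Suc i)), 0, ?out (Suc i))"
        by (simp add: xS)
      have 2: "within ?w (clear (r + 1)) ((?R i)(r + 3 := ?x (Suc i)), 0, ?out (Suc i)) (3 * ?x i + 1)
          ((?R i)(r + 1 := 0, r + 3 := ?x (Suc i)), 0, ?out (Suc i))"
        by (rule within_mono[OF within_clear order_refl]) (auto simp: fun_eq_iff)
      have 3: "within ?w (move_reg (r + 3) (r + 1)) ((?R i)(r + 1 := 0, r + 3 := ?x (Suc i)), 0, ?out (Suc i))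
          (5 * ?x (Suc i) + 1) ((?R i)(r + 1 := ?x (Suc i)), 0, ?out (Suc i))"
        by (rule within_mono[OF within_move_reg order_refl]) (use R(5) in \<open>auto simp: fun_eq_iff\<close>)
      have 4: "within ?w (Inc (r + 2)) ((?R i)(r + 1 := ?x (Suc i)), 0, ?out (Suc i)) 2
          ((?R i)(r + 1 := ?x (Suc i), r + 2 := Suc i), 0, ?out (Suc i))"
        by (rule within_mono[OF within_Inc order_refl]) (auto simp: fun_eq_iff)
      have 5: "within ?w (Dec r) ((?R i)(r + 1 := ?x (Suc i), r + 2 := Suc i), 0, ?out (Suc i)) 1
          (?R (Suc i), 0, ?out (Suc i))"
        by (rule within_mono[OF within_Dec order_refl]) (auto simp: fun_eq_iff)
      show ?thesis
        by (rule within_Seq[OF 1 within_Seq[OF 2 within_Seq[OF 3 within_Seq[OF 4 5 order_refl] order_refl] order_refl]])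
          (use b t in linarith)
    qed
    have 3: "within ?w (While (Pos r) (?body \<rho> r)) (?R 0, 0, u) (?n * (?TB ?N + 2) + 1) (?R ?n, 0, ?out ?n)"
      by (rule within_While[where n = "?n" and T = "?TB ?N" and \<sigma> = "\<lambda>i. (?R i, 0, ?out i)"])
        (use body in simp_all)
    have 4: "within ?w (clear (r + 2)) (?R ?n, 0, ?out ?n) (3 * ?n + 1) (R(r + 1 := ?x ?n), 0, ?out ?n)"
      by (rule within_mono[OF within_clear order_refl]) (use R(5) in \<open>auto simp: fun_eq_iff\<close>)
    have 5: "within ?w (move_reg (r + 1) r) (R(r + 1 := ?x ?n), 0, ?out ?n) (5 * ?x ?n + 1)
        (R(r := ?x ?n), 0, ?out ?n)"
      by (rule within_mono[OF within_move_reg order_refl]) (use R(5) in \<open>auto simp: fun_eq_iff\<close>)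
    have "?n * (?TB ?N + 2) \<le> ?N * (?TB ?N + 2)" using le by (intro mult_le_mono1)
    moreover have "?x ?n \<le> D ?N" using bound by blast
    ultimately show "within ?w (?p \<rho> r) (R, 0, u) (?B ?N) (R(r := ?x ?n), 0, ?out ?n)"
      by (intro within_Seq[OF 1 within_Seq[OF 2 within_Seq[OF 3 within_Seq[OF 4 5 order_refl] order_refl] order_refl]])
        (use le in linarith)
  qed
qed

section \<open>Reading numbers from the input tape\<close>

definition nth_default :: "nat list \<Rightarrow> nat \<Rightarrow> nat" where
  "nth_default I a = (if a < length I then I ! a else 0)"

lemma word_tape_append_right: "word_tape (v @ w) (int (length v) + int j) = word_tape w (int j)"
  by (auto simp: word_tape_def nth_append nat_add_distrib)

lemma encs_split:
  "i < length I \<Longrightarrow> encs I = encs (take i I) @ replicate (I ! i) 1 @ 2 # encs (drop (Suc i) I)"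
  by (subst id_take_nth_drop[of i I]) (simp_all del: append_take_drop_id)

lemma nth_default_le: "nth_default I a \<le> length (encs I)"
  using encs_split[of a I] by (auto simp: nth_default_def)

text \<open>Register \<open>r + 2\<close> records the head position, so that the head can be brought
  back to cell 0 later. \<open>Dec (r + 3)\<close> stands for an empty branch, as that register is
  0.\<close>

definition skip_num :: "nat \<Rightarrow> com" where
  "skip_num r = While (Sym 1) (GoR ;; Inc (r + 2)) ;; Ite (Sym 2) (GoR ;; Inc (r + 2)) (Dec (r + 3))"

lemma word_tape_encs:
  assumes "i < length I"
  shows "j < I ! i \<Longrightarrow> word_tape (encs I) (int (length (encs (take i I)) + j)) = 1"
    "word_tape (encs I) (int (length (encs (take i I)) + I ! i)) = 2"
  unfolding encs_split[OF assms] of_nat_add word_tape_append_right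
  by (auto simp: word_tape_def nth_append)

text \<open>Past the end of \<open>I\<close> both \<open>P i\<close> and \<open>P (Suc i)\<close>
  are the total length and the head stays on the blank cell. So the claim holds for every
  \<open>i\<close>, and an index out of range needs no program of its own.\<close>

lemma within_skip_num:
  fixes I i
  defines "P \<equiv> \<lambda>i. length (encs (take i I))"
  assumes "R (r + 3) = 0" "R (r + 2) = P i"
  shows "within (encs I) (skip_num r) (R, int (P i), u) (5 * length (encs I) + 6)
    (R(r + 2 := P (Suc i)), int (P (Suc i)), u)"
proof (cases "i < length I")
  case True
  let ?a = "I ! i"
  have P: "P (Suc i) = P i + ?a + 1" using True by (simp add: P_def take_Suc_conv_app_nth)
  have le: "?a \<le> length (encs I)" using encs_split[OF True] by simp
  have 1: "within (encs I) (While (Sym 1) (GoR ;; Inc (r + 2))) (R, int (P i), u) (5 * ?a + 1)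
      (R(r + 2 := P i + ?a), int (P i + ?a), u)"
    by (rule within_While[where n = ?a and T = 3 and \<sigma> = "\<lambda>j. (R(r + 2 := P i + j), int (P i + j), u)"])
      (use True assms word_tape_encs[OF True]
       in \<open>auto simp: fun_eq_iff P_def intro!: within_Seq[OF within_GoR within_mono[OF within_Inc order_refl]]\<close>)
  have 2: "within (encs I) (Ite (Sym 2) (GoR ;; Inc (r + 2)) (Dec (r + 3)))
      (R(r + 2 := P i + ?a), int (P i + ?a), u) (3 + 2) (R(r + 2 := P (Suc i)), int (P (Suc i)), u)"
    by (rule within_Ite_True)
      (use word_tape_encs(2)[OF True] in \<open>auto simp: P[unfolded P_def] P_def fun_eq_iff intro!: within_Seq[OF within_GoR within_mono[OF within_Inc order_refl]]\<close>)
  show ?thesis unfolding skip_num_def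
    by (rule within_Seq[OF 1 2]) (use le in simp)
next
  case False
  then have P: "P (Suc i) = P i" "P i = length (encs I)" by (simp_all add: P_def)
  have blank: "word_tape (encs I) (int (length (encs I))) = 0" by (simp add: word_tape_def)
  have 1: "within (encs I) (While (Sym 1) (GoR ;; Inc (r + 2))) (R, int (P i), u) 1 (R, int (P i), u)"
    by (rule within_While[where n = 0 and \<sigma> = "\<lambda>j. (R, int (P i), u)"]) (simp_all add: P(2) blank)
  have 2: "within (encs I) (Ite (Sym 2) (GoR ;; Inc (r + 2)) (Dec (r + 3)))
      (R, int (P i), u) (1 + 2) (R(r + 2 := P (Suc i)), int (P (Suc i)), u)"
  proof (rule within_Ite_False)
    show "\<not> holds (encs I) (Sym 2) (R, int (P i), u)" by (simp add: P(2) blank)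
    have "R(r + 3 := R (r + 3) - 1) = R(r + 2 := P (Suc i))"
      using assms(2,3) P(1) by (auto simp: fun_eq_iff)
    then show "within (encs I) (Dec (r + 3)) (R, int (P i), u) 1 (R(r + 2 := P (Suc i)), int (P (Suc i)), u)"
      using within_Dec[of "encs I" "r + 3" R "int (P i)" u] by (simp add: P(1))
  qed
  show ?thesis unfolding skip_num_def by (rule within_Seq[OF 1 2]) simp
qed

lemma effective_input_var:
  assumes "x < k"
  shows "poly_computable k (\<lambda>I e. nth_default I (e x))"
proof -
  let ?p = "\<lambda>\<rho> r. add_reg (\<rho> x) (r + 1) (r + 2) ;; While (Pos (r + 1)) (Dec (r + 1) ;; skip_num r) ;;
    While (Sym 1) (GoR ;; Inc (r + 2) ;; Inc r) ;; While (Pos (r + 2)) (Dec (r + 2) ;; GoL)"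
  let ?B = "\<lambda>N. N * (5 * N + 9) + 27 * N + 5"
  show ?thesis
  proof (rule effectiveI[where p = ?p and d = 4 and B = ?B])
    show "poly_bounded ?B" by (intro poly_bounded_intros)
    show "regs_below (r + 4) (?p \<rho> r)" if "\<And>j. j < k \<Longrightarrow> \<rho> j < r" for \<rho> r
      using that[OF assms(1)] by (simp add: add_reg_def move_reg_def skip_num_def)
    fix I e
    let ?N = "arg_size k I e" let ?v = "e x" let ?w = "encs I" let ?a = "nth_default I (e x)"
    have le: "?v \<le> ?N" "length ?w \<le> ?N" using assms arg_le_size by (auto simp: arg_size_def)
    have le2: "?a \<le> length ?w" by (rule nth_default_le)
    show "?a \<le> ?B ?N" using le le2 by linarith
    fix \<rho> :: "nat \<Rightarrow> nat" and r R and u :: "nat list" assume a: "args k \<rho> r e R"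
    define P where "P = (\<lambda>i. length (encs (take i I)))"
    have R: "\<rho> x < r" "R (\<rho> x) = ?v" "\<And>q. q \<ge> r \<Longrightarrow> R q = 0"
      using a assms by (auto simp: args_def)
    let ?R = "\<lambda>i. R(r + 1 := ?v - i, r + 2 := P i)"
    have 1: "within ?w (add_reg (\<rho> x) (r + 1) (r + 2)) (R, 0, u) (12 * ?v + 2) (?R 0, int (P 0), u)"
      by (rule within_mono[OF within_add_reg order_refl]) (use R in \<open>auto simp: P_def fun_eq_iff\<close>)
    have body: "within ?w (Dec (r + 1) ;; skip_num r) (?R i, int (P i), u) (5 * length ?w + 7)
        (?R (Suc i), int (P (Suc i)), u)" for i
      unfolding P_def by (rule within_Seq[OF within_Dec within_mono[OF within_skip_num[where i = i] order_refl]])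
        (use R(3) in \<open>auto simp: fun_eq_iff\<close>)
    have 2: "within ?w (While (Pos (r + 1)) (Dec (r + 1) ;; skip_num r)) (?R 0, int (P 0), u)
        (?v * (5 * length ?w + 9) + 1) (?R ?v, int (P ?v), u)"
      by (rule within_While[where n = ?v and T = "5 * length ?w + 7" and \<sigma> = "\<lambda>i. (?R i, int (P i), u)"])
        (use body in auto)
    let ?R' = "\<lambda>i. R(r := i, r + 2 := P ?v + i)"
    \<comment> \<open>The run of ones ends at the terminator 2 or, if the index is out of range, at
      once on a blank; the latter is the default value 0.\<close>
    have test: "i \<le> ?a \<Longrightarrow> word_tape ?w (int (P ?v + i)) = 1 \<longleftrightarrow> i < ?a" for i
    proof (cases "?v < length I")
      case True
      assume "i \<le> ?a"
      then show ?thesis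
        using word_tape_encs(1)[OF True, of i] word_tape_encs(2)[OF True] True
        by (cases "i = ?a") (auto simp: P_def nth_default_def)
    next
      case False
      assume "i \<le> ?a"
      then show ?thesis using False by (simp add: P_def nth_default_def word_tape_def)
    qed
    have 3: "within ?w (While (Sym 1) (GoR ;; Inc (r + 2) ;; Inc r)) (?R ?v, int (P ?v), u)
        (7 * ?a + 1) (?R' ?a, int (P ?v + ?a), u)"
      by (rule within_While[where n = ?a and T = 5 and \<sigma> = "\<lambda>i. (?R' i, int (P ?v + i), u)"])
        (use test R(3) in \<open>auto simp: fun_eq_iff intro!: within_Seq[OF within_GoR within_Seq[OF within_Inc within_mono[OF within_Inc order_refl]]]\<close>)
    have P: "P ?v + ?a \<le> length ?w"
    proof (cases "?v < length I")
      case True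
      then show ?thesis using arg_cong[OF encs_split[OF True], of length] by (simp add: P_def nth_default_def)
    qed (simp add: P_def nth_default_def)
    have 4: "within ?w (While (Pos (r + 2)) (Dec (r + 2) ;; GoL)) (?R' ?a, int (P ?v + ?a), u)
        (4 * (P ?v + ?a) + 1) (R(r := ?a), 0, u)"
      by (rule within_While[where n = "P ?v + ?a" and T = 2 and
            \<sigma> = "\<lambda>i. (R(r := ?a, r + 2 := P ?v + ?a - i), int (P ?v + ?a - i), u)"])
        (use R(3) in \<open>auto simp: fun_eq_iff intro!: within_Seq[OF within_Dec within_mono[OF within_GoL order_refl]]\<close>)
    have "?v * (5 * length ?w + 9) \<le> ?N * (5 * ?N + 9)" using le by (intro mult_mono) auto
    moreover have "12 * ?v + 2 + (x + 1 + (7 * ?a + 1 + (4 * (P ?v + ?a) + 1))) \<le> y + 27 * ?N + 5"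
      if "x \<le> y" for x y
    proof -
      have "?a \<le> ?N" "P ?v + ?a \<le> ?N" using le le2 P by linarith+
      then show ?thesis using that le(1) by simp
    qed
    ultimately have "within ?w (?p \<rho> r) (R, 0, u) (?B ?N) (R(r := ?a), 0, u)"
      by (intro within_Seq[OF 1 within_Seq[OF 2 within_Seq[OF 3 4 order_refl] order_refl]]) blast
    then show "within ?w (?p \<rho> r) (R, 0, u) (?B ?N) (R(r := ?a), 0, u @ encs [])" by simp
  qed
qed

lemma poly_printable_machine:
  assumes "poly_printable 0 S"
  shows "\<exists>M a k. wf_tm M \<and>
    (\<forall>I e. tm_outputs_within M (encs I) (encs (S I e)) (a * (length (encs I) + 1) ^ k))"
proof -
  obtain p d B where B: "poly_bounded B"
    and p1: "\<And>\<rho> r. (\<And>j. j < 0 \<Longrightarrow> \<rho> j < r) \<Longrightarrow> regs_below (r + d) (p \<rho> r)"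
    and p3: "\<And>\<rho> r I e R u. args 0 \<rho> r e R \<Longrightarrow>
        within (encs I) (p \<rho> r) (R, 0, u) (B (arg_size 0 I e)) (R(r := 0), 0, u @ encs (S I e))"
    using effectiveE[OF assms(1)] by metis
  obtain a k where ak: "\<And>N. B N \<le> a * (N + 1) ^ k" using B by (auto simp: poly_bounded_def)
  let ?c = "p (\<lambda>_. 0) 0"
  have regs: "regs_below d ?c" using p1[of "\<lambda>_. 0" 0] by simp
  have "tm_outputs_within (machine d ?c) (encs I) (encs (S I e)) (a * (length (encs I) + 1) ^ k)" for I e
  proof -
    have "within (encs I) ?c (\<lambda>_. 0, 0, []) (B (length (encs I))) (\<lambda>_. 0, 0, encs (S I e))"
      using p3[of "\<lambda>_. 0" 0 e "\<lambda>_. 0" I "[]"] by (simp add: args_def arg_size_def fun_upd_idem)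
    then obtain t where "t \<le> B (length (encs I))" "run (encs I) ?c (\<lambda>_. 0, 0, []) t (\<lambda>_. 0, 0, encs (S I e))"
      by (auto simp: within_def)
    then show ?thesis using machine_outputs[OF _ regs] ak le_trans by blast
  qed
  then show ?thesis using wf_tm_machine[OF regs] by blast
qed


section \<open>Closure properties of polynomial time\<close>

lemma effective_cong:
  assumes "effective k F S" "\<And>I e. F I e = F' I e" "\<And>I e. S I e = S' I e"
  shows "effective k F' S'"
proof -
  have "F = F'" "S = S'" using assms(2,3) by (intro ext; simp)+
  then show ?thesis using assms(1) by simp
qed

lemma poly_bounded_value:
  assumes "effective k F S"
  obtains B where "poly_bounded B" "\<And>I e. F I e \<le> B (arg_size k I e)"
  using assms by (metis effectiveE)

lemma effective_let:
  assumes "poly_computable k A" "effective (Suc k) F S"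
  shows "effective k (\<lambda>I e. F I (case_nat (A I e) e)) (\<lambda>I e. S I (case_nat (A I e) e))"
  by (rule effective_cong[OF effective_bind[OF assms]]) simp_all

lemma effective_weaken:
  "effective k F S \<Longrightarrow> effective (Suc k) (\<lambda>I e. F I (\<lambda>j. e (Suc j))) (\<lambda>I e. S I (\<lambda>j. e (Suc j)))"
  by (rule effective_rename) simp_all

lemma effective_let2:
  assumes "poly_computable k A" "poly_computable k B" "effective (Suc (Suc k)) F S"
  shows "effective k (\<lambda>I e. F I (case_nat (B I e) (case_nat (A I e) e)))
    (\<lambda>I e. S I (case_nat (B I e) (case_nat (A I e) e)))"
  using effective_let[OF assms(1) effective_let[OF effective_weaken[OF assms(2)] assms(3)]] by simp

lemma poly_computable_add:
  "poly_computable k A \<Longrightarrow> poly_computable k B \<Longrightarrow> poly_computable k (\<lambda>I e. A I e + B I e)"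
  using effective_let2[of k A B "\<lambda>I e. e 1 + e 0"] effective_add_vars[of 1 "Suc (Suc k)" 0] by simp

lemma poly_computable_diff:
  "poly_computable k A \<Longrightarrow> poly_computable k B \<Longrightarrow> poly_computable k (\<lambda>I e. A I e - B I e)"
  using effective_let2[of k A B "\<lambda>I e. e 1 - e 0"] effective_diff_vars[of 1 "Suc (Suc k)" 0] by simp

lemma poly_computable_Suc: "poly_computable k A \<Longrightarrow> poly_computable k (\<lambda>I e. Suc (A I e))"
  using poly_computable_add[OF _ effective_const[of k 1]] by simp

lemma poly_computable_nth_default:
  "poly_computable k A \<Longrightarrow> poly_computable k (\<lambda>I e. nth_default I (A I e))"
  using effective_let[of k A "\<lambda>I e. nth_default I (e 0)"] effective_input_var[of 0 "Suc k"] by simp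

lemma effective_if_zero:
  assumes "poly_computable k A" "effective k F S" "effective k G T"
  shows "effective k (\<lambda>I e. if A I e = 0 then F I e else G I e) (\<lambda>I e. if A I e = 0 then S I e else T I e)"
  by (rule effective_cong[OF effective_let[OF assms(1)
        effective_if_var[OF effective_weaken[OF assms(2)] effective_weaken[OF assms(3)], of 0]]]) simp_all

lemma poly_computable_if_eq:
  assumes "poly_computable k A" "poly_computable k B" "poly_computable k F" "poly_computable k G"
  shows "poly_computable k (\<lambda>I e. if A I e = B I e then F I e else G I e)"
proof -
  have "poly_computable k (\<lambda>I e. (A I e - B I e) + (B I e - A I e))"
    by (intro poly_computable_add poly_computable_diff assms)
  from effective_if_zero[OF this assms(3,4)]
  show ?thesis by (rule effective_cong) auto
qed

lemma poly_computable_if_less: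
  assumes "poly_computable k A" "poly_computable k B" "poly_computable k F" "poly_computable k G"
  shows "poly_computable k (\<lambda>I e. if A I e < B I e then F I e else G I e)"
proof -
  have "poly_computable k (\<lambda>I e. Suc (A I e) - B I e)"
    by (intro poly_computable_Suc poly_computable_diff assms)
  from effective_if_zero[OF this assms(3,4)]
  show ?thesis by (rule effective_cong) auto
qed

lemma poly_printable_if_eq:
  assumes "poly_computable k A" "poly_computable k B" "poly_printable k F" "poly_printable k G"
  shows "poly_printable k (\<lambda>I e. if A I e = B I e then F I e else G I e)"
proof -
  have "poly_computable k (\<lambda>I e. (A I e - B I e) + (B I e - A I e))"
    by (intro poly_computable_add poly_computable_diff assms)
  from effective_if_zero[OF this assms(3,4)]
  show ?thesis by (rule effective_cong) auto
qed

text \<open>The values of an iteration stay polynomially bounded because each round adds at most a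
  polynomially bounded amount.\<close>

lemma effective_iterate:
  assumes N: "poly_computable k N" and Z: "poly_computable k Z" and F: "effective (Suc (Suc k)) F S"
    and D: "poly_bounded D"
    and le: "\<And>I e i x. F I (case_nat i (case_nat x e)) \<le> x + D (i + arg_size k I e)"
  defines "X \<equiv> \<lambda>I e. rec_nat (Z I e) (\<lambda>i x. F I (case_nat i (case_nat x e)))"
  shows "effective k (\<lambda>I e. X I e (N I e))
    (\<lambda>I e. concat (map (\<lambda>i. S I (case_nat i (case_nat (X I e i) e))) [0..<N I e]))"
proof -
  \<comment> \<open>\<open>effective_loop\<close> takes the start value and the number of rounds
    from arguments 0 and 1. In the body these appear as arguments 2 and 3, behind the index and the
    current value, and \<open>h\<close> skips them.\<close>
  define h :: "nat \<Rightarrow> nat" where "h j = (if j < 2 then j else j + 2)" for j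
  define F' where "F' I e = F I (\<lambda>j. e (h j))" for I e
  define S' where "S' I e = S I (\<lambda>j. e (h j))" for I e
  have h: "(\<lambda>j. case_nat i (case_nat x (case_nat z (case_nat n e))) (h j)) = case_nat i (case_nat x e)"
    for i x z n and e :: "nat \<Rightarrow> nat"
    by (rule ext) (simp add: h_def numeral_2_eq_2 split: nat.split)
  have h': "(\<lambda>j. case_nat i (case_nat x e) (h j)) = case_nat i (case_nat x (\<lambda>j. e (Suc (Suc j))))"
    for i x and e :: "nat \<Rightarrow> nat"
    by (rule ext) (simp add: h_def numeral_2_eq_2 split: nat.split)
  have F': "effective (Suc (Suc (Suc (Suc k)))) F' S'"
    unfolding F'_def S'_def by (rule effective_rename[OF F]) (auto simp: h_def)
  let ?X = "\<lambda>I e. rec_nat (e 0) (\<lambda>i x. F' I (case_nat i (case_nat x e)))"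
  let ?k = "Suc (Suc k)"
  have bound: "?X I e i \<le> arg_size ?k I e + arg_size ?k I e * D (arg_size ?k I e + arg_size ?k I e)"
    if "i \<le> e 1" for I e i
  proof -
    let ?A = "arg_size ?k I e"
    have i: "e 0 \<le> ?A" "e 1 \<le> ?A" by (rule arg_le_size; simp)+
    have sub: "arg_size k I (\<lambda>j. e (Suc (Suc j))) \<le> ?A"
      by (simp add: arg_size_def sum.lessThan_Suc_shift del: sum.lessThan_Suc)
    have "?X I e i \<le> ?A + i * D (?A + ?A)" using that
    proof (induction i)
      case 0
      then show ?case using i by simp
    next
      case (Suc i)
      have "?X I e (Suc i) \<le> ?X I e i + D (i + arg_size k I (\<lambda>j. e (Suc (Suc j))))"
        using le by (simp add: F'_def h')
      also have "D (i + arg_size k I (\<lambda>j. e (Suc (Suc j)))) \<le> D (?A + ?A)"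
        using Suc.prems i sub by (intro poly_bounded_mono[OF D]) simp
      finally show ?case using Suc by simp
    qed
    also have "\<dots> \<le> ?A + ?A * D (?A + ?A)" using that i by simp
    finally show ?thesis .
  qed
  have "effective ?k (\<lambda>I e. ?X I e (e 1))
      (\<lambda>I e. concat (map (\<lambda>i. S' I (case_nat i (case_nat (?X I e i) e))) [0..<e 1]))"
    using effective_loop[OF F', of 1 0 "\<lambda>N. N + N * D (N + N)"] bound
    by (simp add: poly_bounded_intros poly_bounded_compose[OF D])
  from effective_let2[OF N Z this] show ?thesis
    by (rule effective_cong) (simp_all add: F'_def S'_def h X_def)
qed

lemma poly_computable_iterate:
  assumes "poly_computable k N" "poly_computable k Z" "poly_computable (Suc (Suc k)) F"
    "poly_bounded D" "\<And>I e i x. F I (case_nat i (case_nat x e)) \<le> x + D (i + arg_size k I e)"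
  shows "poly_computable k (\<lambda>I e. rec_nat (Z I e) (\<lambda>i x. F I (case_nat i (case_nat x e))) (N I e))"
  by (rule effective_cong[OF effective_iterate[OF assms]]) simp_all

lemma poly_computable_sum:
  assumes "poly_computable (Suc k) F" "poly_computable k N"
  shows "poly_computable k (\<lambda>I e. \<Sum>i<N I e. F I (case_nat i e))"
proof -
  obtain B where B: "poly_bounded B" and le: "\<And>I e. F I e \<le> B (arg_size (Suc k) I e)"
    using poly_bounded_value[OF assms(1)] by metis
  \<comment> \<open>Argument 1 of the body is the sum so far, which \<open>h\<close> hides from the
    summand.\<close>
  define h :: "nat \<Rightarrow> nat" where "h j = (if j = 0 then 0 else Suc j)" for j
  have h: "(\<lambda>j. case_nat i (case_nat x e) (h j)) = case_nat i e" for i x and e :: "nat \<Rightarrow> nat"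
    by (rule ext) (simp add: h_def split: nat.split)
  have "poly_computable (Suc (Suc k)) (\<lambda>I e. e 1 + F I (\<lambda>j. e (h j)))"
    by (intro poly_computable_add effective_var effective_cong[OF effective_rename[OF assms(1), of h]])
      (auto simp: h_def)
  from poly_computable_iterate[OF assms(2) effective_const[of k 0] this B]
  have "poly_computable k (\<lambda>I e. rec_nat 0 (\<lambda>i x. x + F I (case_nat i e)) (N I e))"
    using le[of _ "case_nat _ _"] by (simp add: h arg_size_push)
  moreover have "rec_nat 0 (\<lambda>i x. x + f i) n = (\<Sum>i<n. f i)" for f :: "nat \<Rightarrow> nat" and n
    by (induction n) simp_all
  ultimately show ?thesis by simp
qed

lemma poly_computable_mult:
  assumes "poly_computable k A" "poly_computable k B"
  shows "poly_computable k (\<lambda>I e. A I e * B I e)"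
  using poly_computable_sum[OF effective_weaken[OF assms(2)] assms(1)] by simp

lemma poly_printable_number:
  "poly_computable k A \<Longrightarrow> poly_printable k (\<lambda>I e. [A I e])"
  using effective_let[of k A "\<lambda>I e. 0" "\<lambda>I e. [e 0]"] effective_print_var[of 0 "Suc k"] by simp

lemma poly_printable_append:
  assumes "poly_printable k S" "poly_printable k T"
  shows "poly_printable k (\<lambda>I e. S I e @ T I e)"
  using effective_bind[OF assms(1) effective_weaken[OF assms(2)]] by simp

lemma poly_printable_Cons:
  "poly_computable k A \<Longrightarrow> poly_printable k S \<Longrightarrow> poly_printable k (\<lambda>I e. A I e # S I e)"
  using poly_printable_append[OF poly_printable_number] by simp

lemma poly_printable_concat:
  assumes "poly_printable (Suc k) S" "poly_computable k N"
  shows "poly_printable k (\<lambda>I e. concat (map (\<lambda>i. S I (case_nat i e)) [0..<N I e]))"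
proof -
  define h :: "nat \<Rightarrow> nat" where "h j = (if j = 0 then 0 else Suc j)" for j
  have h: "(\<lambda>j. case_nat i (case_nat x e) (h j)) = case_nat i e" for i x and e :: "nat \<Rightarrow> nat"
    by (rule ext) (simp add: h_def split: nat.split)
  have "poly_printable (Suc (Suc k)) (\<lambda>I e. S I (\<lambda>j. e (h j)))"
    by (rule effective_cong[OF effective_rename[OF assms(1), of h]]) (auto simp: h_def)
  from effective_iterate[OF assms(2) effective_const[of k 0] this poly_bounded_const[of 0]]
  have "effective k (\<lambda>I e. rec_nat 0 (\<lambda>i x. 0) (N I e))
      (\<lambda>I e. concat (map (\<lambda>i. S I (case_nat i e)) [0..<N I e]))" by (simp add: h)
  moreover have "rec_nat 0 (\<lambda>i x. 0) n = (0::nat)" for n by (cases n) simp_all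
  ultimately show ?thesis by simp
qed

lemma poly_printable_map:
  assumes "poly_computable (Suc k) F" "poly_computable k N"
  shows "poly_printable k (\<lambda>I e. map (\<lambda>i. F I (case_nat i e)) [0..<N I e])"
proof -
  have "concat (map (\<lambda>i. [f i]) xs) = map f xs" for f :: "nat \<Rightarrow> nat" and xs
    by (induction xs) simp_all
  then show ?thesis
    using poly_printable_concat[OF poly_printable_number[OF assms(1)] assms(2)] by simp
qed

lemma poly_computable_unary:
  assumes "poly_computable 1 (\<lambda>I e. f I (e 0))" "poly_computable k A"
  shows "poly_computable k (\<lambda>I e. f I (A I e))"
  using effective_let[OF assms(2) effective_rename[OF assms(1), of "\<lambda>j. j" "Suc k"]] by simp

lemma poly_computable_binary:
  assumes "poly_computable 2 (\<lambda>I e. f I (e 0) (e 1))" "poly_computable k A" "poly_computable k B"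
  shows "poly_computable k (\<lambda>I e. f I (A I e) (B I e))"
  using effective_let2[OF assms(3,2) effective_rename[OF assms(1), of "\<lambda>j. j" "Suc (Suc k)"]] by simp

text \<open>\<open>L\<close> is a fixed list, so it becomes a nest of case distinctions in the
  program. This gives access to the number of outputs of a gate from its index.\<close>

lemma poly_computable_table:
  assumes "poly_computable k A"
  shows "poly_computable k (\<lambda>I e. if A I e < length L then f (L ! A I e) else 0)"
proof (induction L rule: rev_induct)
  case Nil
  then show ?case using effective_const[of k 0] by simp
next
  case (snoc x L)
  from poly_computable_if_eq[OF assms effective_const[of k "length L"] effective_const[of k "f x"] snoc]
  show ?case by (rule effective_cong) (auto simp: nth_append)
qed

lemmas poly_computable_intros =
  effective_const effective_var poly_computable_add poly_computable_diff poly_computable_Suc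
  poly_computable_mult poly_computable_nth_default poly_computable_if_eq poly_computable_if_less

lemmas poly_printable_intros =
  poly_printable_Cons poly_printable_append poly_printable_if_eq

section \<open>Circuits without wire exchanges\<close>

fun new_wires :: "gate list \<Rightarrow> operation list \<Rightarrow> nat" where
  "new_wires G [] = 0"
| "new_wires G (Gate g ps # os) = gate_out (G ! g) + new_wires G os"
| "new_wires G (Swap i # os) = new_wires G os"

abbreviation exec :: "gate list \<Rightarrow> operation list \<Rightarrow> trit list \<Rightarrow> trit list" where
  "exec G os vs \<equiv> fold (exec_op G) os vs"

lemma new_wires_append [simp]: "new_wires G (os @ os') = new_wires G os + new_wires G os'"
  by (induction G os rule: new_wires.induct) simp_all

lemma wf_ops_append:
  "wf_ops G w (os @ os') ps \<longleftrightarrow> wf_ops G w os [] \<and> wf_ops G (w + new_wires G os) os' ps"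
  by (induction G w os "[] :: nat list" rule: wf_ops.induct) (auto simp: add.assoc)

lemma wf_ops_outs: "wf_ops G w os ps \<longleftrightarrow> wf_ops G w os [] \<and> (\<forall>p\<in>set ps. p < w + new_wires G os)"
  using wf_ops_append[of G w os "[]" ps] by simp

lemma length_exec:
  assumes "wf_gates G" "wf_ops G (length vs) os ps"
  shows "length (exec G os vs) = length vs + new_wires G os"
  using assms(2)
proof (induction os arbitrary: vs)
  case (Cons op os)
  show ?case
  proof (cases op)
    case (Gate g qs)
    then have "length (gate_fun (G ! g) (map ((!) vs) qs)) = gate_out (G ! g)"
      using Cons.prems assms(1) by (simp add: wf_gates_def)
    then show ?thesis using Cons Gate by simp
  qed (use Cons in simp)
qed simp

fun is_gate :: "operation \<Rightarrow> bool" where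
  "is_gate (Gate g ps) \<longleftrightarrow> True"
| "is_gate (Swap i) \<longleftrightarrow> False"

abbreviation swap_free :: "operation list \<Rightarrow> bool" where
  "swap_free os \<equiv> \<forall>op\<in>set os. is_gate op"

lemma exec_extends: "swap_free os \<Longrightarrow> \<exists>ys. exec G os vs = vs @ ys"
proof (induction os arbitrary: vs)
  case (Cons op os)
  obtain g ps where op: "op = Gate g ps" using Cons.prems by (cases op) auto
  then show ?case using Cons.IH[of "vs @ _"] Cons.prems by fastforce
qed simp

text \<open>The reason for removing exchanges: a wire keeps its position and value for ever, so all
  intermediate values can be read off the final list of wires.\<close>

lemma exec_nth_old: "swap_free os \<Longrightarrow> p < length vs \<Longrightarrow> exec G os vs ! p = vs ! p"
  using exec_extends[of os G vs] by (auto simp: nth_append)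

fun swap_pos :: "operation \<Rightarrow> nat \<Rightarrow> nat" where
  "swap_pos (Gate g ps) p = p"
| "swap_pos (Swap i) p = (if p = i then Suc p else if p = Suc i then p - 1 else p)"

text \<open>The position at which the wire at position \<open>p\<close> would be if no wires had been exchanged:
  exchanges are traced back from the last to the first.\<close>

definition origin :: "operation list \<Rightarrow> nat \<Rightarrow> nat" where
  "origin os p = foldr swap_pos os p"

lemma origin_simps [simp]:
  "origin [] p = p" "origin (os @ [op]) p = origin os (swap_pos op p)"
  by (simp_all add: origin_def)

text \<open>Given by the position \<open>t\<close> rather than by recursion on the list, because
  this is how a printing loop over \<open>t\<close> produces it.\<close>

definition straight_op :: "operation list \<Rightarrow> nat \<Rightarrow> operation list" where
  "straight_op os t =
     (case os ! t of Gate g ps \<Rightarrow> [Gate g (map (origin (take t os)) ps)] | Swap i \<Rightarrow> [])"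

definition straighten :: "operation list \<Rightarrow> operation list" where
  "straighten os = concat (map (straight_op os) [0..<length os])"

lemma straighten_Nil [simp]: "straighten [] = []"
  by (simp add: straighten_def)

lemma straighten_snoc:
  "straighten (os @ [op]) =
     straighten os @ (case op of Gate g ps \<Rightarrow> [Gate g (map (origin os) ps)] | Swap i \<Rightarrow> [])"
proof -
  have "map (straight_op (os @ [op])) [0..<length os] = map (straight_op os) [0..<length os]"
    by (auto simp: straight_op_def nth_append split: operation.split)
  moreover have "straight_op (os @ [op]) (length os) =
      (case op of Gate g ps \<Rightarrow> [Gate g (map (origin os) ps)] | Swap i \<Rightarrow> [])"
    by (cases op) (simp_all add: straight_op_def)
  ultimately show ?thesis by (simp add: straighten_def del: map_eq_conv)
qed

lemma swap_free_straighten: "swap_free (straighten os)"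
  by (induction os rule: rev_induct) (auto simp: straighten_snoc split: operation.split)

text \<open>Exchanging two values amounts to exchanging all later references to them. So the
  exchange is dropped, and the links behind it are traced back to the wires where the values were
  created.\<close>

lemma straighten_correct:
  assumes "wf_gates G" "wf_ops G (length x) os []"
  shows "wf_ops G (length x) (straighten os) [] \<and> new_wires G (straighten os) = new_wires G os \<and>
    (\<forall>p < length x + new_wires G os. origin os p < length x + new_wires G os \<and>
       exec G os x ! p = exec G (straighten os) x ! origin os p)"
  using assms(2)
proof (induction os rule: rev_induct)
  case (snoc op os)
  let ?w = "length x + new_wires G os"
  let ?vs = "exec G os x" and ?us = "exec G (straighten os) x"
  have wf: "wf_ops G (length x) os []" and wf_op: "wf_ops G ?w [op] []"
    using snoc.prems by (auto simp: wf_ops_append)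
  have IH: "wf_ops G (length x) (straighten os) []" "new_wires G (straighten os) = new_wires G os"
    "\<And>p. p < ?w \<Longrightarrow> origin os p < ?w \<and> ?vs ! p = ?us ! origin os p"
    using snoc.IH[OF wf] by auto
  have len: "length ?vs = ?w" "length ?us = ?w"
    using length_exec[OF assms(1)] wf IH(1,2) by metis+
  \<comment> \<open>Exchanges only concern wires that exist at their time, so the outputs of a gate
    added now are not affected by the earlier ones.\<close>
  have new: "origin os p = p" if "?w \<le> p" for p
  proof -
    have "origin os p = p" if "wf_ops G w os []" "w + new_wires G os \<le> p" for w
      using that
    proof (induction os arbitrary: w)
      case (Cons op os)
      then show ?case by (cases op) (auto simp: origin_def)
    qed simp
    then show ?thesis using wf that by blast
  qed
  show ?case
  proof (cases op)
    case (Gate g ps)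
    let ?ys = "gate_fun (G ! g) (map ((!) ?vs) ps)"
    have ps: "\<forall>p\<in>set ps. p < ?w" "g < length G" "length ps = gate_in (G ! g)"
      using wf_op Gate by auto
    have eq: "map ((!) ?us) (map (origin os) ps) = map ((!) ?vs) ps"
      using ps(1) IH(3) by auto
    have us: "exec G (straighten (os @ [op])) x = ?us @ ?ys" and vs: "exec G (os @ [op]) x = ?vs @ ?ys"
      by (simp_all add: straighten_snoc Gate eq del: map_map)
    have "wf_ops G (length x) (straighten (os @ [op])) []"
      using Gate IH ps by (auto simp: straighten_snoc wf_ops_append)
    moreover have "origin os p < ?w + gate_out (G ! g) \<and> (?vs @ ?ys) ! p = (?us @ ?ys) ! origin os p"
      if "p < ?w + gate_out (G ! g)" for p
    proof (cases "p < ?w")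
      case True
      then show ?thesis using IH(3)[OF True] len by (auto simp: nth_append)
    next
      case False
      then show ?thesis using new[of p] that len by (auto simp: nth_append)
    qed
    ultimately show ?thesis unfolding us vs using Gate IH(2)
      by (simp add: straighten_snoc add.assoc)
  next
    case (Swap i)
    have i: "Suc i < ?w" using wf_op Swap by simp
    have "?vs[i := ?vs ! Suc i, Suc i := ?vs ! i] ! p = ?vs ! swap_pos op p" if "p < ?w" for p
      using i that len Swap by (auto simp: nth_list_update)
    moreover have "swap_pos op p < ?w" if "p < ?w" for p using i that Swap by auto
    ultimately show ?thesis using IH Swap by (simp add: straighten_snoc)
  qed
qed simp

fun rename_op :: "(nat \<Rightarrow> nat) \<Rightarrow> operation \<Rightarrow> operation" where
  "rename_op h (Gate g ps) = Gate g (map h ps)"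
| "rename_op h (Swap i) = Swap i"

lemma new_wires_rename [simp]: "new_wires G (map (rename_op h) os) = new_wires G os"
  by (induction G os rule: new_wires.induct) simp_all

lemma swap_free_rename [simp]: "swap_free (map (rename_op h) os) \<longleftrightarrow> swap_free os"
proof -
  have "is_gate (rename_op h op) = is_gate op" for op by (cases op) auto
  then show ?thesis by simp
qed

text \<open>\<open>placed a W h\<close>: a circuit with \<open>a\<close> inputs is copied to a place where \<open>W\<close> wires are present,
  and its wire \<open>p\<close> becomes wire \<open>h p\<close>.\<close>

definition placed :: "nat \<Rightarrow> nat \<Rightarrow> (nat \<Rightarrow> nat) \<Rightarrow> bool" where
  "placed a W h \<longleftrightarrow> (\<forall>p<a. h p < W) \<and> (\<forall>r. h (a + r) = W + r)"

lemma placed_less: "placed a W h \<Longrightarrow> p < a + r \<Longrightarrow> h p < W + r"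
  unfolding placed_def by (metis add_less_cancel_left le_Suc_ex not_le trans_less_add1)

lemma placed_step: "placed a W h \<Longrightarrow> placed (a + d) (W + d) h"
  using placed_less by (auto simp: placed_def add.assoc)

lemma wf_ops_rename:
  "placed a W h \<Longrightarrow> swap_free os \<Longrightarrow> wf_ops G a os [] \<Longrightarrow> wf_ops G W (map (rename_op h) os) []"
proof (induction os arbitrary: a W)
  case (Cons op os)
  obtain g ps where op: "op = Gate g ps" using Cons.prems by (cases op) auto
  have "wf_ops G (W + gate_out (G ! g)) (map (rename_op h) os) []"
    using Cons.prems op by (intro Cons.IH[OF placed_step]) auto
  then show ?case using Cons.prems op by (auto simp: placed_def)
qed simp

lemma exec_rename:
  assumes "wf_gates G" "placed (length us) (length vs) h" "swap_free os" "wf_ops G (length us) os []"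
    "\<And>p. p < length us \<Longrightarrow> vs ! h p = us ! p" "p < length us + new_wires G os"
  shows "exec G (map (rename_op h) os) vs ! h p = exec G os us ! p"
  using assms(2-)
proof (induction os arbitrary: us vs)
  case (Cons op os)
  obtain g ps where op: "op = Gate g ps" using Cons.prems by (cases op) auto
  let ?ys = "gate_fun (G ! g) (map ((!) us) ps)"
  have len: "length ?ys = gate_out (G ! g)"
    using Cons.prems op assms(1) by (simp add: wf_gates_def)
  have eq: "map ((!) vs) (map h ps) = map ((!) us) ps"
    using Cons.prems op by auto
  have "exec G (map (rename_op h) os) (vs @ ?ys) ! h p = exec G os (us @ ?ys) ! p"
  proof (rule Cons.IH)
    show "placed (length (us @ ?ys)) (length (vs @ ?ys)) h"
      using placed_step[OF Cons.prems(1)] by simp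
    fix q assume "q < length (us @ ?ys)"
    show "(vs @ ?ys) ! h q = (us @ ?ys) ! q"
    proof (cases "q < length us")
      case True
      then show ?thesis using Cons.prems by (simp add: nth_append placed_def)
    next
      case False
      then obtain r where r: "q = length us + r" by (metis le_Suc_ex not_le)
      then have "h q = length vs + r" using Cons.prems(1) by (simp add: placed_def)
      then show ?thesis using r by (simp add: nth_append)
    qed
  qed (use Cons.prems op len in auto)
  then show ?case by (simp add: op eq del: map_map)
qed simp

text \<open>Both sides speak of the final list \<open>V\<close>. Each copy thus contributes an
  equation between entries of \<open>V\<close>, and the later reasoning about values can forget the
  order of execution.\<close>

lemma placed_copy:
  assumes "wf_gates G" "placed a W h" "swap_free os" "wf_ops G a os []"
    "wf_ops G (length x) A []" "W = length x + new_wires G A" "swap_free B"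
    "p < a + new_wires G os" and V: "V = exec G (A @ map (rename_op h) os @ B) x"
  shows "V ! h p = exec G os (map (\<lambda>p. V ! h p) [0..<a]) ! p"
proof -
  let ?vs = "exec G A x"
  let ?vs' = "exec G (map (rename_op h) os) ?vs"
  have len: "length ?vs = W" using length_exec[OF assms(1,5)] assms(6) by simp
  have wf: "wf_ops G W (map (rename_op h) os) []" by (rule wf_ops_rename[OF assms(2-4)])
  have len': "length ?vs' = W + new_wires G os"
    using length_exec[OF assms(1), of ?vs] wf len by simp
  have V: "V = exec G B ?vs'" using V by simp
  have V1: "V ! q = ?vs' ! q" if "q < W + new_wires G os" for q
    unfolding V using that len' assms(7) by (intro exec_nth_old) auto
  have V0: "V ! q = ?vs ! q" if "q < W" for q
    using V1[of q] that len exec_nth_old[of "map (rename_op h) os" q ?vs G] assms(3)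
    by (simp add: swap_free_rename del: set_map)
  have "?vs' ! h p = exec G os (map (\<lambda>p. V ! h p) [0..<a]) ! p"
    using assms(1-4,8) len V0 by (intro exec_rename) (auto simp: placed_def)
  then show ?thesis using V1[of "h p"] placed_less[OF assms(2,8)] by simp
qed

lemma wf_ops_concat:
  assumes "\<And>l. l < N \<Longrightarrow> wf_ops G (W + l * S) (f l) [] \<and> new_wires G (f l) = S"
  shows "wf_ops G W (concat (map f [0..<N])) [] \<and> new_wires G (concat (map f [0..<N])) = N * S"
  using assms by (induction N) (auto simp: wf_ops_append)

lemma concat_split:
  assumes "l < N"
  shows "concat (map f [0..<N]) = concat (map f [0..<l]) @ f l @ concat (map f [Suc l..<N])"
proof -
  have "[0..<N] = [0..<l] @ l # [Suc l..<N]"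
    using assms by (metis le0 less_imp_le upt_add_eq_append upt_conv_Cons le_add_diff_inverse)
  then show ?thesis by simp
qed

section \<open>Searching in a maximal prefix code\<close>

text \<open>Words are compared from the last position to the first: \<open>acc\<close> is the result for the later
  positions, where \<open>None\<close> stands for equality and \<open>Some True\<close> for \<open><\<close>.\<close>

definition cmp_trit :: "trit \<Rightarrow> trit \<Rightarrow> trit \<Rightarrow> trit" where
  "cmp_trit z y acc = (if z = y then acc else Some (z = Some False \<and> y = Some True))"

fun cmp_trits :: "trit list \<Rightarrow> trit list \<Rightarrow> trit" where
  "cmp_trits (z # zs) (y # ys) = cmp_trit z y (cmp_trits zs ys)"
| "cmp_trits _ _ = None"

lemma cmp_trits_None: "length zs = length ys \<Longrightarrow> cmp_trits zs ys = None \<longleftrightarrow> zs = ys"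
  by (induction zs ys rule: cmp_trits.induct) (auto simp: cmp_trit_def)

lemma cmp_trits_append: "cmp_trits (us @ zs) (us @ ys) = cmp_trits zs ys"
  by (induction us) (auto simp: cmp_trit_def)

lemma length_pad: "length w \<le> k \<Longrightarrow> length (pad k w) = k"
  by (simp add: pad_def)

lemma nth_pad: "l < k \<Longrightarrow> pad k w ! l = (if l < length w then Some (w ! l) else None)"
  by (simp add: pad_def nth_append)

text \<open>The word is recovered as the part before the first bottom.\<close>

lemma pad_inj:
  assumes "pad k v = pad k w" "length v \<le> k" "length w \<le> k"
  shows "v = w"
proof -
  have "takeWhile (\<lambda>t. t \<noteq> None) (map Some v @ replicate c None) = map Some v" for v :: word and c
    by (induction v; cases c) simp_all
  then have "takeWhile (\<lambda>t. t \<noteq> None) (pad k v) = map Some v" for v :: word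
    by (simp add: pad_def)
  then have "map Some v = map Some w" using assms(1) by metis
  then show ?thesis using inj_map_eq_map[of Some v w] by simp
qed

lemma cmp_trits_pad:
  assumes "z = q @ b # v" "y = q @ (\<not> b) # w"
  shows "cmp_trits (pad k z) (pad k y) = Some (\<not> b)"
  using assms by (simp add: pad_def cmp_trits_append) (simp add: cmp_trit_def)

text \<open>\<open>prev\<close> is the result of the earlier probes and has priority.
  \<open>z\<close> is the first trit of the evaluation and is bottom iff the probe is not in the
  code. Since \<open>None\<close> means equality, \<open>acc \<noteq> Some False\<close> expresses
  \<le>.\<close>

definition comb_trit :: "trit \<Rightarrow> trit \<Rightarrow> trit \<Rightarrow> trit" where
  "comb_trit prev z acc =
     (if prev \<noteq> None then prev else if z = None then None else Some (acc \<noteq> Some False))"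

text \<open>The letter \<open>x\<close> passes only if the candidate is in the code
  (\<open>z\<close>) and its image is equal to the input (\<open>acc\<close>).\<close>

definition mask_trit :: "trit \<Rightarrow> trit \<Rightarrow> trit \<Rightarrow> trit" where
  "mask_trit x z acc = (if z \<noteq> None \<and> acc = None then x else None)"

lemma dict_le_split:
  assumes "prefix_code P" "x \<in> P" "y \<in> P" "dict_le x y" "x \<noteq> y"
  obtains q v w where "x = q @ False # v" "y = q @ True # w"
  using assms unfolding dict_le_def prefix_code_def by blast

text \<open>A word incomparable with all of \<open>P\<close> could be added to
  \<open>P\<close>.\<close>

lemma maximal_prefix_code_comparable:
  assumes "maximal_prefix_code P"
  obtains p where "p \<in> P" "prefix p w \<or> prefix w p"
proof -
  have "\<exists>p\<in>P. prefix p w \<or> prefix w p"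
  proof (rule ccontr)
    assume no: "\<not> (\<exists>p\<in>P. prefix p w \<or> prefix w p)"
    have "prefix_code (insert w P)"
      unfolding prefix_code_def
    proof (intro ballI impI)
      fix x y assume "x \<in> insert w P" "y \<in> insert w P" "prefix x y"
      moreover have "prefix x y \<Longrightarrow> x = y" if "x \<in> P" "y \<in> P"
        using assms that unfolding maximal_prefix_code_def prefix_code_def by blast
      ultimately show "x = y" using no by (metis insert_iff)
    qed
    moreover have "P \<subset> insert w P" using no by auto
    ultimately show False using assms by (auto simp: maximal_prefix_code_def)
  qed
  then show ?thesis using that by blast
qed

text \<open>Otherwise the one-letter word that differs from \<open>p\<close> in its first letter
  would be incomparable with \<open>p\<close>.\<close>

lemma maximal_prefix_code_singleton:
  assumes "maximal_prefix_code {p}"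
  shows "p = []"
proof (cases p)
  case (Cons b v)
  obtain q where "q \<in> {p}" "prefix q [\<not> b] \<or> prefix [\<not> b] q"
    by (rule maximal_prefix_code_comparable[OF assms])
  then show ?thesis using Cons by (cases b) simp_all
qed

lemma length_le_maxlen: "finite P \<Longrightarrow> p \<in> P \<Longrightarrow> length p \<le> maxlen P"
  by (simp add: maxlen_def)

lemma maxlen_0_iff:
  assumes "finite P" "maximal_prefix_code P"
  shows "maxlen P = 0 \<longleftrightarrow> P = {[]}"
proof
  assume 0: "maxlen P = 0"
  obtain p where "p \<in> P" by (rule maximal_prefix_code_comparable[OF assms(2)])
  moreover have "q = []" if "q \<in> P" for q using length_le_maxlen[OF assms(1) that] 0 by simp
  ultimately show "P = {[]}" by blast
qed (simp add: maxlen_def)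

lemma maximal_prefix_code_Nil:
  assumes "maximal_prefix_code P" "[] \<in> P"
  shows "maxlen P = 0"
proof -
  have "q = []" if "q \<in> P" for q
    using assms that Nil_prefix[of q] unfolding maximal_prefix_code_def prefix_code_def by metis
  then have "P = {[]}" using assms(2) by blast
  then show ?thesis by (simp add: maxlen_def)
qed

text \<open>If one code is \<open>{[]}\<close>, the bijection makes the other a singleton. This
  isolates the case in which the circuits have no inputs.\<close>

lemma represents_F_maxlen_0:
  assumes "represents_F P Q f"
  shows "maxlen P = 0 \<longleftrightarrow> maxlen Q = 0"
proof -
  have bij: "bij_betw f P Q" and P: "finite P" "maximal_prefix_code P"
    and Q: "finite Q" "maximal_prefix_code Q"
    using assms by (auto simp: represents_F_def)
  show ?thesis
  proof
    assume "maxlen P = 0"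
    then have "P = {[]}" using maxlen_0_iff P by blast
    then have "Q = {f []}" using bij by (simp add: bij_betw_def)
    then show "maxlen Q = 0" using Q maximal_prefix_code_singleton maxlen_0_iff by metis
  next
    assume "maxlen Q = 0"
    then have "Q = {[]}" using maxlen_0_iff Q by blast
    then have "is_singleton P" using bij by (metis bij_betw_same_card is_singleton_altdef is_singletonI)
    then obtain p where "P = {p}" by (auto simp: is_singleton_def)
    then show "maxlen P = 0" using P maximal_prefix_code_singleton maxlen_0_iff by metis
  qed
qed

lemma padded_pad:
  assumes "finite P" "p \<in> P"
  shows "padded P Q f (pad (maxlen P) p) = pad (maxlen Q) (f p)"
proof -
  have "(THE p'. p' \<in> P \<and> pad (maxlen P) p = pad (maxlen P) p') = p"
    using assms pad_inj length_le_maxlen by (intro the_equality) metis+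
  then show ?thesis using assms(2) by (auto simp: padded_def)
qed

text \<open>The word \<open>u10\<^sup>j\<close>, cut off at length \<open>m\<close>, where \<open>u\<close> consists of the first \<open>i\<close> trits of \<open>xs\<close>.\<close>

definition probe :: "nat \<Rightarrow> nat \<Rightarrow> nat \<Rightarrow> trit list \<Rightarrow> trit list" where
  "probe m i j xs = map (\<lambda>l. if l < i then xs ! l else if l = i then Some True
     else if l \<le> i + j then Some False else None) [0..<m]"

lemma nth_probe:
  "l < m \<Longrightarrow> probe m i j xs ! l = (if l < i then xs ! l else if l = i then Some True
     else if l \<le> i + j then Some False else None)"
  by (simp add: probe_def)

locale F_element =
  fixes P Q :: "word set" and f :: "word \<Rightarrow> word" and m n :: nat
  assumes rep: "represents_F P Q f" and m: "m = maxlen P" and n: "n = maxlen Q" and n_pos: "0 < n"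
begin

lemma facts:
  "finite P" "maximal_prefix_code P" "prefix_code P" "finite Q" "maximal_prefix_code Q" "prefix_code Q"
  "bij_betw f P Q" "x \<in> P \<Longrightarrow> y \<in> P \<Longrightarrow> dict_le x y \<Longrightarrow> dict_le (f x) (f y)"
  using rep by (auto simp: represents_F_def maximal_prefix_code_def)

lemma f_in: "x \<in> P \<Longrightarrow> f x \<in> Q"
  using facts(7) by (auto simp: bij_betw_def)

lemma f_inj: "x \<in> P \<Longrightarrow> y \<in> P \<Longrightarrow> f x = f y \<Longrightarrow> x = y"
  using facts(7) by (auto simp: bij_betw_def dest: inj_onD)

lemma len: "x \<in> P \<Longrightarrow> length x \<le> m" "y \<in> Q \<Longrightarrow> length y \<le> n"
  using length_le_maxlen facts m n by auto

lemma Q_not_Nil: "y \<in> Q \<Longrightarrow> y \<noteq> []"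
  using maximal_prefix_code_Nil[OF facts(5)] n n_pos by auto

lemma padded_value: "x \<in> P \<Longrightarrow> padded P Q f (pad m x) = pad n (f x)"
  using padded_pad facts(1) m n by simp

text \<open>As \<open>n\<close> is positive, no word of \<open>Q\<close> is empty; hence one trit
  tells a value of \<open>f\<close> from bottom.\<close>

lemma padded_first:
  "x \<in> P \<Longrightarrow> padded P Q f (pad m x) ! 0 \<noteq> None"
  "(\<And>x. x \<in> P \<Longrightarrow> v \<noteq> pad m x) \<Longrightarrow> padded P Q f v ! 0 = None"
  using padded_value Q_not_Nil[OF f_in] n_pos n m by (auto simp: nth_pad padded_def)

lemma length_padded: "length (padded P Q f v) = n"
proof (cases "\<exists>x\<in>P. v = pad m x")
  case True
  then show ?thesis using padded_value length_pad len(2)[OF f_in] by auto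
next
  case False
  then show ?thesis using n m by (auto simp: padded_def)
qed

text \<open>If letter \<open>i\<close> of \<open>x\<close> is 0, then \<open>x\<close> comes before
  \<open>p\<close>. If it is 1, the words agree up to \<open>i\<close> and \<open>p\<close>
  continues with zeros only, so \<open>p\<close> is \<open>x\<close> or comes before it. The images
  are ordered in the same way, and distinct words of a prefix code differ at a position before any
  padding, so comparing the padded images decides.\<close>

lemma probe_hit:
  assumes x: "x \<in> P" and i: "i < m" and p: "p \<in> P" and eq: "probe m i j (pad m x) = pad m p"
  shows "i < length x \<and>
    (cmp_trits (pad n (f p)) (pad n (f x)) \<noteq> Some False) = x ! i"
proof -
  have nth: "(if l < i then pad m x ! l else if l = i then Some True
     else if l \<le> i + j then Some False else None) = pad m p ! l" if "l < m" for l
    using nth_probe[OF that] eq by metis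
  have ip: "i < length p" and pi: "p ! i"
    using nth[OF i] i by (auto simp: nth_pad split: if_splits)
  \<comment> \<open>Below \<open>i\<close> the probe consists of letters of \<open>p\<close>, so the
    padding of \<open>x\<close> cannot have begun there.\<close>
  have before: "l < length x \<and> x ! l = p ! l" if "l < i" for l
    using nth[of l] that i ip by (auto simp: nth_pad split: if_splits)
  have after: "\<not> p ! l" if "i < l" "l < length p" for l
    using nth[of l] that len(1)[OF p] by (auto simp: nth_pad split: if_splits)
  have ix: "i < length x"
  proof (rule ccontr)
    assume "\<not> i < length x"
    then have "prefix x p"
      using before ip by (intro prefixI[of p x "drop (length x) p"] nth_equalityI) (auto simp: nth_append)
    then have "x = p" using x p facts(3) by (auto simp: prefix_code_def)
    then show False using ip \<open>\<not> i < length x\<close> by simp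
  qed
  have eq: "take i x = take i p" using before ip ix by (intro nth_equalityI) auto
  obtain u v w where split: "x = u @ x ! i # v" "p = u @ True # w"
    using id_take_nth_drop[OF ix] id_take_nth_drop[OF ip] pi unfolding eq by simp
  show ?thesis
  proof (cases "x ! i")
    case False
    then have x_eq: "x = u @ False # v" using split(1) by simp
    then have "dict_le x p" "x \<noteq> p" using split(2) unfolding dict_le_def by auto
    then have "dict_le (f x) (f p)" "f x \<noteq> f p" using facts(8) f_inj x p by blast+
    then obtain q v w where "f x = q @ False # v" "f p = q @ True # w"
      by (rule dict_le_split[OF facts(6) f_in[OF x] f_in[OF p]])
    then show ?thesis using cmp_trits_pad[of "f p" q True w "f x" v n] False ix by simp
  next
    case True
    show ?thesis
    proof (cases "x = p")
      case True
      then show ?thesis using \<open>x ! i\<close> ix cmp_trits_None[of "pad n (f p)" "pad n (f p)"] by simp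
    next
      case False
      then have "p \<parallel> x" using x p facts(3) by (intro parallelI) (auto simp: prefix_code_def)
      from parallel_decomp[OF this] obtain q b v c w
        where bc: "b \<noteq> c" "p = q @ b # v" "x = q @ c # w"
        by (elim exE conjE) (rule that; assumption)
      \<comment> \<open>The first difference lies behind \<open>i\<close>, where \<open>p\<close>
        has only zeros.\<close>
      have "\<not> b"
      proof
        assume b: "b"
        have "p ! length q = b" "x ! length q = c" "length q < length p" using bc by auto
        then show False using b bc(1) after[of "length q"] before[of "length q"] True
          by (metis linorder_neqE_nat)
      qed
      then have "dict_le p x" using bc unfolding dict_le_def by auto
      then have "dict_le (f p) (f x)" "f p \<noteq> f x" using facts(8) f_inj x p False by blast+
      then obtain q v w where "f p = q @ False # v" "f x = q @ True # w"
        by (rule dict_le_split[OF facts(6) f_in[OF p] f_in[OF x]])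
      then show ?thesis using cmp_trits_pad[of "f p" q False v "f x" w n] True ix by simp
    qed
  qed
qed

text \<open>Some code word is comparable with \<open>u10^m\<close>. That word is too long to be a
  prefix of a code word, so the code word is a prefix of it, and not one of \<open>u\<close>, as it
  would then be a proper prefix of \<open>x\<close>. Hence it is \<open>u10^j\<close>; its length
  \<open>i + 1 + j\<close> is at most \<open>m\<close>, so \<open>j < m\<close> suffices.\<close>

lemma probe_exists:
  assumes x: "x \<in> P" and i: "i < length x"
  shows "\<exists>j<m. \<exists>p\<in>P. probe m i j (pad m x) = pad m p"
proof -
  let ?u = "take i x"
  obtain p where p: "p \<in> P" "prefix p (?u @ True # replicate m False) \<or> prefix (?u @ True # replicate m False) p"
    using maximal_prefix_code_comparable[OF facts(2)] by metis
  have "\<not> prefix (?u @ True # replicate m False) p"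
    using len(1)[OF p(1)] by (auto dest!: prefix_length_le)
  then have "prefix p (?u @ True # replicate m False)" using p(2) by blast
  moreover have "\<not> prefix p ?u"
  proof
    assume pu: "prefix p ?u"
    then have "prefix p x" using take_is_prefix prefix_order.trans by blast
    then have "p = x" using x p facts(3) by (auto simp: prefix_code_def)
    then show False using i prefix_length_le[OF pu] by simp
  qed
  ultimately obtain w where w: "p = ?u @ w" "prefix w (True # replicate m False)" "w \<noteq> []"
    by (auto simp: prefix_append)
  then obtain v where v: "w = True # v" "prefix v (replicate m False)"
    by (cases w) auto
  then have "v = replicate (length v) False"
    by (metis prefixE append_eq_conv_conj length_replicate take_replicate min.absorb1 prefix_length_le)
  then obtain j where pj: "p = ?u @ True # replicate j False" using v w by metis
  have j: "i + j < m" using len(1)[OF p(1)] pj i by simp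
  have "probe m i j (pad m x) = pad m p"
  proof (rule nth_equalityI)
    show "length (probe m i j (pad m x)) = length (pad m p)"
      using len(1)[OF p(1)] by (simp add: probe_def length_pad)
    fix l assume "l < length (probe m i j (pad m x))"
    then have "l < m" by (simp add: probe_def)
    then show "probe m i j (pad m x) ! l = pad m p ! l"
      using i pj by (auto simp: probe_def nth_pad nth_append nth_Cons split: nat.split)
  qed
  then show ?thesis using p(1) j by (intro exI[of _ j]) auto
qed

text \<open>Every probe in the code yields the same letter, so it is right to keep the first result.
  If \<open>x\<close> ends before \<open>i\<close>, the result is bottom, which is the
  padding.\<close>

lemma search:
  assumes x: "x \<in> P" and i: "i < m"
    and r: "\<And>j. j < m \<Longrightarrow> r j = comb_trit (if j = 0 then None else r (j - 1))
      (padded P Q f (probe m i j (pad m x)) ! 0)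
      (cmp_trits (padded P Q f (probe m i j (pad m x))) (pad n (f x)))"
  shows "r (m - 1) = pad m x ! i"
proof -
  let ?hit = "\<lambda>j. \<exists>p\<in>P. probe m i j (pad m x) = pad m p"
  have step: "comb_trit None (padded P Q f (probe m i j (pad m x)) ! 0)
      (cmp_trits (padded P Q f (probe m i j (pad m x))) (pad n (f x))) =
      (if ?hit j then pad m x ! i else None)" for j
  proof (cases "?hit j")
    case True
    then obtain p where p: "p \<in> P" and eq: "probe m i j (pad m x) = pad m p" by blast
    show ?thesis
      using probe_hit[OF x i p eq] padded_first(1)[OF p] padded_value[OF p] True i
      by (auto simp: comb_trit_def eq nth_pad)
  next
    case False
    then show ?thesis using padded_first(2) by (auto simp: comb_trit_def)
  qed
  have "r j = (if \<exists>j'\<le>j. ?hit j' then pad m x ! i else None)" if "j < m" for j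
    using that
  proof (induction j)
    case 0
    then show ?case using r[of 0] step[of 0] by simp
  next
    case (Suc j)
    then have IH: "r j = (if \<exists>j'\<le>j. ?hit j' then pad m x ! i else None)" by simp
    show ?case
    proof (cases "r j = None")
      case True
      then have "r (Suc j) = (if ?hit (Suc j) then pad m x ! i else None)"
        using r[OF Suc.prems] step[of "Suc j"] by simp
      then show ?thesis using IH True by (auto simp: le_Suc_eq split: if_splits)
    next
      case False
      then have "r (Suc j) = r j"
        using r[OF Suc.prems] by (simp add: comb_trit_def)
      then show ?thesis using IH False by (auto simp: le_Suc_eq split: if_splits)
    qed
  qed
  from this[of "m - 1"]
  have last: "r (m - 1) = (if \<exists>j'\<le>m - 1. ?hit j' then pad m x ! i else None)" using i by simp
  show ?thesis
  proof (cases "i < length x")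
    case True
    then obtain j where "j < m" "?hit j" using probe_exists[OF x] by blast
    moreover from this have "j \<le> m - 1" by simp
    ultimately show ?thesis using last by auto
  next
    case False
    then show ?thesis using last i by (auto simp: nth_pad)
  qed
qed

text \<open>A wrong candidate \<open>xs\<close> is recognised by evaluating \<open>f\<close> at it.\<close>

lemma masked_candidate:
  assumes len: "length y = n" "length xs = m" and xs: "\<And>x. x \<in> P \<Longrightarrow> y = pad n (f x) \<Longrightarrow> xs = pad m x"
    and l: "l < m"
  shows "mask_trit (xs ! l) (padded P Q f xs ! 0) (cmp_trits (padded P Q f xs) y) =
    padded Q P (inv_into P f) y ! l"
proof (cases "\<exists>q\<in>Q. y = pad n q")
  case True
  then obtain q where q: "q \<in> Q" "y = pad n q" by blast
  define x where "x = inv_into P f q"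
  have x: "x \<in> P" "f x = q"
    using bij_betwE[OF bij_betw_inv_into[OF facts(7)]] bij_betw_inv_into_right[OF facts(7)] q(1)
    unfolding x_def by blast+
  have "padded Q P (inv_into P f) y = pad m x"
    using padded_pad[OF facts(4) q(1), of P "inv_into P f"] q m n by (simp add: x_def)
  moreover have "xs = pad m x" by (rule xs[OF x(1)]) (simp only: x(2) q(2))
  moreover have "padded P Q f (pad m x) = y" using padded_value[OF x(1)] x(2) q(2) by metis
  ultimately show ?thesis
    using padded_first(1)[OF x(1)] cmp_trits_None[OF refl, of y] by (simp add: mask_trit_def)
next
  case False
  then have "padded Q P (inv_into P f) y ! l = None"
    using l m n by (auto simp: padded_def)
  moreover have "padded P Q f xs ! 0 = None \<or> cmp_trits (padded P Q f xs) y \<noteq> None"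
  proof (rule ccontr)
    assume "\<not> ?thesis"
    then have first: "padded P Q f xs ! 0 \<noteq> None" and "cmp_trits (padded P Q f xs) y = None"
      by simp_all
    then have y: "padded P Q f xs = y"
      using cmp_trits_None[of "padded P Q f xs" y] length_padded[of xs] len(1) by simp
    obtain p where p: "p \<in> P" "xs = pad m p" using padded_first(2)[of xs] first by blast
    have "y = pad n (f p)" using y padded_value[OF p(1)] p(2) by simp
    then show False using f_in[OF p(1)] False by blast
  qed
  ultimately show ?thesis by (auto simp: mask_trit_def)
qed

end

section \<open>The inverse circuit\<close>

text \<open>One gadget serves all purposes: its first input selects the operation, and the last three
  outputs provide constants.\<close>

definition gadget_fun :: "trit list \<Rightarrow> trit list" where
  "gadget_fun x =
     [case x ! 0 of
        None \<Rightarrow> cmp_trit (x ! 1) (x ! 2) (x ! 3)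
      | Some b \<Rightarrow> (if b then mask_trit else comb_trit) (x ! 1) (x ! 2) (x ! 3),
      Some False, Some True, None]"

text \<open>Since every output is one of the new wires, output \<open>k\<close> of a copy placed at
  \<open>W\<close> is wire \<open>W + a k\<close>, whatever wires feed the copy.\<close>

locale gadget =
  fixes G :: "gate list" and hops :: "operation list" and a :: "nat \<Rightarrow> nat"
  assumes wf_gates: "wf_gates G" and swap_free_hops: "swap_free hops" and wf_hops: "wf_ops G 4 hops []"
    and a_less: "k < 4 \<Longrightarrow> a k < new_wires G hops"
    and hops_value: "length x = 4 \<Longrightarrow> k < 4 \<Longrightarrow> exec G hops x ! (4 + a k) = gadget_fun x ! k"

lemma gadget_exists:
  assumes "wf_gates G" "universal G"
  shows "\<exists>hops a. gadget G hops a"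
proof -
  have "\<forall>x. length x = 4 \<longrightarrow> length (gadget_fun x) = 4" by (simp add: gadget_fun_def)
  then obtain c where c: "has_io_function G c 4 4 gadget_fun"
    using assms(2) unfolding universal_def by fastforce
  define hops where "hops = straighten (circ_ops c)"
  define out where "out k = origin (circ_ops c) (circ_outs c ! k)" for k
  have wf: "wf_ops G 4 (circ_ops c) []" "\<forall>p\<in>set (circ_outs c). p < 4 + new_wires G (circ_ops c)"
    using c unfolding has_io_function_def wf_circuit_def by (metis wf_ops_outs)+
  have outs: "length (circ_outs c) = 4" using c by (simp add: has_io_function_def)
  have wf': "wf_ops G 4 hops []" and new: "new_wires G hops = new_wires G (circ_ops c)"
    using straighten_correct[OF assms(1), of "replicate 4 None"] wf(1) by (simp_all add: hops_def)
  have out: "out k < 4 + new_wires G hops \<and> exec G hops x ! out k = gadget_fun x ! k"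
    if "length x = 4" "k < 4" for x k
  proof -
    have p: "circ_outs c ! k < 4 + new_wires G (circ_ops c)" using wf(2) outs that by simp
    have "eval_circuit G c x = gadget_fun x" using c that by (simp add: has_io_function_def)
    then have "map ((!) (exec G (circ_ops c) x)) (circ_outs c) = gadget_fun x"
      by (simp add: eval_circuit_def)
    then have "gadget_fun x ! k = exec G (circ_ops c) x ! (circ_outs c ! k)"
      using outs that by (metis nth_map)
    then show ?thesis
      using straighten_correct[OF assms(1), of x] wf(1) p that new by (simp add: hops_def out_def)
  qed
  \<comment> \<open>An output linked directly to an input would repeat that input on all arguments.
    Output 0 does not: on the first test vector it is \<open>Some False\<close>, which is not an
    entry of the vector. The other outputs are constants, refuted by the other two vectors.\<close>
  have old: "\<not> out k < 4" if "k < 4" for k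
  proof
    assume "out k < 4"
    then have *: "x ! out k = gadget_fun x ! k" if "length x = 4" for x
      using out[OF that \<open>k < 4\<close>] exec_nth_old[of hops "out k" x G] swap_free_straighten that
      by (simp add: hops_def)
    have "out k \<in> {0, 1, 2, 3}" "k \<in> {0, 1, 2, 3}" using \<open>out k < 4\<close> \<open>k < 4\<close> by auto
    then show False
      using *[of "[None, None, Some True, None]"] *[of "[Some True, Some True, Some True, Some True]"]
        *[of "[None, None, None, None]"]
      by (auto simp: gadget_fun_def cmp_trit_def)
  qed
  have "gadget G hops (\<lambda>k. out k - 4)"
  proof
    show "out k - 4 < new_wires G hops" if "k < 4" for k
    proof -
      have "out k < 4 + new_wires G hops" using out[of "replicate 4 None" k] that by simp
      then show ?thesis using old[OF that] by arith
    qed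
    show "exec G hops x ! (4 + (out k - 4)) = gadget_fun x ! k" if "length x = 4" "k < 4" for x k
      using out[OF that] old[OF that(2)] by simp
  qed (use assms wf' swap_free_straighten in \<open>simp_all add: hops_def\<close>)
  then show ?thesis by blast
qed

section \<open>Wire numbers of the inverse circuit\<close>

context gadget
begin

text \<open>Stage \<open>q = i m + j\<close> of the new circuit evaluates \<open>f\<close> at \<open>u10\<^sup>j\<close> for \<open>u\<close> of length \<open>i\<close>. It
  starts when \<open>base n D q\<close> wires are present and consists of a copy with \<open>D\<close> new wires, \<open>n\<close> gadgets
  for the comparison and one that combines the result with that for \<open>j - 1\<close>. So letter \<open>l\<close> of the
  candidate is found on the last wire of this kind with \<open>i = l\<close>, and the additional stage with \<open>i = m\<close> and
  \<open>j = 0\<close> evaluates \<open>f\<close> at the candidate.\<close>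

definition base :: "nat \<Rightarrow> nat \<Rightarrow> nat \<Rightarrow> nat" where
  "base n D q = n + new_wires G hops + q * (D + Suc n * new_wires G hops)"

text \<open>The first gadget sits directly behind the \<open>n\<close> inputs, so the wires
  \<open>n + a 1\<close>, \<open>n + a 2\<close>, \<open>n + a 3\<close> carry 0, 1 and bottom. The
  comparison starts with bottom, which stands for equality.\<close>

definition acc_wire :: "nat \<Rightarrow> nat \<Rightarrow> nat \<Rightarrow> nat \<Rightarrow> nat" where
  "acc_wire n D q l = (if l = 0 then n + a 3 else base n D q + D + (l - 1) * new_wires G hops + a 0)"

definition comb_wire :: "nat \<Rightarrow> nat \<Rightarrow> nat \<Rightarrow> nat" where
  "comb_wire n D q = base n D q + D + n * new_wires G hops + a 0"

definition prev_wire :: "nat \<Rightarrow> nat \<Rightarrow> nat \<Rightarrow> nat \<Rightarrow> nat \<Rightarrow> nat" where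
  "prev_wire m n D i j = (if j = 0 then n + a 3 else comb_wire n D (i * m + j - 1))"

text \<open>The counterpart of \<open>probe\<close> on wires: letters already found, the letter 1,
  the zeros and the padding.\<close>

definition src_wire :: "nat \<Rightarrow> nat \<Rightarrow> nat \<Rightarrow> nat \<Rightarrow> nat \<Rightarrow> nat \<Rightarrow> nat" where
  "src_wire m n D i j l =
     (if l < i then comb_wire n D (l * m + (m - 1))
      else if l = i then n + a 2 else if l < Suc (i + j) then n + a 1 else n + a 3)"

definition copy_wire :: "nat \<Rightarrow> nat \<Rightarrow> nat \<Rightarrow> nat \<Rightarrow> nat \<Rightarrow> nat \<Rightarrow> nat" where
  "copy_wire m n D i j p =
     (if p < m then src_wire m n D i j p else base n D (i * m + j) + (p - m))"

definition gad_wire :: "nat \<Rightarrow> nat \<Rightarrow> nat \<Rightarrow> nat \<Rightarrow> nat \<Rightarrow> nat \<Rightarrow> nat" where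
  "gad_wire W b0 b1 b2 b3 p = (if p < 4 then [b0, b1, b2, b3] ! p else W + (p - 4))"

definition gad :: "nat \<Rightarrow> nat \<Rightarrow> nat \<Rightarrow> nat \<Rightarrow> nat \<Rightarrow> operation list" where
  "gad W b0 b1 b2 b3 = map (rename_op (gad_wire W b0 b1 b2 b3)) hops"

lemma swap_free_gad [simp]: "swap_free (gad W b0 b1 b2 b3)"
  using swap_free_hops swap_free_rename unfolding gad_def by blast

lemma new_wires_gad [simp]: "new_wires G (gad W b0 b1 b2 b3) = new_wires G hops"
  by (simp add: gad_def)

lemma placed_gad:
  "b0 < W \<Longrightarrow> b1 < W \<Longrightarrow> b2 < W \<Longrightarrow> b3 < W \<Longrightarrow> placed 4 W (gad_wire W b0 b1 b2 b3)"
  by (auto simp: placed_def gad_wire_def less_Suc_eq numeral_eq_Suc)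

lemma wf_gad:
  "b0 < W \<Longrightarrow> b1 < W \<Longrightarrow> b2 < W \<Longrightarrow> b3 < W \<Longrightarrow> wf_ops G W (gad W b0 b1 b2 b3) []"
  unfolding gad_def by (rule wf_ops_rename[OF placed_gad swap_free_hops wf_hops])

lemma gad_value:
  assumes "V = exec G (A @ gad W b0 b1 b2 b3 @ B) x" "wf_ops G (length x) A []"
    "W = length x + new_wires G A" "swap_free B" "b0 < W" "b1 < W" "b2 < W" "b3 < W" "k < 4"
  shows "V ! (W + a k) = gadget_fun [V ! b0, V ! b1, V ! b2, V ! b3] ! k"
proof -
  let ?h = "gad_wire W b0 b1 b2 b3"
  have "V ! ?h (4 + a k) = exec G hops (map (\<lambda>p. V ! ?h p) [0..<4]) ! (4 + a k)"
    using assms a_less[OF assms(9)]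
    by (intro placed_copy[OF wf_gates placed_gad swap_free_hops wf_hops assms(2) assms(3) assms(4)])
      (auto simp: gad_def)
  also have "map (\<lambda>p. V ! ?h p) [0..<4] = [V ! b0, V ! b1, V ! b2, V ! b3]"
    by (simp add: gad_wire_def upt_rec numeral_eq_Suc)
  finally show ?thesis using hops_value[of "[V ! b0, V ! b1, V ! b2, V ! b3]" k] assms(9)
    by (simp add: gad_wire_def)
qed

lemma base_Suc: "base n D (Suc q) = base n D q + (D + Suc n * new_wires G hops)"
  by (simp add: base_def)

lemma base_mono: "q \<le> q' \<Longrightarrow> base n D q \<le> base n D q'"
  by (simp add: base_def)

lemma const_less: "k < 4 \<Longrightarrow> n + a k < base n D q"
  using a_less[of k] by (simp add: base_def)

lemma input_less: "l < n \<Longrightarrow> l < base n D q"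
  by (simp add: base_def)

lemma comb_less: "q < q' \<Longrightarrow> comb_wire n D q < base n D q'"
  using base_mono[of "Suc q" q' n D] a_less[of 0] unfolding base_Suc by (simp add: comb_wire_def)

lemma acc_less: "acc_wire n D q l < base n D q + D + l * new_wires G hops"
proof (cases l)
  case 0
  then show ?thesis using const_less[of 3 n D q] by (simp add: acc_wire_def)
next
  case (Suc l')
  then show ?thesis using a_less[of 0] by (simp add: acc_wire_def)
qed

end

section \<open>Construction and well-formedness of the inverse circuit\<close>

locale inverter = gadget +
  fixes ops :: "operation list" and out :: "nat \<Rightarrow> nat" and m n :: nat
  assumes m_pos: "0 < m" and n_pos: "0 < n"
    and swap_free_ops: "swap_free ops" and wf_ops: "wf_ops G m ops []"
    and out_less: "l < n \<Longrightarrow> out l < m + new_wires G ops"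
begin

abbreviation "H \<equiv> new_wires G hops"
abbreviation "D \<equiv> new_wires G ops"

text \<open>The first wire is the selector: bottom chooses \<open>cmp_trit\<close>; below,
  \<open>n + a 1\<close> chooses \<open>comb_trit\<close> and \<open>n + a 2\<close> chooses
  \<open>mask_trit\<close>. Step \<open>l\<close> treats position \<open>n - 1 - l\<close>, since an
  earlier difference must override a later one.\<close>

definition cmp_gad :: "nat \<Rightarrow> nat \<Rightarrow> nat \<Rightarrow> operation list" where
  "cmp_gad i j l = gad (base n D (i * m + j) + D + l * H) (n + a 3)
     (copy_wire m n D i j (out (n - 1 - l))) (n - 1 - l) (acc_wire n D (i * m + j) l)"

definition comb_gad :: "nat \<Rightarrow> nat \<Rightarrow> operation list" where
  "comb_gad i j = gad (base n D (i * m + j) + D + n * H) (n + a 1)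
     (prev_wire m n D i j) (copy_wire m n D i j (out 0)) (acc_wire n D (i * m + j) n)"

definition stage :: "nat \<Rightarrow> nat \<Rightarrow> operation list" where
  "stage i j = map (rename_op (copy_wire m n D i j)) ops @
     concat (map (cmp_gad i j) [0..<n]) @ comb_gad i j"

definition mask_gad :: "nat \<Rightarrow> operation list" where
  "mask_gad l = gad (base n D (m * m + 1) + l * H) (n + a 2)
     (comb_wire n D (l * m + (m - 1))) (copy_wire m n D m 0 (out 0)) (acc_wire n D (m * m) n)"

abbreviation "row i \<equiv> concat (map (stage i) [0..<m])"

definition inv_ops :: "operation list" where
  "inv_ops = gad n 0 0 0 0 @ concat (map row [0..<m]) @ stage m 0 @ concat (map mask_gad [0..<m])"

definition inv_outs :: "nat list" where
  "inv_outs = map (\<lambda>l. base n D (m * m + 1) + l * H + a 0) [0..<m]"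

definition valid :: "nat \<Rightarrow> nat \<Rightarrow> bool" where
  "valid i j \<longleftrightarrow> i < m \<and> j < m \<or> i = m \<and> j = 0"

text \<open>Row \<open>l\<close> is complete before row \<open>i\<close> begins, so the letters that
  a probe uses are on wires that exist already.\<close>

lemma last_in_row_less: "l < i \<Longrightarrow> l * m + (m - 1) < i * m + j"
proof -
  assume "l < i"
  then have "Suc l * m \<le> i * m" by (intro mult_le_mono1) simp
  then show ?thesis using m_pos by simp
qed

lemma src_less: "src_wire m n D i j l < base n D (i * m + j)"
  using const_less[of _ n D] comb_less[OF last_in_row_less] by (auto simp: src_wire_def)

lemma placed_copy_wire: "placed m (base n D (i * m + j)) (copy_wire m n D i j)"
  by (simp add: placed_def copy_wire_def src_less)

lemma copy_less: "p < m + D \<Longrightarrow> copy_wire m n D i j p < base n D (i * m + j) + D"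
  by (rule placed_less[OF placed_copy_wire])

lemma prev_less: "prev_wire m n D i j < base n D (i * m + j)"
  using const_less[of 3 n D] comb_less[of "i * m + j - 1" "i * m + j" n D] by (auto simp: prev_wire_def)

lemma n_minus_less: "n - 1 - l < base n D q + r"
  using input_less[of "n - 1 - l" n D q] n_pos by simp

lemma swap_free_stage: "swap_free (stage i j)"
  using swap_free_rename swap_free_ops unfolding stage_def cmp_gad_def comb_gad_def
  by (auto simp del: swap_free_rename simp: swap_free_gad)

lemma swap_free_mask: "swap_free (mask_gad l)"
  by (simp add: mask_gad_def)

lemma wf_copy: "wf_ops G (base n D (i * m + j)) (map (rename_op (copy_wire m n D i j)) ops) []"
  by (rule wf_ops_rename[OF placed_copy_wire swap_free_ops wf_ops])

lemma cmp_args_less: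
  "n + a 3 < base n D (i * m + j) + D + l * H"
  "l < n \<Longrightarrow> copy_wire m n D i j (out (n - 1 - l)) < base n D (i * m + j) + D + l * H"
  "n - 1 - l < base n D (i * m + j) + D + l * H"
  "acc_wire n D (i * m + j) l < base n D (i * m + j) + D + l * H"
  using const_less[of 3 n D "i * m + j"] copy_less[OF out_less[of "n - 1 - l"], of i j]
    n_minus_less[of l "i * m + j"] acc_less
  by (auto simp: add.assoc intro: trans_less_add1)

lemma wf_cmps:
  "wf_ops G (base n D (i * m + j) + D) (concat (map (cmp_gad i j) [0..<l])) [] \<and>
    new_wires G (concat (map (cmp_gad i j) [0..<l])) = l * H" if "l \<le> n"
  using that cmp_args_less by (intro wf_ops_concat) (auto simp: cmp_gad_def intro!: wf_gad)

lemma comb_args_less: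
  "n + a 1 < base n D (i * m + j) + D + n * H"
  "prev_wire m n D i j < base n D (i * m + j) + D + n * H"
  "copy_wire m n D i j (out 0) < base n D (i * m + j) + D + n * H"
  "acc_wire n D (i * m + j) n < base n D (i * m + j) + D + n * H"
  using const_less[of 1 n D "i * m + j"] copy_less[OF out_less[of 0], of i j] n_pos
    prev_less[of i j] acc_less
  by (auto simp: add.assoc intro: trans_less_add1)

lemma wf_stage:
  "wf_ops G (base n D (i * m + j)) (stage i j) [] \<and> new_wires G (stage i j) = D + Suc n * H"
  using wf_copy[of i j] wf_cmps[of n i j] comb_args_less[of i j]
  by (auto simp: stage_def wf_ops_append comb_gad_def intro!: wf_gad)

lemma base_add: "base n D (q + l) = base n D q + l * (D + Suc n * H)"
  by (simp add: base_def distrib_right)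

lemma wf_stages:
  "wf_ops G (base n D (i * m)) (concat (map (stage i) [0..<j])) [] \<and>
    new_wires G (concat (map (stage i) [0..<j])) = j * (D + Suc n * H)"
  using wf_stage[of i] by (intro wf_ops_concat) (simp add: base_add)

lemma wf_rows:
  "wf_ops G (base n D 0) (concat (map row [0..<i])) [] \<and>
    new_wires G (concat (map row [0..<i])) = i * (m * (D + Suc n * H))"
proof (rule wf_ops_concat)
  fix l
  have "base n D 0 + l * (m * (D + Suc n * H)) = base n D (l * m)"
    using base_add[of 0 "l * m"] by (simp add: mult.assoc)
  then show "wf_ops G (base n D 0 + l * (m * (D + Suc n * H))) (row l) [] \<and>
      new_wires G (row l) = m * (D + Suc n * H)"
    using wf_stages[of l m] by simp
qed

lemma wf_first: "wf_ops G n (gad n 0 0 0 0) []"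
  using n_pos by (intro wf_gad)

text \<open>Together with \<open>after\<close> it cuts the circuit at a stage, in the shape that
  \<open>placed_copy\<close> and \<open>gad_value\<close> require.\<close>

definition before :: "nat \<Rightarrow> nat \<Rightarrow> operation list" where
  "before i j = gad n 0 0 0 0 @ concat (map row [0..<i]) @ concat (map (stage i) [0..<j])"

lemma wf_before: "wf_ops G n (before i j) []" and new_wires_before: "n + new_wires G (before i j) = base n D (i * m + j)"
proof -
  have 0: "n + H = base n D 0" by (simp add: base_def)
  have 1: "base n D 0 + i * (m * (D + Suc n * H)) = base n D (i * m)"
    using base_add[of 0 "i * m"] by (simp add: mult.assoc)
  show "wf_ops G n (before i j) []"
    using wf_first wf_rows[of i] wf_stages[of i j]
    by (simp add: before_def wf_ops_append 0 1 del: mult_Suc add_Suc_right)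
  show "n + new_wires G (before i j) = base n D (i * m + j)"
    using wf_rows[of i] wf_stages[of i j] 0 1 base_add[of "i * m" j]
    by (simp add: before_def del: mult_Suc)
qed

definition after :: "nat \<Rightarrow> nat \<Rightarrow> operation list" where
  "after i j = (if i < m then concat (map (stage i) [Suc j..<m]) @ concat (map row [Suc i..<m]) @ stage m 0 else []) @
     concat (map mask_gad [0..<m])"

lemma swap_free_after: "swap_free (after i j)"
  using swap_free_stage swap_free_mask by (auto simp: after_def)

lemma inv_ops_split: "valid i j \<Longrightarrow> inv_ops = before i j @ stage i j @ after i j"
proof (cases "i < m")
  case True
  assume "valid i j"
  then have "j < m" using True by (simp add: valid_def)
  then show ?thesis
    using concat_split[OF True, of row] concat_split[of j m "stage i"]
    by (simp add: inv_ops_def before_def after_def True)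
next
  case False
  assume "valid i j"
  then show ?thesis using False by (auto simp: valid_def inv_ops_def before_def after_def)
qed

lemma mask_args_less:
  assumes "l < m"
  shows "n + a 2 < base n D (m * m + 1) + l * H"
    "comb_wire n D (l * m + (m - 1)) < base n D (m * m + 1) + l * H"
    "copy_wire m n D m 0 (out 0) < base n D (m * m + 1) + l * H"
    "acc_wire n D (m * m) n < base n D (m * m + 1) + l * H"
proof -
  have 1: "base n D (m * m + 1) = base n D (m * m) + D + n * H + H" by (simp add: base_Suc)
  show "n + a 2 < base n D (m * m + 1) + l * H"
    using const_less[of 2 n D "m * m + 1"] by simp
  have "l * m + (m - 1) < m * m + 1" using last_in_row_less[OF assms, of 1] by simp
  then show "comb_wire n D (l * m + (m - 1)) < base n D (m * m + 1) + l * H"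
    using comb_less trans_less_add1 by blast
  show "copy_wire m n D m 0 (out 0) < base n D (m * m + 1) + l * H"
    "acc_wire n D (m * m) n < base n D (m * m + 1) + l * H"
    unfolding 1 using comb_args_less(3,4)[of m 0] by simp_all
qed

lemma wf_masks:
  assumes "l \<le> m"
  shows "wf_ops G (base n D (m * m + 1)) (concat (map mask_gad [0..<l])) [] \<and>
    new_wires G (concat (map mask_gad [0..<l])) = l * H"
  using mask_args_less assms by (intro wf_ops_concat) (auto simp: mask_gad_def intro!: wf_gad)

lemma wf_to_masks:
  "wf_ops G n (before m 0 @ stage m 0) [] \<and>
    n + new_wires G (before m 0 @ stage m 0) = base n D (m * m + 1)"
  using wf_before[of m 0] new_wires_before[of m 0] wf_stage[of m 0]
  by (simp add: wf_ops_append base_Suc add.assoc[symmetric])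

lemma wf_inv_ops: "wf_ops G n inv_ops inv_outs"
proof -
  have split: "inv_ops = (before m 0 @ stage m 0) @ concat (map mask_gad [0..<m])"
    by (simp add: inv_ops_def before_def)
  have "base n D (m * m + 1) + l * H + a 0 < base n D (m * m + 1) + m * H" if "l < m" for l
  proof -
    have "Suc l * H \<le> m * H" using that by (intro mult_le_mono1) simp
    then show ?thesis using a_less[of 0] by simp
  qed
  then show ?thesis
    using wf_to_masks wf_masks[OF order_refl] unfolding split
    by (subst wf_ops_outs) (auto simp: wf_ops_append inv_outs_def add.assoc[symmetric])
qed

end


section \<open>Values on the wires of the inverse circuit\<close>

context inverter
begin

lemma swap_free_inv_ops: "swap_free inv_ops"
  using swap_free_stage swap_free_mask by (auto simp: inv_ops_def)

context
  fixes y :: "trit list" and V :: "trit list"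
  assumes len_y: "length y = n" and V: "V = exec G inv_ops y"
begin

lemma V_input: "l < n \<Longrightarrow> V ! l = y ! l"
  unfolding V by (rule exec_nth_old[OF swap_free_inv_ops]) (simp add: len_y)

text \<open>The gadget is fed four times with input 0, which exists as \<open>n\<close> is positive.
  Its last three outputs do not depend on the arguments.\<close>

lemma V_const: "k < 4 \<Longrightarrow> V ! (n + a k) = gadget_fun [V ! 0, V ! 0, V ! 0, V ! 0] ! k"
  by (rule gad_value[where A = "[]" and B = "concat (map row [0..<m]) @ stage m 0 @ concat (map mask_gad [0..<m])" and x = y])
    (use swap_free_stage swap_free_mask n_pos in \<open>auto simp: V inv_ops_def len_y\<close>)

lemma V_consts: "V ! (n + a (Suc 0)) = Some False" "V ! (n + a 2) = Some True" "V ! (n + a 3) = None"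
  using V_const[of 1] V_const[of 2] V_const[of 3] by (simp_all add: gadget_fun_def eval_nat_numeral)

definition word_at :: "nat \<Rightarrow> nat \<Rightarrow> trit list" where
  "word_at i j = map (\<lambda>l. V ! src_wire m n D i j l) [0..<m]"

lemma V_copy:
  assumes "valid i j" "p < m + D"
  shows "V ! copy_wire m n D i j p = exec G ops (word_at i j) ! p"
proof -
  let ?h = "copy_wire m n D i j"
  have "V ! ?h p = exec G ops (map (\<lambda>p. V ! ?h p) [0..<m]) ! p"
  proof (rule placed_copy[OF wf_gates placed_copy_wire swap_free_ops wf_ops])
    show "wf_ops G (length y) (before i j) []" "base n D (i * m + j) = length y + new_wires G (before i j)"
      using wf_before new_wires_before[of i j] by (simp_all add: len_y)
    show "V = exec G (before i j @ map (rename_op ?h) ops @ concat (map (cmp_gad i j) [0..<n]) @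
        comb_gad i j @ after i j) y"
      unfolding V inv_ops_split[OF assms(1)] stage_def by simp
    show "swap_free (concat (map (cmp_gad i j) [0..<n]) @ comb_gad i j @ after i j)"
      using swap_free_after[of i j] by (auto simp: cmp_gad_def comb_gad_def)
  qed fact
  also have "map (\<lambda>p. V ! ?h p) [0..<m] = word_at i j"
    by (simp add: word_at_def copy_wire_def)
  finally show ?thesis .
qed

lemma V_cmp:
  assumes ij: "valid i j" and l: "l < n"
  shows "V ! acc_wire n D (i * m + j) (Suc l) =
    cmp_trit (V ! copy_wire m n D i j (out (n - 1 - l))) (V ! (n - 1 - l)) (V ! acc_wire n D (i * m + j) l)"
proof -
  let ?A = "before i j @ map (rename_op (copy_wire m n D i j)) ops @ concat (map (cmp_gad i j) [0..<l])"
  let ?B = "concat (map (cmp_gad i j) [Suc l..<n]) @ comb_gad i j @ after i j"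
  let ?W = "base n D (i * m + j) + D + l * H"
  have wf: "wf_ops G n ?A []" and W: "?W = n + new_wires G ?A"
    using wf_before[of i j] new_wires_before[of i j] wf_copy[of i j] wf_cmps[of l i j] l
    by (auto simp: wf_ops_append add.assoc[symmetric])
  have split: "V = exec G (?A @ cmp_gad i j l @ ?B) y"
    unfolding V inv_ops_split[OF ij] stage_def concat_split[OF l] by simp
  have "V ! (?W + a 0) = gadget_fun [V ! (n + a 3), V ! copy_wire m n D i j (out (n - 1 - l)),
      V ! (n - 1 - l), V ! acc_wire n D (i * m + j) l] ! 0"
  proof (rule gad_value[OF split[unfolded cmp_gad_def[of i j l]]])
    show "wf_ops G (length y) ?A []" "?W = length y + new_wires G ?A"
      using wf W by (simp_all only: len_y)
    show "swap_free ?B"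
      using swap_free_after[of i j] by (auto simp: cmp_gad_def comb_gad_def)
  qed (use cmp_args_less l in simp_all)
  then show ?thesis by (simp add: acc_wire_def gadget_fun_def V_consts)
qed

lemma V_comb:
  assumes ij: "valid i j"
  shows "V ! comb_wire n D (i * m + j) =
    comb_trit (V ! prev_wire m n D i j) (V ! copy_wire m n D i j (out 0)) (V ! acc_wire n D (i * m + j) n)"
proof -
  let ?A = "before i j @ map (rename_op (copy_wire m n D i j)) ops @ concat (map (cmp_gad i j) [0..<n])"
  let ?W = "base n D (i * m + j) + D + n * H"
  have wf: "wf_ops G n ?A []" and W: "?W = n + new_wires G ?A"
    using wf_before[of i j] new_wires_before[of i j] wf_copy[of i j] wf_cmps[of n i j]
    by (auto simp: wf_ops_append add.assoc[symmetric])
  have split: "V = exec G (?A @ comb_gad i j @ after i j) y"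
    unfolding V inv_ops_split[OF ij] stage_def by simp
  have "V ! (?W + a 0) = gadget_fun [V ! (n + a 1), V ! prev_wire m n D i j,
      V ! copy_wire m n D i j (out 0), V ! acc_wire n D (i * m + j) n] ! 0"
  proof (rule gad_value[OF split[unfolded comb_gad_def[of i j]]])
    show "wf_ops G (length y) ?A []" "?W = length y + new_wires G ?A"
      using wf W by (simp_all only: len_y)
  qed (use comb_args_less swap_free_after in simp_all)
  then show ?thesis by (simp add: comb_wire_def gadget_fun_def V_consts)
qed

lemma V_mask:
  assumes l: "l < m"
  shows "V ! (base n D (m * m + 1) + l * H + a 0) =
    mask_trit (V ! comb_wire n D (l * m + (m - 1))) (V ! copy_wire m n D m 0 (out 0))
      (V ! acc_wire n D (m * m) n)"
proof -
  let ?A = "(before m 0 @ stage m 0) @ concat (map mask_gad [0..<l])"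
  let ?B = "concat (map mask_gad [Suc l..<m])"
  let ?W = "base n D (m * m + 1) + l * H"
  have wf: "wf_ops G n ?A []" and W: "?W = n + new_wires G ?A"
    using wf_to_masks wf_masks[of l] l by (auto simp: wf_ops_append add.assoc[symmetric])
  have split: "V = exec G (?A @ mask_gad l @ ?B) y"
    unfolding V inv_ops_def concat_split[OF l, of mask_gad] before_def by simp
  have "V ! (?W + a 0) = gadget_fun [V ! (n + a 2), V ! comb_wire n D (l * m + (m - 1)),
      V ! copy_wire m n D m 0 (out 0), V ! acc_wire n D (m * m) n] ! 0"
  proof (rule gad_value[OF split[unfolded mask_gad_def[of l]]])
    show "wf_ops G (length y) ?A []" "?W = length y + new_wires G ?A"
      using wf W by (simp_all only: len_y)
    show "swap_free ?B" using swap_free_mask by auto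
  qed (use mask_args_less[OF l] in simp_all)
  then show ?thesis by (simp add: gadget_fun_def V_consts)
qed

context
  fixes F :: "trit list \<Rightarrow> trit list"
  assumes F: "\<And>xs l. length xs = m \<Longrightarrow> l < n \<Longrightarrow> exec G ops xs ! out l = F xs ! l"
    and len_F: "\<And>xs. length (F xs) = n"
begin

text \<open>Read off the final wires, so it is available before any of its letters is known to be
  right. There is no circularity, because a probe for letter \<open>i\<close> takes only the first
  \<open>i\<close> entries from it.\<close>

definition candidate :: "trit list" where
  "candidate = map (\<lambda>l. V ! comb_wire n D (l * m + (m - 1))) [0..<m]"

lemma word_at_probe: "word_at i j = probe m i j candidate"
  by (auto simp: word_at_def probe_def candidate_def src_wire_def V_consts)

lemma V_result: "valid i j \<Longrightarrow> l < n \<Longrightarrow> V ! copy_wire m n D i j (out l) = F (probe m i j candidate) ! l"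
  using V_copy[OF _ out_less] F[of "word_at i j"] by (simp add: word_at_probe probe_def)

lemma V_acc:
  assumes ij: "valid i j"
  shows "V ! acc_wire n D (i * m + j) n = cmp_trits (F (probe m i j candidate)) y"
proof -
  let ?z = "F (probe m i j candidate)"
  have "V ! acc_wire n D (i * m + j) l = cmp_trits (drop (n - l) ?z) (drop (n - l) y)" if "l \<le> n" for l
    using that
  proof (induction l)
    case 0
    then show ?case by (simp add: acc_wire_def V_consts len_F)
  next
    case (Suc l)
    let ?k = "n - 1 - l"
    have k: "?k < n" "n - Suc l = ?k" "Suc ?k = n - l" using Suc.prems by auto
    have drop: "drop ?k ?z = ?z ! ?k # drop (n - l) ?z" "drop ?k y = y ! ?k # drop (n - l) y"
      using Cons_nth_drop_Suc[of ?k ?z] Cons_nth_drop_Suc[of ?k y] k(1)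
      unfolding k(3) len_F len_y by simp_all
    have IH: "V ! acc_wire n D (i * m + j) l = cmp_trits (drop (n - l) ?z) (drop (n - l) y)"
      using Suc by simp
    have l: "l < n" using Suc.prems by simp
    show ?case
      unfolding k(2) drop cmp_trits.simps V_cmp[OF ij l] V_result[OF ij k(1)] V_input[OF k(1)] IH ..
  qed
  from this[of n] show ?thesis by simp
qed

lemma V_comb_probe:
  assumes "i < m" "j < m"
  shows "V ! comb_wire n D (i * m + j) =
    comb_trit (if j = 0 then None else V ! comb_wire n D (i * m + (j - 1)))
      (F (probe m i j candidate) ! 0) (cmp_trits (F (probe m i j candidate)) y)"
proof -
  have ij: "valid i j" using assms by (simp add: valid_def)
  have "V ! prev_wire m n D i j = (if j = 0 then None else V ! comb_wire n D (i * m + (j - 1)))"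
    by (simp add: prev_wire_def V_consts)
  then show ?thesis using V_comb[OF ij] V_result[OF ij n_pos] V_acc[OF ij] by simp
qed

lemma V_out:
  assumes "l < m"
  shows "V ! (base n D (m * m + 1) + l * H + a 0) =
    mask_trit (candidate ! l) (F candidate ! 0) (cmp_trits (F candidate) y)"
proof -
  have "valid m 0" by (simp add: valid_def)
  \<comment> \<open>For \<open>i = m\<close> every position of the probe comes from the
    candidate.\<close>
  moreover have "probe m m 0 candidate = candidate"
    by (rule nth_equalityI) (simp_all add: probe_def candidate_def)
  ultimately show ?thesis
    using V_mask[OF assms] V_result[of m 0 0] V_acc[of m 0] n_pos assms by (simp add: candidate_def)
qed

end

lemma probe_cong: "(\<And>l. l < i \<Longrightarrow> l < m \<Longrightarrow> xs ! l = xs' ! l) \<Longrightarrow> probe m i j xs = probe m i j xs'"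
  by (simp add: probe_def)

text \<open>Induction on the length of the correct initial part: if the first \<open>i\<close>
  letters are right, then so are all probes of row \<open>i\<close>, and \<open>search\<close> gives
  the next letter. This concerns only \<open>y\<close> of the form \<open>pad n (f x)\<close>; for
  any other \<open>y\<close> the mask erases the candidate.\<close>

lemma V_inverse:
  assumes el: "F_element P Q f m n"
    and F: "\<And>xs l. length xs = m \<Longrightarrow> l < n \<Longrightarrow> exec G ops xs ! out l = padded P Q f xs ! l"
    and l: "l < m"
  shows "V ! (base n D (m * m + 1) + l * H + a 0) = padded Q P (inv_into P f) y ! l"
proof -
  interpret F_element P Q f m n by (rule el)
  have len_F: "length (padded P Q f xs) = n" for xs by (rule length_padded)
  have len_c: "length candidate = m" by (simp add: candidate_def[OF F len_F])
  note comb = V_comb_probe[OF F len_F] 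
  have "candidate = pad m x" if x: "x \<in> P" and y: "y = pad n (f x)" for x
  proof -
    have "\<forall>l<i. candidate ! l = pad m x ! l" if "i \<le> m" for i
      using that
    proof (induction i)
      case (Suc i)
      then have i: "i < m" and IH: "\<forall>l<i. candidate ! l = pad m x ! l" by auto
      have probe: "probe m i j candidate = probe m i j (pad m x)" for j
        by (rule probe_cong) (use IH in blast)
      have "V ! comb_wire n D (i * m + (m - 1)) = pad m x ! i"
        using comb[OF _ _ i] unfolding probe y by (intro search[OF x i]) blast
      then have "candidate ! i = pad m x ! i"
        using i by (simp add: candidate_def[OF F len_F])
      then show ?case using IH by (auto simp: less_Suc_eq)
    qed simp
    from this[of m] show ?thesis
      using length_pad[OF len(1)[OF x]] len_c by (intro nth_equalityI) auto
  qed
  from masked_candidate[OF len_y len_c this l] V_out[OF F len_F l] show ?thesis by simp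
qed

end

end

section \<open>The inverse circuit as a list of numbers\<close>

definition ops_size :: "operation list \<Rightarrow> nat" where
  "ops_size os = sum_list (map (\<lambda>op. Suc (op_links op)) os)"

lemma circuit_size_eq: "circuit_size c = ops_size (circ_ops c) + length (circ_outs c)"
proof -
  have "ops_size os = length os + sum_list (map op_links os)" for os
    by (induction os) (simp_all add: ops_size_def)
  then show ?thesis by (simp add: circuit_size_def num_gates_def num_wires_def)
qed

lemma ops_size_simps [simp]:
  "ops_size [] = 0" "ops_size (os @ os') = ops_size os + ops_size os'"
  by (simp_all add: ops_size_def)

lemma ops_size_rename [simp]: "ops_size (map (rename_op h) os) = ops_size os"
proof -
  have "op_links (rename_op h op) = op_links op" for op by (cases op) simp_all
  then show ?thesis by (simp add: ops_size_def comp_def)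
qed

lemma ops_size_straighten: "ops_size (straighten os) \<le> ops_size os"
proof (induction os rule: rev_induct)
  case (snoc op os)
  then show ?case by (cases op) (simp_all add: straighten_snoc ops_size_def)
qed simp

lemma ops_size_concat: "(\<And>l. l < N \<Longrightarrow> ops_size (f l) = S) \<Longrightarrow> ops_size (concat (map f [0..<N])) = N * S"
  by (induction N) simp_all

lemma length_concat_const:
  "(\<And>l. l < N \<Longrightarrow> length (f l) = S) \<Longrightarrow> length (concat (map f [0..<N])) = N * S"
  by (induction N) simp_all

context inverter
begin

lemma ops_size_stage: "ops_size (stage i j) = ops_size ops + Suc n * ops_size hops"
  by (simp add: stage_def cmp_gad_def comb_gad_def gad_def ops_size_concat[where S = "ops_size hops"])

lemma ops_size_inv_ops:
  "ops_size inv_ops = ops_size hops + (m * m + 1) * (ops_size ops + Suc n * ops_size hops) + m * ops_size hops"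
proof -
  define S where "S = ops_size ops + Suc n * ops_size hops"
  have "ops_size (concat (map row [0..<m])) = m * (m * S)"
    by (intro ops_size_concat) (simp only: ops_size_stage S_def)
  then show ?thesis unfolding S_def[symmetric]
    by (simp add: inv_ops_def ops_size_stage[folded S_def] ops_size_concat[where S = "ops_size hops"]
        mask_gad_def gad_def mult.assoc)
qed

lemma length_stage: "length (stage i j) = length ops + Suc n * length hops"
  by (simp add: stage_def cmp_gad_def comb_gad_def gad_def length_concat_const[where S = "length hops"]
      del: length_concat)

lemma length_inv_ops:
  "length inv_ops = length hops + (m * m + 1) * (length ops + Suc n * length hops) + m * length hops"
proof -
  define S where "S = length ops + Suc n * length hops"
  have "length (concat (map row [0..<m])) = m * (m * S)"
    by (intro length_concat_const) (simp only: length_stage S_def)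
  then show ?thesis unfolding S_def[symmetric]
    by (simp add: inv_ops_def length_stage[folded S_def] length_concat_const[where S = "length hops"]
        mask_gad_def gad_def mult.assoc del: length_concat)
qed

text \<open>The factor 6 collects one gadget for the constants, the stages with
  \<open>(m * m + 1) * Suc n \<le> 4 * (m ^ 2 * n)\<close>, and the \<open>m\<close> masks; the
  summand 1 pays for the \<open>m\<close> output links. All estimates use that \<open>m\<close> and
  \<open>n\<close> are positive, in particular \<open>m * m + 1 \<le> m * (m + 1)\<close>.\<close>

lemma size_bound:
  assumes "ops_size ops \<le> s"
  shows "ops_size inv_ops + m \<le> m * (m + 1) * s + (6 * ops_size hops + 1) * (m ^ 2 * n)"
proof -
  let ?h = "ops_size hops" and ?X = "m ^ 2 * n"
  have m: "m * m + 1 \<le> m * (m + 1)" "m * m + 1 \<le> 2 * m ^ 2" and n: "Suc n \<le> 2 * n"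
    using m_pos n_pos by (simp_all add: power2_eq_square)
  have X: "1 \<le> ?X" using m_pos n_pos by simp
  have mX: "m \<le> ?X" using m_pos n_pos by (simp add: power2_eq_square)
  have "(m * m + 1) * Suc n \<le> (2 * m ^ 2) * (2 * n)" by (rule mult_mono[OF m(2) n]) simp_all
  also have "\<dots> = 4 * ?X" by simp
  finally have 1: "(m * m + 1) * Suc n * ?h \<le> 4 * ?X * ?h" by (rule mult_le_mono1)
  have 2: "(m * m + 1) * ops_size ops \<le> m * (m + 1) * s" by (rule mult_mono[OF m(1) assms]) simp_all
  have 3: "?h \<le> ?X * ?h" "m * ?h \<le> ?X * ?h" using mult_le_mono1[OF X, of ?h] mult_le_mono1[OF mX, of ?h] by simp_all
  have "ops_size inv_ops + m = ?h + (m * m + 1) * ops_size ops + (m * m + 1) * Suc n * ?h + m * ?h + m"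
    unfolding ops_size_inv_ops by (simp only: distrib_left mult.assoc)
  also have "\<dots> \<le> ?X * ?h + m * (m + 1) * s + 4 * ?X * ?h + ?X * ?h + ?X"
    using 1 2 3 mX by (intro add_mono)
  also have "\<dots> = m * (m + 1) * s + (6 * ?h + 1) * ?X" by (simp add: algebra_simps)
  finally show ?thesis .
qed

end


text \<open>The place where operation \<open>t\<close> begins in the list of numbers. Two numbers
  come before the operations; the tag 0 marks a gate, which occupies three numbers and its links,
  while an exchange occupies two.\<close>

definition op_pos :: "nat list \<Rightarrow> nat \<Rightarrow> nat" where
  "op_pos I = rec_nat 2 (\<lambda>i x. if nth_default I x = 0 then x + (3 + nth_default I (x + 2)) else x + 2)"

definition swap_at :: "nat list \<Rightarrow> nat \<Rightarrow> nat \<Rightarrow> nat" where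
  "swap_at I t x = (if nth_default I (op_pos I t) = 0 then x
     else if x = nth_default I (op_pos I t + 1) then x + 1
     else if x = nth_default I (op_pos I t + 1) + 1 then x - 1 else x)"

text \<open>Tracing back begins with the last operation, hence the index \<open>t - Suc k\<close> in
  round \<open>k\<close>.\<close>

definition origin_at :: "nat list \<Rightarrow> nat \<Rightarrow> nat \<Rightarrow> nat" where
  "origin_at I t p = rec_nat p (\<lambda>k x. swap_at I (t - Suc k) x) t"

definition ins :: "nat list \<Rightarrow> nat" where "ins I = nth_default I 0"
definition num_ops :: "nat list \<Rightarrow> nat" where "num_ops I = nth_default I 1"
definition outs_pos :: "nat list \<Rightarrow> nat" where "outs_pos I = op_pos I (num_ops I)"
definition num_outs :: "nat list \<Rightarrow> nat" where "num_outs I = nth_default I (outs_pos I)"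
definition out_at :: "nat list \<Rightarrow> nat \<Rightarrow> nat" where
  "out_at I l = origin_at I (num_ops I) (nth_default I (outs_pos I + (1 + l)))"
definition gates_at :: "nat list \<Rightarrow> nat" where
  "gates_at I = (\<Sum>t<num_ops I. if nth_default I (op_pos I t) = 0 then 1 else 0)"

section \<open>Polynomial-time access to the encoded circuit\<close>

lemma poly_computable_op_pos:
  assumes "poly_computable k A"
  shows "poly_computable k (\<lambda>I e. op_pos I (A I e))"
proof (rule poly_computable_unary[OF _ assms])
  let ?F = "\<lambda>I e. if nth_default I (e 1) = 0 then e 1 + (3 + nth_default I (e 1 + 2)) else e 1 + 2"
  have F: "poly_computable (Suc (Suc 1)) ?F" by (intro poly_computable_intros) simp_all
  \<comment> \<open>A round adds at most 3 and one number on the tape, and that number is bounded by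
    the length of the tape.\<close>
  have le: "?F I (case_nat i (case_nat x e)) \<le> x + (3 + (i + arg_size 1 I e))" for I i x and e :: "nat \<Rightarrow> nat"
    using nth_default_le[of I "x + 2"] by (simp add: arg_size_def)
  have "poly_bounded (\<lambda>N. 3 + N)" by (intro poly_bounded_intros)
  from poly_computable_iterate[OF effective_var[of 0 1] effective_const[of 1 2] F this le]
  show "poly_computable 1 (\<lambda>I e. op_pos I (e 0))" by (simp add: op_pos_def cong: if_cong)
qed

lemma poly_computable_swap_at:
  assumes "poly_computable k A" "poly_computable k B"
  shows "poly_computable k (\<lambda>I e. swap_at I (A I e) (B I e))"
  unfolding swap_at_def by (intro poly_computable_intros poly_computable_op_pos assms)

lemma poly_computable_origin_at:
  assumes "poly_computable k A" "poly_computable k B"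
  shows "poly_computable k (\<lambda>I e. origin_at I (A I e) (B I e))"
proof (rule poly_computable_binary[OF _ assms])
  let ?F = "\<lambda>I e. swap_at I (e 2 - Suc (e 0)) (e 1)"
  have F: "poly_computable (Suc (Suc 2)) ?F"
    by (intro poly_computable_swap_at poly_computable_intros) simp_all
  \<comment> \<open>An exchange moves a wire by one position, so the growth per round is bounded by
    1.\<close>
  have le: "?F I (case_nat i (case_nat x e)) \<le> x + 1" for I i x and e :: "nat \<Rightarrow> nat"
    by (simp add: swap_at_def)
  from poly_computable_iterate[OF effective_var[of 0 2] effective_var[of 1 2] F poly_bounded_const[of 1] le]
  show "poly_computable 2 (\<lambda>I e. origin_at I (e 0) (e 1))"
    by (simp add: origin_at_def numeral_2_eq_2)
qed

lemma poly_computable_parameters: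
  "poly_computable k (\<lambda>I e. ins I)" "poly_computable k (\<lambda>I e. num_ops I)"
  "poly_computable k (\<lambda>I e. outs_pos I)" "poly_computable k (\<lambda>I e. num_outs I)"
  unfolding ins_def num_ops_def outs_pos_def num_outs_def
  by (intro poly_computable_intros poly_computable_op_pos)+

lemma poly_computable_out_at:
  "poly_computable k A \<Longrightarrow> poly_computable k (\<lambda>I e. out_at I (A I e))"
  unfolding out_at_def
  by (intro poly_computable_intros poly_computable_origin_at poly_computable_parameters)

lemma poly_computable_gates_at: "poly_computable k (\<lambda>I e. gates_at I)"
proof -
  have "poly_computable (Suc k) (\<lambda>I e. if nth_default I (op_pos I (e 0)) = 0 then 1 else 0)"
    by (intro poly_computable_intros poly_computable_op_pos) simp
  from poly_computable_sum[OF this poly_computable_parameters(2)]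
  show ?thesis by (simp add: gates_at_def)
qed

context gadget
begin

text \<open>The guard on the gate index gives a value also on lists that encode no circuit, and has
  the form of a table lookup.\<close>

definition wires_at :: "nat list \<Rightarrow> nat" where
  "wires_at I = (\<Sum>t<num_ops I. if nth_default I (op_pos I t) = 0
     then if nth_default I (op_pos I t + 1) < length G then gate_out (G ! nth_default I (op_pos I t + 1)) else 0
     else 0)"

lemma poly_computable_wires_at: "poly_computable k (\<lambda>I e. wires_at I)"
proof -
  have "poly_computable (Suc k) (\<lambda>I e. if nth_default I (op_pos I (e 0)) = 0
     then if nth_default I (op_pos I (e 0) + 1) < length G then gate_out (G ! nth_default I (op_pos I (e 0) + 1)) else 0
     else 0)"
    by (rule poly_computable_if_eq) (intro poly_computable_intros poly_computable_op_pos poly_computable_table; simp)+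
  from poly_computable_sum[OF this poly_computable_parameters(2)]
  show ?thesis by (simp add: wires_at_def cong: if_cong)
qed

abbreviation "copy_wire_at I \<equiv> copy_wire (ins I) (num_outs I) (wires_at I)"
abbreviation "base_at I \<equiv> base (num_outs I) (wires_at I)"
abbreviation "comb_wire_at I \<equiv> comb_wire (num_outs I) (wires_at I)"
abbreviation "acc_wire_at I \<equiv> acc_wire (num_outs I) (wires_at I)"
abbreviation "prev_wire_at I \<equiv> prev_wire (ins I) (num_outs I) (wires_at I)"

lemmas parameters = poly_computable_parameters poly_computable_wires_at poly_computable_gates_at

lemma poly_computable_base:
  "poly_computable k A \<Longrightarrow> poly_computable k (\<lambda>I e. base_at I (A I e))"
  unfolding base_def by (intro poly_computable_intros parameters)

lemma poly_computable_comb_wire: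
  "poly_computable k A \<Longrightarrow> poly_computable k (\<lambda>I e. comb_wire_at I (A I e))"
  unfolding comb_wire_def by (intro poly_computable_intros parameters poly_computable_base)

lemma poly_computable_acc_wire:
  "poly_computable k A \<Longrightarrow> poly_computable k B \<Longrightarrow> poly_computable k (\<lambda>I e. acc_wire_at I (A I e) (B I e))"
  unfolding acc_wire_def by (intro poly_computable_intros parameters poly_computable_base)

lemma poly_computable_prev_wire:
  "poly_computable k A \<Longrightarrow> poly_computable k B \<Longrightarrow> poly_computable k (\<lambda>I e. prev_wire_at I (A I e) (B I e))"
  unfolding prev_wire_def by (intro poly_computable_intros parameters poly_computable_comb_wire)

lemma poly_computable_copy_wire:
  "poly_computable k A \<Longrightarrow> poly_computable k B \<Longrightarrow> poly_computable k X \<Longrightarrow>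
    poly_computable k (\<lambda>I e. copy_wire_at I (A I e) (B I e) (X I e))"
  unfolding copy_wire_def src_wire_def
  by (intro poly_computable_intros parameters poly_computable_comb_wire poly_computable_base)

lemmas wire_intros = poly_computable_intros parameters poly_computable_base poly_computable_comb_wire
  poly_computable_acc_wire poly_computable_prev_wire poly_computable_copy_wire poly_computable_out_at
  poly_computable_origin_at poly_computable_op_pos

definition op_nums :: "nat list \<Rightarrow> nat \<Rightarrow> nat \<Rightarrow> nat \<Rightarrow> nat list" where
  "op_nums I i j t = (if nth_default I (op_pos I t) = 0
     then 0 # nth_default I (op_pos I t + 1) # nth_default I (op_pos I t + 2) #
       map (\<lambda>p. copy_wire_at I i j (origin_at I t (nth_default I (op_pos I t + (3 + p)))))
         [0..<nth_default I (op_pos I t + 2)]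
     else [])"

definition gad_nums :: "nat \<Rightarrow> nat \<Rightarrow> nat \<Rightarrow> nat \<Rightarrow> nat \<Rightarrow> nat list" where
  "gad_nums W b0 b1 b2 b3 = concat (map op_numbers (gad W b0 b1 b2 b3))"

definition stage_nums :: "nat list \<Rightarrow> nat \<Rightarrow> nat \<Rightarrow> nat list" where
  "stage_nums I i j =
     concat (map (op_nums I i j) [0..<num_ops I]) @
     concat (map (\<lambda>l. gad_nums (base_at I (i * ins I + j) + wires_at I + l * new_wires G hops) (num_outs I + a 3)
       (copy_wire_at I i j (out_at I (num_outs I - 1 - l))) (num_outs I - 1 - l)
       (acc_wire_at I (i * ins I + j) l)) [0..<num_outs I]) @
     gad_nums (base_at I (i * ins I + j) + wires_at I + num_outs I * new_wires G hops) (num_outs I + a 1)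
       (prev_wire_at I i j) (copy_wire_at I i j (out_at I 0)) (acc_wire_at I (i * ins I + j) (num_outs I))"

text \<open>\<open>[0, 0, 0]\<close> encodes the circuit without wires. Otherwise the number of
  operations has to be printed before the operations, so it is computed by the formula of
  \<open>length_inv_ops\<close>.\<close>

definition inv_nums :: "nat list \<Rightarrow> nat list" where
  "inv_nums I = (if ins I = 0 then [0, 0, 0] else
     num_outs I #
     (length hops + (ins I * ins I + 1) * (gates_at I + Suc (num_outs I) * length hops) + ins I * length hops) #
     gad_nums (num_outs I) 0 0 0 0 @
     concat (map (\<lambda>i. concat (map (stage_nums I i) [0..<ins I])) [0..<ins I]) @
     stage_nums I (ins I) 0 @
     concat (map (\<lambda>l. gad_nums (base_at I (ins I * ins I + 1) + l * new_wires G hops) (num_outs I + a 2)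
       (comb_wire_at I (l * ins I + (ins I - 1))) (copy_wire_at I (ins I) 0 (out_at I 0))
       (acc_wire_at I (ins I * ins I) (num_outs I))) [0..<ins I]) @
     ins I # map (\<lambda>l. base_at I (ins I * ins I + 1) + l * new_wires G hops + a 0) [0..<ins I])"

lemma poly_printable_Nil: "poly_printable k (\<lambda>I e. [])"
  by (rule effective_const)

text \<open>\<open>hops\<close> is fixed, so the program is unrolled over its operations; at run
  time only the five wire numbers vary.\<close>

lemma poly_printable_gad:
  assumes "poly_computable k W" "poly_computable k B0" "poly_computable k B1" "poly_computable k B2"
    "poly_computable k B3"
  shows "poly_printable k (\<lambda>I e. gad_nums (W I e) (B0 I e) (B1 I e) (B2 I e) (B3 I e))"
proof -
  let ?h = "\<lambda>I e. gad_wire (W I e) (B0 I e) (B1 I e) (B2 I e) (B3 I e)"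
  have wire: "poly_computable k (\<lambda>I e. ?h I e p)" for p
  proof (cases "p < 4")
    case True
    then have "p = 0 \<or> p = 1 \<or> p = 2 \<or> p = 3" by auto
    then show ?thesis using assms by (auto simp: gad_wire_def eval_nat_numeral)
  next
    case False
    then show ?thesis using poly_computable_add[OF assms(1) effective_const[of k "p - 4"]]
      by (simp add: gad_wire_def)
  qed
  have wires: "poly_printable k (\<lambda>I e. map (?h I e) ps)" for ps
    by (induction ps) (auto intro!: poly_printable_Nil poly_printable_Cons wire)
  have op: "poly_printable k (\<lambda>I e. op_numbers (rename_op (?h I e) op))" for op
    by (cases op) (auto intro!: poly_printable_Nil poly_printable_Cons wires effective_const)
  have "poly_printable k (\<lambda>I e. concat (map op_numbers (map (rename_op (?h I e)) os)))" for os
    by (induction os) (auto intro!: poly_printable_Nil poly_printable_append op simp del: map_map)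
  then show ?thesis by (simp add: gad_nums_def gad_def)
qed

lemma poly_printable_op_nums: "poly_printable 3 (\<lambda>I e. op_nums I (e 2) (e 1) (e 0))"
proof -
  have "poly_computable (Suc 3) (\<lambda>I e. copy_wire_at I (e 3) (e 2)
      (origin_at I (e 1) (nth_default I (op_pos I (e 1) + (3 + e 0)))))"
    by (intro wire_intros) simp_all
  from poly_printable_map[OF this]
  have "poly_printable 3 (\<lambda>I e. map (\<lambda>p. copy_wire_at I (e 2) (e 1)
      (origin_at I (e 0) (nth_default I (op_pos I (e 0) + (3 + p)))))
         [0..<nth_default I (op_pos I (e 0) + 2)])"
    by (simp add: eval_nat_numeral wire_intros)
  then show ?thesis unfolding op_nums_def
    by (intro poly_printable_intros poly_printable_Nil wire_intros) simp_all
qed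

lemma poly_printable_stage: "poly_printable 2 (\<lambda>I e. stage_nums I (e 1) (e 0))"
proof -
  have 1: "poly_printable 2 (\<lambda>I e. concat (map (op_nums I (e 1) (e 0)) [0..<num_ops I]))"
    using poly_printable_concat[of 2 "\<lambda>I e. op_nums I (e 2) (e 1) (e 0)" "\<lambda>I e. num_ops I"]
      poly_printable_op_nums by (simp add: eval_nat_numeral wire_intros)
  have "poly_printable (Suc 2) (\<lambda>I e. gad_nums (base_at I (e 2 * ins I + e 1) + wires_at I + e 0 * new_wires G hops)
      (num_outs I + a 3) (copy_wire_at I (e 2) (e 1) (out_at I (num_outs I - 1 - e 0))) (num_outs I - 1 - e 0)
       (acc_wire_at I (e 2 * ins I + e 1) (e 0)))"
    by (intro poly_printable_gad wire_intros) simp_all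
  from poly_printable_concat[OF this poly_computable_parameters(4)]
  have 2: "poly_printable 2 (\<lambda>I e. concat (map (\<lambda>l. gad_nums (base_at I (e 1 * ins I + e 0) + wires_at I + l * new_wires G hops)
      (num_outs I + a 3) (copy_wire_at I (e 1) (e 0) (out_at I (num_outs I - 1 - l))) (num_outs I - 1 - l)
       (acc_wire_at I (e 1 * ins I + e 0) l)) [0..<num_outs I]))"
    by (simp add: eval_nat_numeral)
  show ?thesis unfolding stage_nums_def
    by (intro poly_printable_append 1 2 poly_printable_gad wire_intros) simp_all
qed

lemma poly_printable_inv_nums: "poly_printable 0 (\<lambda>I e. inv_nums I)"
proof -
  have "poly_printable 1 (\<lambda>I e. concat (map (stage_nums I (e 0)) [0..<ins I]))"
    using poly_printable_concat[of 1 "\<lambda>I e. stage_nums I (e 1) (e 0)" "\<lambda>I e. ins I"] poly_printable_stage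
    by (simp add: eval_nat_numeral wire_intros)
  then have rows: "poly_printable 0 (\<lambda>I e. concat (map (\<lambda>i. concat (map (stage_nums I i) [0..<ins I])) [0..<ins I]))"
    using poly_printable_concat[of 0 "\<lambda>I e. concat (map (stage_nums I (e 0)) [0..<ins I])" "\<lambda>I e. ins I"]
    by (simp add: wire_intros)
  have last: "poly_printable 0 (\<lambda>I e. stage_nums I (ins I) 0)"
    using effective_let2[of 0 "\<lambda>I e. ins I" "\<lambda>I e. 0" "\<lambda>I e. 0" "\<lambda>I e. stage_nums I (e 1) (e 0)"]
      poly_printable_stage by (simp add: wire_intros eval_nat_numeral)
  have "poly_printable 1 (\<lambda>I e. gad_nums (base_at I (ins I * ins I + 1) + e 0 * new_wires G hops) (num_outs I + a 2)
       (comb_wire_at I (e 0 * ins I + (ins I - 1))) (copy_wire_at I (ins I) 0 (out_at I 0))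
       (acc_wire_at I (ins I * ins I) (num_outs I)))"
    by (intro poly_printable_gad wire_intros) simp_all
  then have masks: "poly_printable 0 (\<lambda>I e. concat (map (\<lambda>l. gad_nums (base_at I (ins I * ins I + 1) + l * new_wires G hops) (num_outs I + a 2)
       (comb_wire_at I (l * ins I + (ins I - 1))) (copy_wire_at I (ins I) 0 (out_at I 0))
       (acc_wire_at I (ins I * ins I) (num_outs I))) [0..<ins I]))"
    using poly_printable_concat[OF _ poly_computable_parameters(1), of 0 "\<lambda>I e. gad_nums (base_at I (ins I * ins I + 1) + e 0 * new_wires G hops) (num_outs I + a 2)
       (comb_wire_at I (e 0 * ins I + (ins I - 1))) (copy_wire_at I (ins I) 0 (out_at I 0))
       (acc_wire_at I (ins I * ins I) (num_outs I))"] by simp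
  have "poly_computable 1 (\<lambda>I e. base_at I (ins I * ins I + 1) + e 0 * new_wires G hops + a 0)"
    by (intro wire_intros) simp_all
  then have outs: "poly_printable 0 (\<lambda>I e. map (\<lambda>l. base_at I (ins I * ins I + 1) + l * new_wires G hops + a 0) [0..<ins I])"
    using poly_printable_map[OF _ poly_computable_parameters(1), of 0 "\<lambda>I e. base_at I (ins I * ins I + 1) + e 0 * new_wires G hops + a 0"]
    by simp
  show ?thesis unfolding inv_nums_def
    by (intro poly_printable_intros poly_printable_Nil poly_printable_gad rows last masks outs wire_intros)
qed

end


section \<open>Decoding the numbers of a circuit\<close>

abbreviation op_nums_length :: "operation list \<Rightarrow> nat" where
  "op_nums_length os \<equiv> length (concat (map op_numbers os))"

lemma circuit_numbers_split:
  assumes "t \<le> length (circ_ops c)"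
  shows "circuit_numbers c =
    (circ_in c # length (circ_ops c) # concat (map op_numbers (take t (circ_ops c)))) @
    concat (map op_numbers (drop t (circ_ops c))) @ length (circ_outs c) # circ_outs c"
proof -
  have "concat (map op_numbers (circ_ops c)) =
      concat (map op_numbers (take t (circ_ops c))) @ concat (map op_numbers (drop t (circ_ops c)))"
    by (metis append_take_drop_id concat_append map_append)
  then show ?thesis by (simp add: circuit_numbers_def)
qed

lemma nth_default_append: "nth_default (xs @ ys) (length xs + i) = nth_default ys i"
  by (simp add: nth_default_def)

lemma nth_default_append_left: "i < length ys \<Longrightarrow> nth_default (ys @ zs) i = ys ! i"
  by (simp add: nth_default_def nth_append)

lemma op_pos_eq:
  "t \<le> length (circ_ops c) \<Longrightarrow>
    op_pos (circuit_numbers c) t = 2 + op_nums_length (take t (circ_ops c))"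
  and nth_op:
  "t < length (circ_ops c) \<Longrightarrow> i < length (op_numbers (circ_ops c ! t)) \<Longrightarrow>
    nth_default (circuit_numbers c) (op_pos (circuit_numbers c) t + i) = op_numbers (circ_ops c ! t) ! i"
proof -
  let ?I = "circuit_numbers c" and ?os = "circ_ops c"
  \<comment> \<open>Stated with the explicit position instead of \<open>op_pos\<close>, because the
    induction for \<open>op_pos\<close> has to read the tag and the number of links there.\<close>
  have nth: "nth_default ?I (2 + op_nums_length (take t ?os) + i) = op_numbers (?os ! t) ! i"
    if t: "t < length ?os" and i: "i < length (op_numbers (?os ! t))" for t i
  proof -
    let ?xs = "circ_in c # length ?os # concat (map op_numbers (take t ?os))"
    have "drop t ?os = ?os ! t # drop (Suc t) ?os" using t by (simp add: Cons_nth_drop_Suc)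
    then have I: "?I = ?xs @ op_numbers (?os ! t) @ (concat (map op_numbers (drop (Suc t) ?os)) @ length (circ_outs c) # circ_outs c)"
      using circuit_numbers_split[of t c] t by simp
    have "nth_default ?I (length ?xs + i) = op_numbers (?os ! t) ! i"
      unfolding I nth_default_append by (rule nth_default_append_left[OF i])
    then show ?thesis by simp
  qed
  have pos: "op_pos ?I t = 2 + op_nums_length (take t ?os)" if "t \<le> length ?os" for t
    using that
  proof (induction t)
    case 0
    then show ?case by (simp add: op_pos_def)
  next
    case (Suc t)
    then have t: "t < length ?os" and IH: "op_pos ?I t = 2 + op_nums_length (take t ?os)" by auto
    have step: "op_pos ?I (Suc t) = (if nth_default ?I (op_pos ?I t) = 0
        then op_pos ?I t + (3 + nth_default ?I (op_pos ?I t + 2)) else op_pos ?I t + 2)"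
      by (simp add: op_pos_def)
    have len: "op_nums_length (take (Suc t) ?os) = op_nums_length (take t ?os) + length (op_numbers (?os ! t))"
      using t by (simp add: take_Suc_conv_app_nth)
    show ?case
    proof (cases "?os ! t")
      case (Gate g ps)
      then have "nth_default ?I (op_pos ?I t) = 0" "nth_default ?I (op_pos ?I t + 2) = length ps"
        using nth[OF t, of 0] nth[OF t, of 2] unfolding IH by simp_all
      then show ?thesis unfolding step len using Gate IH by simp
    next
      case (Swap i)
      then have "nth_default ?I (op_pos ?I t) = 1"
        using nth[OF t, of 0] unfolding IH by simp
      then show ?thesis unfolding step len using Swap IH by simp
    qed
  qed
  show "t \<le> length ?os \<Longrightarrow> op_pos ?I t = 2 + op_nums_length (take t ?os)" by (rule pos)
  show "t < length ?os \<Longrightarrow> i < length (op_numbers (?os ! t)) \<Longrightarrow>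
      nth_default ?I (op_pos ?I t + i) = op_numbers (?os ! t) ! i"
    using nth[of t i] pos[of t] by simp
qed

lemma nth_Gate:
  assumes "t < length (circ_ops c)" "circ_ops c ! t = Gate g ps"
  defines "I \<equiv> circuit_numbers c"
  shows "nth_default I (op_pos I t) = 0" "nth_default I (op_pos I t + 1) = g"
    "nth_default I (op_pos I t + 2) = length ps"
    "p < length ps \<Longrightarrow> nth_default I (op_pos I t + (3 + p)) = ps ! p"
  using nth_op[OF assms(1), of 0] nth_op[OF assms(1), of 1] nth_op[OF assms(1), of 2]
    nth_op[OF assms(1), of "3 + p"] assms(2)
  unfolding I_def by simp_all

lemma nth_Swap:
  assumes "t < length (circ_ops c)" "circ_ops c ! t = Swap i"
  defines "I \<equiv> circuit_numbers c"
  shows "nth_default I (op_pos I t) = 1" "nth_default I (op_pos I t + 1) = i"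
  using nth_op[OF assms(1), of 0] nth_op[OF assms(1), of 1] assms(2)
  unfolding I_def by simp_all

lemma ins_eq: "ins (circuit_numbers c) = circ_in c"
  by (simp add: ins_def circuit_numbers_def nth_default_def)

lemma num_ops_eq: "num_ops (circuit_numbers c) = length (circ_ops c)"
  by (simp add: num_ops_def circuit_numbers_def nth_default_def)

lemma nth_outs:
  "nth_default (circuit_numbers c) (outs_pos (circuit_numbers c) + i) = nth_default (length (circ_outs c) # circ_outs c) i"
proof -
  let ?xs = "circ_in c # length (circ_ops c) # concat (map op_numbers (circ_ops c))"
  have "outs_pos (circuit_numbers c) = length ?xs"
    by (simp add: outs_pos_def num_ops_eq op_pos_eq)
  then show ?thesis
    using nth_default_append[of ?xs "length (circ_outs c) # circ_outs c" i] by (simp add: circuit_numbers_def)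
qed

lemma num_outs_eq: "num_outs (circuit_numbers c) = length (circ_outs c)"
  using nth_outs[of c 0] by (simp add: num_outs_def nth_default_def)

lemma swap_at_eq:
  assumes "t < length (circ_ops c)"
  shows "swap_at (circuit_numbers c) t x = swap_pos (circ_ops c ! t) x"
proof (cases "circ_ops c ! t")
  case (Gate g ps)
  then show ?thesis using nth_Gate(1)[OF assms Gate] by (simp add: swap_at_def)
next
  case (Swap i)
  then show ?thesis using nth_Swap[OF assms Swap] by (simp add: swap_at_def)
qed

lemma origin_at_eq:
  assumes "t \<le> length (circ_ops c)"
  shows "origin_at (circuit_numbers c) t p = origin (take t (circ_ops c)) p"
proof -
  let ?I = "circuit_numbers c" and ?os = "take t (circ_ops c)"
  \<comment> \<open>After \<open>k\<close> rounds the last \<open>k\<close> of the first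
    \<open>t\<close> operations have been traced back.\<close>
  have "origin (drop (t - k) ?os) p = rec_nat p (\<lambda>k x. swap_at ?I (t - Suc k) x) k" if "k \<le> t" for k
    using that
  proof (induction k)
    case 0
    then show ?case by simp
  next
    case (Suc k)
    then have k: "t - Suc k < t" "Suc (t - Suc k) = t - k" by auto
    have "drop (t - Suc k) ?os = circ_ops c ! (t - Suc k) # drop (t - k) ?os"
      using Cons_nth_drop_Suc[of "t - Suc k" ?os] k assms unfolding k(2) by simp
    moreover have "swap_at ?I (t - Suc k) x = swap_pos (circ_ops c ! (t - Suc k)) x" for x
      using k assms by (intro swap_at_eq) simp
    ultimately show ?case using Suc by (simp add: origin_def)
  qed
  from this[of t] show ?thesis by (simp add: origin_at_def)
qed

lemma out_at_eq:
  assumes "l < length (circ_outs c)"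
  shows "out_at (circuit_numbers c) l = origin (circ_ops c) (circ_outs c ! l)"
  using assms nth_outs[of c "1 + l"] by (simp add: out_at_def num_ops_eq origin_at_eq nth_default_def)

lemma wf_ops_gate: "wf_ops G w os ps \<Longrightarrow> Gate g qs \<in> set os \<Longrightarrow> g < length G"
  by (induction G w os ps rule: wf_ops.induct) auto

lemma concat_map_concat: "concat (map f (concat (map g xs))) = concat (map (\<lambda>x. concat (map f (g x))) xs)"
  by (induction xs) simp_all

lemma gates_at_eq: "gates_at (circuit_numbers c) = length (straighten (circ_ops c))"
proof -
  have "length (concat (map f [0..<N])) = (\<Sum>t<N. length (f t))" for f :: "nat \<Rightarrow> operation list" and N
    by (induction N) simp_all
  then have "length (straighten (circ_ops c)) = (\<Sum>t<length (circ_ops c). length (straight_op (circ_ops c) t))"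
    unfolding straighten_def .
  also have "\<dots> = gates_at (circuit_numbers c)"
    unfolding gates_at_def num_ops_eq
  proof (rule sum.cong)
    fix t assume "t \<in> {..<length (circ_ops c)}"
    then have t: "t < length (circ_ops c)" by simp
    show "length (straight_op (circ_ops c) t) =
        (if nth_default (circuit_numbers c) (op_pos (circuit_numbers c) t) = 0 then 1 else 0)"
      by (cases "circ_ops c ! t") (simp_all add: straight_op_def nth_Gate[OF t] nth_Swap[OF t])
  qed simp
  finally show ?thesis ..
qed

context gadget
begin

lemma wires_at_eq:
  assumes "wf_ops G w (circ_ops c) ps"
  shows "wires_at (circuit_numbers c) = new_wires G (circ_ops c)"
proof -
  let ?I = "circuit_numbers c"
  let ?g = "\<lambda>op. case op of Gate g ps \<Rightarrow> gate_out (G ! g) | Swap i \<Rightarrow> 0"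
  have "new_wires G os = (\<Sum>t<length os. ?g (os ! t))" for os
    by (induction G os rule: new_wires.induct) (simp_all add: sum.lessThan_Suc_shift del: sum.lessThan_Suc)
  then have "new_wires G (circ_ops c) = (\<Sum>t<length (circ_ops c). ?g (circ_ops c ! t))" .
  also have "\<dots> = wires_at ?I"
    unfolding wires_at_def num_ops_eq
  proof (rule sum.cong)
    fix t assume "t \<in> {..<length (circ_ops c)}"
    then have t: "t < length (circ_ops c)" by simp
    show "?g (circ_ops c ! t) = (if nth_default ?I (op_pos ?I t) = 0
        then if nth_default ?I (op_pos ?I t + 1) < length G
          then gate_out (G ! nth_default ?I (op_pos ?I t + 1)) else 0
        else 0)"
    proof (cases "circ_ops c ! t")
      case (Gate g qs)
      then have "g < length G" using wf_ops_gate[OF assms] nth_mem[OF t] by metis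
      then show ?thesis using nth_Gate(1,2)[OF t Gate] Gate by simp
    next
      case (Swap i)
      then show ?thesis using nth_Swap(1)[OF t Swap] by simp
    qed
  qed simp
  finally show ?thesis ..
qed

end

section \<open>Length of the encoding\<close>

lemma wf_ops_gate_less:
  "wf_ops G w os ps \<Longrightarrow> op \<in> set os \<Longrightarrow> x \<in> set (op_numbers op) \<Longrightarrow>
    x < length G + w + new_wires G os + ops_size os + 2"
proof (induction G w os ps rule: wf_ops.induct)
  case (2 G w g qs os ps)
  show ?case
  proof (cases "op = Gate g qs")
    case True
    have "x = 0 \<or> x = g \<or> x = length qs \<or> x \<in> set qs" using 2(4) True by auto
    then show ?thesis using 2(2) by (auto simp: ops_size_def)
  next
    case False
    then show ?thesis using 2 by (auto simp: ops_size_def)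
  qed
next
  case (3 G w i os ps)
  show ?case
  proof (cases "op = Swap i")
    case True
    then have "x = 1 \<or> x = i" using 3(4) by auto
    then show ?thesis using 3(2) by auto
  next
    case False
    then show ?thesis using 3 by (auto simp: ops_size_def)
  qed
qed simp

text \<open>A single gate has at most as many outputs as all gates of \<open>G\<close>
  together.\<close>

lemma new_wires_le:
  assumes "wf_ops G w os ps"
  shows "new_wires G os \<le> sum_list (map gate_out G) * ops_size os"
  using assms
proof (induction G w os ps rule: wf_ops.induct)
  case (2 G w g qs os ps)
  have "gate_out (G ! g) \<le> sum_list (map gate_out G)"
    using 2(2) by (intro member_le_sum_list) auto
  then show ?case using 2 by (simp add: ops_size_def distrib_left)
next
  case (3 G w i os ps)
  then have "new_wires G (Swap i # os) \<le> sum_list (map gate_out G) * ops_size os" by simp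
  also have "\<dots> \<le> sum_list (map gate_out G) * ops_size (Swap i # os)"
    by (intro mult_le_mono2) (simp add: ops_size_def)
  finally show ?case .
qed simp

lemma op_nums_length_le: "op_nums_length os \<le> 3 * ops_size os"
proof -
  have op: "length (op_numbers op) \<le> 3 * Suc (op_links op)" for op by (cases op) simp_all
  show ?thesis
  proof (induction os)
    case (Cons op os)
    then show ?case using op[of op] by (simp add: ops_size_def)
  qed simp
qed

lemma length_encs_le: "(\<And>x. x \<in> set I \<Longrightarrow> x \<le> b) \<Longrightarrow> length (encs I) \<le> length I * (b + 1)"
proof (induction I)
  case (Cons a I)
  then have "a \<le> b" "length (encs I) \<le> length I * (b + 1)" by auto
  then show ?case by simp
qed simp

text \<open>Needed since the machine is timed by the length of the unary encoding, not by the
  circuit size. Well-formedness makes each number linear in the size and the number of inputs, and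
  there are linearly many numbers, hence the square.\<close>

lemma length_enc_circuit_le:
  assumes "wf_circuit G c"
  shows "length (encs (circuit_numbers c)) \<le>
    (length G + sum_list (map gate_out G) + 9) * 7 * (circuit_size c + circ_in c + 1) ^ 2"
proof -
  let ?s = "circuit_size c" and ?m = "circ_in c" and ?g = "sum_list (map gate_out G)"
  let ?b = "(length G + ?g + 8) * (?s + ?m + 1)"
  have wf: "wf_ops G ?m (circ_ops c) (circ_outs c)" using assms by (simp add: wf_circuit_def)
  have size: "ops_size (circ_ops c) + length (circ_outs c) = ?s" by (simp add: circuit_size_eq)
  have "length os \<le> ops_size os" for os by (induction os) (simp_all add: ops_size_def)
  then have T: "length (circ_ops c) \<le> ?s" using size by (metis le_add1 le_trans)
  have new: "new_wires G (circ_ops c) \<le> ?g * ?s"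
    using new_wires_le[OF wf] size by (metis le_add1 le_trans mult_le_mono2)
  have eq: "7 * X * (K * X) = K * 7 * X ^ 2" for X K :: nat by (simp add: power2_eq_square)
  have b: "length G + ?m + ?g * ?s + ?s + 2 \<le> ?b" by (simp add: algebra_simps)
  have "x \<le> ?b" if x: "x \<in> set (circuit_numbers c)" for x
  proof -
    consider "x = ?m" | "x = length (circ_ops c)" | op where "op \<in> set (circ_ops c)" "x \<in> set (op_numbers op)"
      | "x = length (circ_outs c)" | "x \<in> set (circ_outs c)"
      using x by (auto simp: circuit_numbers_def)
    then show ?thesis
    proof cases
      case 3
      then show ?thesis using wf_ops_gate_less[OF wf 3] new size b by linarith
    next
      case 5
      then have "x < ?m + new_wires G (circ_ops c)" using wf wf_ops_outs by blast
      then show ?thesis using new b by linarith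
    qed (use T size b in linarith)+
  qed
  then have "length (encs (circuit_numbers c)) \<le> length (circuit_numbers c) * (?b + 1)"
    by (rule length_encs_le)
  also have "\<dots> \<le> (7 * (?s + ?m + 1)) * ((length G + ?g + 9) * (?s + ?m + 1))"
  proof (rule mult_le_mono)
    show "length (circuit_numbers c) \<le> 7 * (?s + ?m + 1)"
      using op_nums_length_le[of "circ_ops c"] size by (simp add: circuit_numbers_def)
    show "?b + 1 \<le> (length G + ?g + 9) * (?s + ?m + 1)" by (simp add: algebra_simps)
  qed
  finally show ?thesis by (simp only: eq)
qed

section \<open>The printed list encodes the inverse circuit\<close>

context inverter
begin

definition inv_circuit :: circuit where
  "inv_circuit = \<lparr>circ_in = n, circ_ops = inv_ops, circ_outs = inv_outs\<rparr>"

lemma inv_circuit_sel [simp]: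
  "circ_in inv_circuit = n" "circ_ops inv_circuit = inv_ops" "circ_outs inv_circuit = inv_outs"
  by (simp_all add: inv_circuit_def)

lemma inv_circuit_computes:
  assumes el: "F_element P Q f m n"
    and F: "\<And>xs l. length xs = m \<Longrightarrow> l < n \<Longrightarrow> exec G ops xs ! out l = padded P Q f xs ! l"
  shows "computes G inv_circuit Q P (inv_into P f)"
proof -
  interpret F_element P Q f m n by (rule el)
  have "eval_circuit G inv_circuit y = padded Q P (inv_into P f) y" if y: "length y = n" for y
  proof (rule nth_equalityI)
    have inv_in: "inv_into P f q \<in> P" if "q \<in> Q" for q
      using bij_betwE[OF bij_betw_inv_into[OF facts(7)]] that by blast
    have "length (padded Q P (inv_into P f) y) = m"
    proof (cases "\<exists>q\<in>Q. y = pad (maxlen Q) q")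
      case True
      then obtain q where q: "q \<in> Q" "y = pad (maxlen Q) q" by blast
      then show ?thesis
        using padded_pad[OF facts(4) q(1), of P "inv_into P f"] length_pad len(1)[OF inv_in[OF q(1)]] m by simp
    next
      case False
      then show ?thesis by (simp add: padded_def m)
    qed
    then show "length (eval_circuit G inv_circuit y) = length (padded Q P (inv_into P f) y)"
      by (simp add: eval_circuit_def inv_outs_def)
    fix l assume "l < length (eval_circuit G inv_circuit y)"
    then have l: "l < m" by (simp add: eval_circuit_def inv_outs_def)
    show "eval_circuit G inv_circuit y ! l = padded Q P (inv_into P f) y ! l"
      using V_inverse[OF y refl el F l] l by (simp add: eval_circuit_def inv_outs_def)
  qed
  moreover have "wf_circuit G inv_circuit" using wf_inv_ops by (simp add: wf_circuit_def)
  ultimately show ?thesis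
    unfolding computes_def has_io_function_def m[symmetric] n[symmetric] by (simp add: inv_outs_def)
qed

context
  fixes c :: circuit
  assumes wf_c: "wf_circuit G c" and ops: "ops = straighten (circ_ops c)" and ins: "m = circ_in c"
    and outs: "n = length (circ_outs c)" and out: "\<And>l. out l = origin (circ_ops c) (circ_outs c ! l)"
begin

abbreviation "I \<equiv> circuit_numbers c"

lemma wires_at_I: "wires_at I = D"
proof -
  have "wf_ops G m (circ_ops c) []"
    using wf_c wf_ops_outs unfolding wf_circuit_def ins by blast
  then show ?thesis
    using wires_at_eq[of m c "[]"] straighten_correct[OF wf_gates, of "replicate m None" "circ_ops c"]
    by (simp add: ops)
qed

lemma parameters_I: "Defs.circ_in c = m" "ins I = m" "num_outs I = n" "wires_at I = D" "num_ops I = length (circ_ops c)"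
  "gates_at I = length ops"
  by (simp_all add: ins_eq num_outs_eq wires_at_I num_ops_eq gates_at_eq ins outs ops)

lemma out_at_I: "l < n \<Longrightarrow> out_at I l = out l"
  using out_at_eq[of l c] by (simp add: outs out)

text \<open>Both sides run through the original operations; a gate gives the same numbers on each
  side, an exchange gives none.\<close>

lemma copy_nums: "concat (map op_numbers (map (rename_op (copy_wire m n D i j)) ops)) =
    concat (map (op_nums I i j) [0..<num_ops I])"
proof -
  let ?h = "copy_wire m n D i j"
  have "concat (map (\<lambda>op. op_numbers (rename_op ?h op)) (straight_op (circ_ops c) t)) = op_nums I i j t"
    if t: "t < length (circ_ops c)" for t
  proof (cases "circ_ops c ! t")
    case (Gate g ps)
    have "map (\<lambda>p. ?h (origin_at I t (nth_default I (op_pos I t + (3 + p))))) [0..<length ps] =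
        map (\<lambda>p. ?h (origin (take t (circ_ops c)) (ps ! p))) [0..<length ps]"
      using nth_Gate(4)[OF t Gate] t by (simp add: origin_at_eq)
    also have "\<dots> = map (?h \<circ> origin (take t (circ_ops c))) ps"
      by (rule nth_equalityI) simp_all
    finally show ?thesis
      using nth_Gate(1-3)[OF t Gate] Gate by (simp add: straight_op_def op_nums_def parameters_I)
  next
    case (Swap k)
    then show ?thesis using nth_Swap(1)[OF t Swap] by (simp add: straight_op_def op_nums_def)
  qed
  then have "concat (map (\<lambda>op. op_numbers (rename_op ?h op)) ops) =
      concat (map (op_nums I i j) [0..<length (circ_ops c)])"
    unfolding ops straighten_def concat_map_concat by (intro arg_cong[of _ _ concat] map_cong) simp_all
  then show ?thesis by (simp add: parameters_I comp_def)
qed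

lemma stage_nums_eq: "stage_nums I i j = concat (map op_numbers (stage i j))"
proof -
  have "concat (map op_numbers (concat (map (cmp_gad i j) [0..<n]))) =
      concat (map (\<lambda>l. gad_nums (base n D (i * m + j) + D + l * H) (n + a 3)
        (copy_wire m n D i j (out_at I (n - 1 - l))) (n - 1 - l) (acc_wire n D (i * m + j) l)) [0..<n])"
    unfolding concat_map_concat gad_nums_def
    by (intro arg_cong[of _ _ concat] map_cong) (simp_all add: cmp_gad_def out_at_I)
  moreover have "concat (map op_numbers (comb_gad i j)) =
      gad_nums (base n D (i * m + j) + D + n * H) (n + a 1)
        (prev_wire m n D i j) (copy_wire m n D i j (out_at I 0)) (acc_wire n D (i * m + j) n)"
    by (simp add: gad_nums_def comb_gad_def out_at_I n_pos)
  ultimately show ?thesis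
    unfolding stage_nums_def stage_def map_append concat_append copy_nums parameters_I by simp
qed

lemma inv_nums_eq: "inv_nums I = circuit_numbers inv_circuit"
proof -
  have rows: "concat (map op_numbers (concat (map row [0..<m]))) =
      concat (map (\<lambda>i. concat (map (stage_nums I i) [0..<m])) [0..<m])"
    unfolding concat_map_concat stage_nums_eq ..
  have masks: "concat (map op_numbers (concat (map mask_gad [0..<m]))) =
      concat (map (\<lambda>l. gad_nums (base n D (m * m + 1) + l * H) (n + a 2)
       (comb_wire n D (l * m + (m - 1))) (copy_wire m n D m 0 (out_at I 0))
       (acc_wire n D (m * m) n)) [0..<m])"
    unfolding concat_map_concat gad_nums_def mask_gad_def out_at_I[OF n_pos] ..
  show ?thesis
    unfolding inv_nums_def circuit_numbers_def[of inv_circuit] parameters_I inv_circuit_sel length_inv_ops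
    using m_pos
    by (simp only: inv_ops_def map_append concat_append rows masks stage_nums_eq[symmetric] gad_nums_def[symmetric]
        inv_outs_def length_map length_upt) simp
qed

end

end

text \<open>If \<open>m = 0\<close>, both codes are \<open>{[]}\<close> and the circuit without
  wires is the inverse. Otherwise the construction is applied to the straightened circuit, which is
  not larger than \<open>c\<close>.\<close>

lemma (in gadget) inverse_circuit:
  assumes rep: "represents_F P Q f" and c: "computes G c P Q f"
    and m: "m = maxlen P" and n: "n = maxlen Q" and s: "s = circuit_size c"
  obtains c' where "computes G c' Q P (inv_into P f)" "circuit_numbers c' = inv_nums (circuit_numbers c)"
    "circuit_size c' \<le> m * (m + 1) * s + (6 * ops_size hops + 1) * (m ^ 2 * n)"
proof (cases "m = 0")
  case True
  have n0: "n = 0" using represents_F_maxlen_0[OF rep] True m n by simp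
  define c' where "c' = \<lparr>circ_in = 0, circ_ops = [], circ_outs = []\<rparr>"
  have P: "finite P" "P = {[]}" and Q: "finite Q" "Q = {[]}" and bij: "bij_betw f P Q"
    using rep True n0 m n maxlen_0_iff by (auto simp: represents_F_def)
  have "inv_into P f [] \<in> P" using bij_betwE[OF bij_betw_inv_into[OF bij]] Q(2) by blast
  then have "padded Q P (inv_into P f) [] = []"
    using padded_pad[of Q "[]" P "inv_into P f"] P Q by (simp add: maxlen_def pad_def)
  then have "computes G c' Q P (inv_into P f)"
    using True n0 unfolding computes_def m[symmetric] n[symmetric]
    by (simp add: c'_def has_io_function_def wf_circuit_def eval_circuit_def)
  moreover have "ins (circuit_numbers c) = 0"
    using c True m by (simp add: ins_eq computes_def has_io_function_def)
  then have "circuit_numbers c' = inv_nums (circuit_numbers c)"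
    by (simp add: inv_nums_def c'_def circuit_numbers_def)
  moreover have "circuit_size c' = 0" by (simp add: c'_def circuit_size_def num_gates_def num_wires_def)
  ultimately show ?thesis using that by simp
next
  case False
  then have n_pos: "0 < n" using represents_F_maxlen_0[OF rep] m n by auto
  let ?ops = "straighten (circ_ops c)" and ?out = "\<lambda>l. origin (circ_ops c) (circ_outs c ! l)"
  have wf_c: "wf_circuit G c" and ins: "m = circ_in c" and outs: "n = length (circ_outs c)"
    and eval: "\<And>xs. length xs = m \<Longrightarrow> eval_circuit G c xs = padded P Q f xs"
    using c by (auto simp: computes_def has_io_function_def m n)
  have wf: "wf_ops G m (circ_ops c) []" "\<forall>p\<in>set (circ_outs c). p < m + new_wires G (circ_ops c)"
    using wf_c wf_ops_outs unfolding wf_circuit_def ins by blast+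
  have straight: "wf_ops G m ?ops []" "new_wires G ?ops = new_wires G (circ_ops c)"
    using straighten_correct[OF wf_gates, of "replicate m None" "circ_ops c"] wf(1) by simp_all
  have out: "?out l < m + new_wires G ?ops \<and> exec G ?ops xs ! ?out l = padded P Q f xs ! l"
    if "length xs = m" "l < n" for xs l
  proof -
    have "circ_outs c ! l < m + new_wires G (circ_ops c)" using wf(2) that(2) outs by simp
    moreover have "padded P Q f xs ! l = exec G (circ_ops c) xs ! (circ_outs c ! l)"
      using that outs eval[OF that(1), symmetric] by (simp add: eval_circuit_def)
    ultimately show ?thesis
      using straighten_correct[OF wf_gates, of xs "circ_ops c"] wf(1) that(1) straight(2) by simp
  qed
  interpret inverter G hops a ?ops ?out m n
  proof
    show "?out l < m + new_wires G ?ops" if "l < n" for l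
      using out[of "replicate m None" l] that by simp
  qed (use False n_pos swap_free_straighten straight in auto)
  have "F_element P Q f m n" by (rule F_element.intro[OF rep m n n_pos])
  then have 1: "computes G inv_circuit Q P (inv_into P f)"
    using out by (intro inv_circuit_computes) auto
  have 2: "circuit_numbers inv_circuit = inv_nums (circuit_numbers c)"
    using inv_nums_eq[OF wf_c refl ins outs refl] by simp
  have "ops_size ?ops \<le> s"
    using ops_size_straighten[of "circ_ops c"] by (simp add: s circuit_size_eq)
  then have 3: "circuit_size inv_circuit \<le> m * (m + 1) * s + (6 * ops_size hops + 1) * (m ^ 2 * n)"
    using size_bound[of s] by (simp add: circuit_size_eq inv_outs_def)
  show ?thesis by (rule that[OF 1 2 3])
qed

theorem theorem7p6:
  fixes G :: "gate list"
  assumes "wf_gates G" and "universal G"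
  shows "\<exists>(C::nat) (M::tm) (a::nat) (k::nat). wf_tm M \<and>
    (\<forall>P Q f c m n s.
       represents_F P Q f \<and> m = maxlen P \<and> n = maxlen Q \<and>
       computes G c P Q f \<and> s = circuit_size c \<longrightarrow>
       (\<exists>c'. computes G c' Q P (inv_into P f) \<and>
             circuit_size c' \<le> m * (m + 1) * s + C * (m ^ 2 * n) \<and>
             tm_outputs_within M (enc_circuit c) (enc_circuit c') (a * (s + m + n + 1) ^ k)))"
proof -
  \<comment> \<open>The gadget depends on \<open>G\<close> alone and is chosen before
    \<open>P\<close>, \<open>Q\<close>, \<open>f\<close> and \<open>c\<close>, so its size may enter
    the constant \<open>C\<close> and its operations the machine.\<close>
  obtain hops a where "gadget G hops a" using gadget_exists[OF assms] by blast
  then interpret gadget G hops a .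
  obtain M b l where M: "wf_tm M"
    and run: "\<And>I. tm_outputs_within M (encs I) (encs (inv_nums I)) (b * (length (encs I) + 1) ^ l)"
    using poly_printable_machine[OF poly_printable_inv_nums] by blast
  \<comment> \<open>The factor of \<open>length_enc_circuit_le\<close>. The encoding is of quadratic
    length, so the degree \<open>l\<close> of the running time becomes \<open>2 * l\<close> in terms
    of \<open>s + m + n + 1\<close>.\<close>
  let ?K = "(length G + sum_list (map gate_out G) + 9) * 7"
  have "\<exists>c'. computes G c' Q P (inv_into P f) \<and>
      circuit_size c' \<le> m * (m + 1) * s + (6 * ops_size hops + 1) * (m ^ 2 * n) \<and>
      tm_outputs_within M (enc_circuit c) (enc_circuit c') (b * (?K + 1) ^ l * (s + m + n + 1) ^ (2 * l))"
    if rep: "represents_F P Q f" and m: "m = maxlen P" and n: "n = maxlen Q"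
      and c: "computes G c P Q f" and s: "s = circuit_size c" for P Q f c m n s
  proof -
    obtain c' where c': "computes G c' Q P (inv_into P f)"
      "circuit_numbers c' = inv_nums (circuit_numbers c)"
      "circuit_size c' \<le> m * (m + 1) * s + (6 * ops_size hops + 1) * (m ^ 2 * n)"
      using inverse_circuit[OF rep c m n s] by blast
    have wf: "wf_circuit G c" "circ_in c = m" using c by (auto simp: computes_def has_io_function_def m)
    let ?X = "s + m + n + 1"
    have "length (encs (circuit_numbers c)) \<le> ?K * (s + m + 1) ^ 2"
      using length_enc_circuit_le[OF wf(1)] unfolding wf(2) s .
    also have "\<dots> \<le> ?K * ?X ^ 2" by (intro mult_le_mono2 power_mono) simp_all
    finally have "length (encs (circuit_numbers c)) + 1 \<le> (?K + 1) * ?X ^ 2"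
      using one_le_power[of ?X 2] unfolding distrib_right by linarith
    then have "(length (encs (circuit_numbers c)) + 1) ^ l \<le> ((?K + 1) * ?X ^ 2) ^ l"
      by (rule power_mono) simp
    also have "\<dots> = (?K + 1) ^ l * ?X ^ (2 * l)" by (simp only: power_mult_distrib power_mult)
    finally have "b * (length (encs (circuit_numbers c)) + 1) ^ l \<le> b * (?K + 1) ^ l * ?X ^ (2 * l)"
      by (simp only: mult.assoc mult_le_mono2)
    then have "tm_outputs_within M (encs (circuit_numbers c)) (encs (circuit_numbers c'))
        (b * (?K + 1) ^ l * ?X ^ (2 * l))"
      using run[of "circuit_numbers c"] unfolding c'(2) tm_outputs_within_def by (meson le_trans)
    then have "tm_outputs_within M (enc_circuit c) (enc_circuit c') (b * (?K + 1) ^ l * ?X ^ (2 * l))"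
      by (simp only: enc_circuit_def encs_def)
    then show ?thesis using c' by blast
  qed
  then show ?thesis using M by blast
qed

end
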